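(* Let $p$ be a prime number, let $A$ be a commutative unital ring containing the prime field $\mathbb{F}_p$, and let $G$ be a finite group of automorphisms of $A$. Let $N$ be the normal subgroup of $G$ generated by the $2$-reflections (for the action of $G$ on $A$). Suppose that $A^N$ is Cohen-Macaulay, $A^G$ is noetherian, and $A^N$ is finite over $A^G$ (i.e. finitely generated as an $A^G$-module). If there is a prime ideal $\mathfrak{P}$ of $A^N$ whose inertia group $I_{G/N}(\mathfrak{P})$ for the action of $G/N$ on $A^N$ is a nontrivial $p$-group, then $A^G$ is not Cohen-Macaulay.
   Context: For a group $H$ acting on a commutative ring $R$ by automorphisms, $R^H$ denotes the subring of invariants. For $g\in H$, $(g-1)R=\{ga-a: a\in R\}$. For a natural number $t$, $g\in H$ is called a $t$-reflection (on $R$) if the ideal of $R$ generated by $(g-1)R$ is contained in a prime ideal of $R$ of height $\leq t$. The inertia group of a prime $\mathfrak{P}$ of $R$ is $I_H(\mathfrak{P})=\{g\in H: (g-1)R\subset \mathfrak{P}\}$. If $N$ is normal in $G$, then $G/N$ acts on $A^N$. A commutative ring is Cohen-Macaulay if it is noetherian and each of its localizations at maximal (equivalently, prime) ideals has depth equal to its dimension. *)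

theory Defs
  imports "HOL-Algebra.Algebra" "HOL-Library.Extended_Nat"
begin

section \<open>Automorphisms, invariants, reflections and inertia\<close>

text \<open>As for \<^const>\<open>AutoGroup\<close>, automorphisms are extensional functions, so that
  equality in the group is equality of functions on the carrier.\<close>

definition ring_aut_group :: "('a, 'b) ring_scheme \<Rightarrow> ('a \<Rightarrow> 'a) monoid" where
  "ring_aut_group R =
     BijGroup (carrier R)\<lparr>carrier := ring_hom R R \<inter> Bij (carrier R)\<rparr>"

definition invariant_ring ::
    "('a, 'b) ring_scheme \<Rightarrow> ('a \<Rightarrow> 'a) set \<Rightarrow> ('a, 'b) ring_scheme" where
  "invariant_ring R H = R\<lparr>carrier := {a \<in> carrier R. \<forall>g\<in>H. g a = a}\<rparr>"

text \<open>The set $(g-1)R$.\<close>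

definition displacement :: "('a, 'b) ring_scheme \<Rightarrow> ('a \<Rightarrow> 'a) \<Rightarrow> 'a set" where
  "displacement R g = (\<lambda>a. g a \<ominus>\<^bsub>R\<^esub> a) ` carrier R"

definition prime_chain :: "('a, 'b) ring_scheme \<Rightarrow> nat \<Rightarrow> (nat \<Rightarrow> 'a set) \<Rightarrow> bool" where
  "prime_chain R n C \<longleftrightarrow>
     (\<forall>i\<le>n. primeideal (C i) R) \<and> (\<forall>i<n. C i \<subset> C (Suc i))"

definition height :: "('a, 'b) ring_scheme \<Rightarrow> 'a set \<Rightarrow> enat" where
  "height R P = Sup {enat n | n. \<exists>C. prime_chain R n C \<and> C n = P}"

definition t_reflection :: "('a, 'b) ring_scheme \<Rightarrow> nat \<Rightarrow> ('a \<Rightarrow> 'a) \<Rightarrow> bool" where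
  "t_reflection R t g \<longleftrightarrow>
     (\<exists>P. primeideal P R \<and> genideal R (displacement R g) \<subseteq> P \<and> height R P \<le> enat t)"

text \<open>Here \<open>\<phi>\<close> is the action of the group \<open>H\<close> on the ring \<open>R\<close>.\<close>

definition inertia_group ::
    "('g, 'h) monoid_scheme \<Rightarrow> ('g \<Rightarrow> 'a \<Rightarrow> 'a) \<Rightarrow> ('a, 'b) ring_scheme \<Rightarrow> 'a set \<Rightarrow> 'g set"
  where "inertia_group H \<phi> R P = {g \<in> carrier H. displacement R (\<phi> g) \<subseteq> P}"

text \<open>The action of $G/N$ on $A^N$: all members of a coset of \<open>N\<close> agree on an
  \<open>N\<close>-invariant element, and the coset sends that element to their common value.\<close>

definition coset_action :: "('a \<Rightarrow> 'a) set \<Rightarrow> 'a \<Rightarrow> 'a" where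
  "coset_action C a = the_elem ((\<lambda>g. g a) ` C)"

section \<open>Finite ring extensions\<close>

text \<open>For a subring \<open>B\<close> of \<open>S\<close>: the ring \<open>S\<close> is finitely generated as a \<open>B\<close>-module.\<close>

definition finite_over :: "('a, 'c) ring_scheme \<Rightarrow> ('a, 'b) ring_scheme \<Rightarrow> bool" where
  "finite_over S B \<longleftrightarrow>
     (\<exists>U. finite U \<and> U \<subseteq> carrier S \<and>
        (\<forall>s\<in>carrier S. \<exists>c\<in>(U \<rightarrow> carrier B). s = (\<Oplus>\<^bsub>S\<^esub>x\<in>U. c x \<otimes>\<^bsub>S\<^esub> x)))"

section \<open>Localization\<close>

text \<open>The fraction $r/s$ is the class of \<open>(r, s)\<close> in \<open>R \<times> S\<close>, where
  $r/s = r'/s'$ means that $t(rs' - r's) = 0$ for some \<open>t \<in> S\<close>.\<close>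

definition fraction :: "('a, 'b) ring_scheme \<Rightarrow> 'a set \<Rightarrow> 'a \<Rightarrow> 'a \<Rightarrow> ('a \<times> 'a) set" where
  "fraction R S r s =
     {(r', s') \<in> carrier R \<times> S.
        \<exists>t\<in>S. t \<otimes>\<^bsub>R\<^esub> (r \<otimes>\<^bsub>R\<^esub> s' \<ominus>\<^bsub>R\<^esub> r' \<otimes>\<^bsub>R\<^esub> s) = \<zero>\<^bsub>R\<^esub>}"

definition localization :: "('a, 'b) ring_scheme \<Rightarrow> 'a set \<Rightarrow> ('a \<times> 'a) set ring" where
  "localization R S =
     \<lparr>carrier = {fraction R S r s | r s. r \<in> carrier R \<and> s \<in> S},
      monoid.mult = (\<lambda>U V. \<Union>(r, s)\<in>U. \<Union>(r', s')\<in>V. fraction R S (r \<otimes>\<^bsub>R\<^esub> r') (s \<otimes>\<^bsub>R\<^esub> s')),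
      one = fraction R S \<one>\<^bsub>R\<^esub> \<one>\<^bsub>R\<^esub>,
      ring.zero = fraction R S \<zero>\<^bsub>R\<^esub> \<one>\<^bsub>R\<^esub>,
      add = (\<lambda>U V. \<Union>(r, s)\<in>U. \<Union>(r', s')\<in>V.
               fraction R S (r \<otimes>\<^bsub>R\<^esub> s' \<oplus>\<^bsub>R\<^esub> r' \<otimes>\<^bsub>R\<^esub> s) (s \<otimes>\<^bsub>R\<^esub> s'))\<rparr>"

definition localization_at :: "('a, 'b) ring_scheme \<Rightarrow> 'a set \<Rightarrow> ('a \<times> 'a) set ring" where
  "localization_at R P = localization R (carrier R - P)"

section \<open>Dimension, depth and Cohen-Macaulay rings\<close>

definition krull_dim :: "('a, 'b) ring_scheme \<Rightarrow> enat" where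
  "krull_dim R = Sup {enat n | n. \<exists>C. prime_chain R n C}"

text \<open>Each \<open>x\<^sub>i\<close> is a nonzerodivisor on $R/(x_1,\ldots,x_{i-1})$ (spelled out in \<open>R\<close>),
  and $R/(x_1,\ldots,x_n)$ is nonzero.\<close>

definition regular_sequence :: "('a, 'b) ring_scheme \<Rightarrow> 'a list \<Rightarrow> bool" where
  "regular_sequence R xs \<longleftrightarrow>
     set xs \<subseteq> carrier R \<and>
     (\<forall>i<length xs. \<forall>a\<in>carrier R.
        xs ! i \<otimes>\<^bsub>R\<^esub> a \<in> genideal R (set (take i xs)) \<longrightarrow> a \<in> genideal R (set (take i xs))) \<and>
     genideal R (set xs) \<noteq> carrier R"

text \<open>For local \<open>R\<close>; the unique maximal ideal is the \<open>THE\<close>-term.\<close>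

definition local_depth :: "('a, 'b) ring_scheme \<Rightarrow> enat" where
  "local_depth R =
     Sup {enat (length xs) | xs. regular_sequence R xs \<and> set xs \<subseteq> (THE m. maximalideal m R)}"

definition cohen_macaulay :: "('a, 'b) ring_scheme \<Rightarrow> bool" where
  "cohen_macaulay R \<longleftrightarrow>
     cring R \<and> noetherian_ring R \<and>
     (\<forall>M. maximalideal M R \<longrightarrow>
        local_depth (localization_at R M) = krull_dim (localization_at R M))"

end

theory Submission
  imports Defs
begin

text \<open>
  Put $B = A^N$, $\Gamma = G/N$ and $C = A^G = B^\Gamma$, and let $I \subseteq \Gamma$ be the inertia
  group of $\mathfrak{P}$. A nontrivial $p$-group has a nonzero homomorphism $\chi$ to
  $\mathbb{Z}/p$, which is a 1-cocycle of $I$ with values in $B$. It is not a coboundary locally at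
  $\mathfrak{P}$, because coboundaries vanish modulo $\mathfrak{P}$. It is killed by
  the traces from $B$ to $B^I$. Since $\Gamma$ contains no 2-reflections on $B$, independence of
  characters modulo a prime shows that the ideal $J$ of all $x \in C$ killing $\chi$ lies in no prime
  of height at most 2.

  If $B$ and $C$ were Cohen--Macaulay, one could choose $x_1, x_2, x_3 \in J$ forming a regular
  sequence locally on $C$, with $x_1, x_2$ also regular locally on $B$. Write
  $x_i \chi(g) = (g-1)\beta_i$. The elements $u_{ij} = x_i\beta_j - x_j\beta_i$ of $B^I$ satisfy
  $x_1u_{23} - x_2u_{13} + x_3u_{12} = 0$. As $C \to B^I$ is etale at $\mathfrak{P}$, regularity on $C$
  gives $u_{12} \in (x_1, x_2)B^I$ locally. Then $\beta_1$ may be changed by an element of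
  $B^I$ to become divisible by $x_1$, and $\chi$ is a local coboundary, a contradiction. Instead of
  etaleness, the proof uses functions $\varphi(g) = \sum_j g(y_j) z_j$ on $\Gamma$ with
  $y_j, z_j \in B^I$ that vanish off $I$ and satisfy $\varphi(1) \notin \mathfrak{P}$, since then
  $\varphi(1) u = \sum_j \mathrm{Tr}_{\Gamma/I}(u y_j) z_j$ for $u \in B^I$.
\<close>

section \<open>Ideals and prime avoidance\<close>

text \<open>The bound 2 on heights and the number of three elements belong together: in a
  Cohen-Macaulay local ring the zero divisors modulo a regular sequence of length l lie in finitely
  many primes of height at most l, and l is at most 2 in the three choices. Depth is a supremum over
  arbitrary sequences, so it must be known first that a sequence already begun extends to full
  length, that is, that depth does not depend on the elements chosen. The obstacle in the middle
  ring is that the ring of I-invariants is not known to be Cohen-Macaulay. Regularity is therefore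
  used only on B and on C, and the relation among the u_ij is brought down to C by traces. That G/N
  has no 2-reflections on A^N also needs an argument. A prime of A above a prime of height at most 2
  has height at most 2 again, so its inertia group lies in N, and an element acting trivially on A^N
  modulo it must then lie in N. The same detection result, applied to I, supplies the invariant
  elements from which the functions vanishing off I are built.\<close>

context cring begin

lemma ideal_intro:
  assumes "I \<subseteq> carrier R" "\<zero> \<in> I"
    and "\<And>a b. a \<in> I \<Longrightarrow> b \<in> I \<Longrightarrow> a \<oplus> b \<in> I"
    and "\<And>r a. r \<in> carrier R \<Longrightarrow> a \<in> I \<Longrightarrow> r \<otimes> a \<in> I"
  shows "ideal I R"
proof (rule idealI[OF ring_axioms])
  have inv: "\<ominus> a \<in> I" if "a \<in> I" for a
  proof -
    have "(\<ominus> \<one>) \<otimes> a \<in> I" using assms(4) that by simp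
    moreover have "a \<in> carrier R" using that assms(1) by auto
    ultimately show ?thesis by (simp add: l_minus)
  qed
  show "subgroup I (add_monoid R)"
    by (rule add.subgroupI) (use assms inv in \<open>auto simp: a_inv_def\<close>)
  fix a x assume a: "a \<in> I" and x: "x \<in> carrier R"
  show "x \<otimes> a \<in> I" using assms(4) a x by simp
  then show "a \<otimes> x \<in> I" using a x assms(1) by (metis m_comm subsetD)
qed

lemma ideal_carr: "ideal I R \<Longrightarrow> a \<in> I \<Longrightarrow> a \<in> carrier R"
  by (rule ideal.Icarr)

lemma ideal_zero: "ideal I R \<Longrightarrow> \<zero> \<in> I"
  by (simp add: additive_subgroup.zero_closed ideal.axioms(1))

lemma ideal_add: "ideal I R \<Longrightarrow> a \<in> I \<Longrightarrow> b \<in> I \<Longrightarrow> a \<oplus> b \<in> I"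
  by (simp add: additive_subgroup.a_closed ideal.axioms(1))

lemma ideal_uminus: "ideal I R \<Longrightarrow> a \<in> I \<Longrightarrow> \<ominus> a \<in> I"
  by (simp add: additive_subgroup.a_inv_closed ideal.axioms(1))

lemma ideal_diff: "ideal I R \<Longrightarrow> a \<in> I \<Longrightarrow> b \<in> I \<Longrightarrow> a \<ominus> b \<in> I"
  by (simp add: a_minus_def ideal_add ideal_uminus)

lemma ideal_mult: "ideal I R \<Longrightarrow> a \<in> I \<Longrightarrow> r \<in> carrier R \<Longrightarrow> r \<otimes> a \<in> I"
  by (rule ideal.I_l_closed)

lemma ideal_mult_right: "ideal I R \<Longrightarrow> a \<in> I \<Longrightarrow> r \<in> carrier R \<Longrightarrow> a \<otimes> r \<in> I"
  by (rule ideal.I_r_closed)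

lemma ideal_cancel_right:
  assumes "ideal I R" "a \<ominus> b \<in> I" "b \<in> I" "a \<in> carrier R" shows "a \<in> I"
proof -
  have b: "b \<in> carrier R" using assms ideal_carr by blast
  have "(a \<ominus> b) \<oplus> b \<in> I" using assms ideal_add by blast
  moreover have "(a \<ominus> b) \<oplus> b = a" using b assms(4) by (simp add: a_minus_def a_assoc l_neg)
  ultimately show ?thesis by simp
qed

lemma ideal_cancel_left:
  assumes "ideal I R" "a \<ominus> b \<in> I" "a \<in> I" "b \<in> carrier R" shows "b \<in> I"
proof -
  have a: "a \<in> carrier R" using assms ideal_carr by blast
  have "a \<ominus> (a \<ominus> b) \<in> I" using assms ideal_diff by blast
  moreover have "a \<ominus> (a \<ominus> b) = b" using a assms(4) by (simp add: a_minus_def minus_add r_neg2)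
  ultimately show ?thesis by simp
qed

lemma ideal_finsum:
  assumes "ideal I R" "\<And>k. k \<in> K \<Longrightarrow> f k \<in> I"
  shows "(\<Oplus>k\<in>K. f k) \<in> I"
  using assms(2)
proof (induction K rule: infinite_finite_induct)
  case (insert x F)
  have "f \<in> F \<rightarrow> carrier R" "f x \<in> carrier R" using insert.prems ideal_carr[OF assms(1)] by auto
  then have "finsum R f (insert x F) = f x \<oplus> finsum R f F"
    by (rule finsum_insert[OF insert.hyps])
  then show ?case using insert ideal_add[OF assms(1)] by auto
qed (auto simp: ideal_zero[OF assms(1)])

lemma prime_finprod:
  assumes "primeideal P R" "finite K" "f \<in> K \<rightarrow> carrier R" "(\<Otimes>k\<in>K. f k) \<in> P"
  shows "\<exists>k\<in>K. f k \<in> P"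
  using assms(2-)
proof (induction K rule: finite_induct)
  case empty
  then have "\<one> \<in> P" by simp
  then show ?case
    by (metis assms(1) ideal.one_imp_carrier primeideal.I_notcarr primeideal.axioms(1))
next
  case (insert x F)
  have "finprod R f (insert x F) = f x \<otimes> finprod R f F"
    using insert by (intro finprod_insert) auto
  then show ?case
    using insert primeideal.I_prime[OF assms(1), of "f x" "finprod R f F"] by auto
qed

lemma ideal_finprod:
  assumes "ideal I R" "finite K" "f \<in> K \<rightarrow> carrier R" "k \<in> K" "f k \<in> I"
  shows "(\<Otimes>k\<in>K. f k) \<in> I"
proof -
  have "finprod R f (insert k (K - {k})) = f k \<otimes> finprod R f (K - {k})"
    using assms by (intro finprod_insert) auto
  moreover have "insert k (K - {k}) = K" using assms by auto
  moreover have "finprod R f (K - {k}) \<in> carrier R" using assms(3) by (intro finprod_closed) auto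
  ultimately show ?thesis using assms ideal_mult_right by simp
qed

lemma prime_one_notin: "primeideal P R \<Longrightarrow> \<one> \<notin> P"
  by (metis ideal.one_imp_carrier primeideal.I_notcarr primeideal.axioms(1))

lemma prime_pow:
  assumes "primeideal P R" "a \<in> carrier R" "a [^] (n::nat) \<in> P" shows "a \<in> P"
  using assms(3)
proof (induction n)
  case 0
  then show ?case using prime_one_notin[OF assms(1)] by simp
next
  case (Suc n)
  then show ?case using primeideal.I_prime[OF assms(1), of "a [^] n" a] assms(2) by auto
qed

text \<open>The carrier conditions are part of the relation, so that chains of congruences carry
  their own side conditions.\<close>

definition congr :: "'a set \<Rightarrow> 'a \<Rightarrow> 'a \<Rightarrow> bool" where
  "congr I a b \<longleftrightarrow> a \<in> carrier R \<and> b \<in> carrier R \<and> a \<ominus> b \<in> I"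

lemma congr_carr: "congr I a b \<Longrightarrow> a \<in> carrier R" "congr I a b \<Longrightarrow> b \<in> carrier R"
  by (auto simp: congr_def)

lemma congr_refl: "ideal I R \<Longrightarrow> a \<in> carrier R \<Longrightarrow> congr I a a"
  by (simp add: congr_def ideal_zero a_minus_def r_neg)

lemma congr_sym:
  assumes "ideal I R" "congr I a b" shows "congr I b a"
proof -
  have c: "a \<in> carrier R" "b \<in> carrier R" using assms congr_carr by auto
  then have "b \<ominus> a = \<ominus> (a \<ominus> b)" by (simp add: a_minus_def minus_add a_comm)
  then show ?thesis using assms c ideal_uminus[OF assms(1)] by (simp add: congr_def)
qed

lemma congr_trans:
  assumes "ideal I R" "congr I a b" "congr I b c" shows "congr I a c"
proof -
  have c: "a \<in> carrier R" "b \<in> carrier R" "c \<in> carrier R" using assms congr_carr by auto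
  then have "a \<ominus> c = (a \<ominus> b) \<oplus> (b \<ominus> c)"
    by (simp add: a_minus_def a_assoc r_neg1)
  then show ?thesis using assms c ideal_add[OF assms(1)] by (simp add: congr_def)
qed

lemma congr_add:
  assumes "ideal I R" "congr I a b" "congr I c d" shows "congr I (a \<oplus> c) (b \<oplus> d)"
proof -
  have c: "a \<in> carrier R" "b \<in> carrier R" "c \<in> carrier R" "d \<in> carrier R"
    using assms congr_carr by auto
  then have "(a \<oplus> c) \<ominus> (b \<oplus> d) = (a \<ominus> b) \<oplus> (c \<ominus> d)"
    by (simp add: a_minus_def minus_add a_ac)
  then show ?thesis using assms c ideal_add[OF assms(1)] by (simp add: congr_def)
qed

lemma congr_mult_left:
  assumes "ideal I R" "r \<in> carrier R" "congr I a b" shows "congr I (r \<otimes> a) (r \<otimes> b)"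
proof -
  have c: "a \<in> carrier R" "b \<in> carrier R" using assms congr_carr by auto
  then have "r \<otimes> a \<ominus> r \<otimes> b = r \<otimes> (a \<ominus> b)" using assms(2)
    by (simp add: a_minus_def r_distr r_minus)
  then show ?thesis using assms c ideal_mult[OF assms(1)] by (simp add: congr_def)
qed

lemma congr_mult:
  assumes I: "ideal I R" and ab: "congr I a b" and cd: "congr I c d"
  shows "congr I (a \<otimes> c) (b \<otimes> d)"
proof -
  have c: "a \<in> carrier R" "b \<in> carrier R" "c \<in> carrier R" "d \<in> carrier R"
    using assms congr_carr by auto
  have "congr I (c \<otimes> a) (c \<otimes> b)" using congr_mult_left[OF I c(3) ab] .
  moreover have "congr I (b \<otimes> c) (b \<otimes> d)" using congr_mult_left[OF I c(2) cd] .
  ultimately show ?thesis using congr_trans[OF I] c by (simp add: m_comm)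
qed

lemma congr_mem: "ideal I R \<Longrightarrow> congr I a b \<Longrightarrow> a \<in> I \<longleftrightarrow> b \<in> I"
  unfolding congr_def using ideal_cancel_left ideal_cancel_right by blast

lemma congr_mono: "congr I a b \<Longrightarrow> I \<subseteq> J \<Longrightarrow> congr J a b"
  by (auto simp: congr_def)

lemma mem_congr_zero: "ideal I R \<Longrightarrow> a \<in> I \<Longrightarrow> congr I a \<zero>"
  using ideal_carr by (simp add: congr_def a_minus_def)

definition add_principal :: "'a set \<Rightarrow> 'a \<Rightarrow> 'a set" where
  "add_principal I x = {a. \<exists>r\<in>carrier R. congr I a (x \<otimes> r)}"

lemma add_principal_ideal:
  assumes I: "ideal I R" and x: "x \<in> carrier R"
  shows "ideal (add_principal I x) R"
proof (rule ideal_intro)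
  show "add_principal I x \<subseteq> carrier R" by (auto simp: add_principal_def congr_carr)
  have "congr I \<zero> (x \<otimes> \<zero>)" using congr_refl[OF I] x by simp
  then show "\<zero> \<in> add_principal I x" unfolding add_principal_def by blast
next
  fix a b assume "a \<in> add_principal I x" "b \<in> add_principal I x"
  then obtain r s where rs: "r \<in> carrier R" "s \<in> carrier R"
    "congr I a (x \<otimes> r)" "congr I b (x \<otimes> s)" by (auto simp: add_principal_def)
  have "congr I (a \<oplus> b) (x \<otimes> (r \<oplus> s))"
    using congr_add[OF I rs(3,4)] rs x by (simp add: r_distr)
  then show "a \<oplus> b \<in> add_principal I x" using rs unfolding add_principal_def by blast
next
  fix c a assume c: "c \<in> carrier R" and "a \<in> add_principal I x"
  then obtain r where rs: "r \<in> carrier R" "congr I a (x \<otimes> r)" by (auto simp: add_principal_def)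
  have "congr I (c \<otimes> a) (x \<otimes> (c \<otimes> r))"
    using congr_mult_left[OF I c rs(2)] rs x c by (simp add: m_lcomm)
  then show "c \<otimes> a \<in> add_principal I x" using rs c unfolding add_principal_def by blast
qed

lemma add_principal_superset:
  assumes I: "ideal I R" and x: "x \<in> carrier R"
  shows "I \<subseteq> add_principal I x"
proof
  fix a assume "a \<in> I"
  then have "congr I a (x \<otimes> \<zero>)" using mem_congr_zero[OF I] x by simp
  then show "a \<in> add_principal I x" unfolding add_principal_def by blast
qed

lemma add_principal_self:
  assumes I: "ideal I R" and x: "x \<in> carrier R"
  shows "x \<in> add_principal I x"
  using congr_refl[OF I x] x unfolding add_principal_def by (auto intro!: bexI[of _ \<one>])

section \<open>Ideals maximal away from a set\<close>

lemma chain_ideal_Union: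
  assumes "\<C> \<noteq> {}" "subset.chain {I. ideal I R} \<C>"
  shows "ideal (\<Union>\<C>) R"
proof (rule ideal_intro)
  have id: "ideal I R" if "I \<in> \<C>" for I using that assms(2) by (auto simp: subset.chain_def)
  show "\<Union>\<C> \<subseteq> carrier R" using id ideal_carr by blast
  show "\<zero> \<in> \<Union>\<C>" using assms(1) id ideal_zero by blast
  fix a b assume "a \<in> \<Union>\<C>" "b \<in> \<Union>\<C>"
  then obtain I J where IJ: "I \<in> \<C>" "J \<in> \<C>" "a \<in> I" "b \<in> J" by blast
  then have "I \<subseteq> J \<or> J \<subseteq> I" using assms(2) unfolding subset_chain_def by auto
  then obtain K where "K \<in> \<C>" "a \<in> K" "b \<in> K" using IJ by blast
  then show "a \<oplus> b \<in> \<Union>\<C>" using id ideal_add by blast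
next
  fix r a assume "r \<in> carrier R" "a \<in> \<Union>\<C>"
  then show "r \<otimes> a \<in> \<Union>\<C>" using assms(2) ideal_mult by (auto simp: subset.chain_def) blast
qed

text \<open>Zorn's lemma, with maximality recorded as a relation: adjoining any further
  \<open>x\<close> to \<open>Q\<close> reaches \<open>S\<close>. The set \<open>S\<close> is
  arbitrary here; it is \<open>{\<one>}\<close> for maximal ideals and the complement of a prime of
  the invariants for lying over.\<close>

lemma ideal_maximal_disjoint:
  assumes I: "ideal I R" "I \<inter> S = {}"
  obtains Q where "ideal Q R" "I \<subseteq> Q" "Q \<inter> S = {}"
    "\<And>x. x \<in> carrier R \<Longrightarrow> x \<notin> Q \<Longrightarrow> \<exists>r\<in>carrier R. \<exists>s\<in>S. congr Q s (x \<otimes> r)"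
proof -
  define \<A> where "\<A> = {J. ideal J R \<and> I \<subseteq> J \<and> J \<inter> S = {}}"
  have ne: "\<A> \<noteq> {}" using I unfolding \<A>_def by blast
  have "\<exists>M\<in>\<A>. \<forall>Y\<in>\<A>. M \<subseteq> Y \<longrightarrow> Y = M"
  proof (rule subset_Zorn_nonempty[OF ne])
    fix \<C> assume C: "\<C> \<noteq> {}" "subset.chain \<A> \<C>"
    have sub: "\<C> \<subseteq> \<A>" using C(2) by (auto simp: subset.chain_def)
    have "subset.chain {I. ideal I R} \<C>"
      using C(2) unfolding subset_chain_def \<A>_def by auto
    then have "ideal (\<Union>\<C>) R" using chain_ideal_Union C(1) by blast
    moreover have "I \<subseteq> \<Union>\<C>" using sub C(1) unfolding \<A>_def by blast
    moreover have "\<Union>\<C> \<inter> S = {}" using sub unfolding \<A>_def by fastforce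
    ultimately show "\<Union>\<C> \<in> \<A>" unfolding \<A>_def by simp
  qed
  then obtain Q where QA: "Q \<in> \<A>" and maxA: "\<And>Y. Y \<in> \<A> \<Longrightarrow> Q \<subseteq> Y \<Longrightarrow> Y = Q"
    by blast
  have Q: "ideal Q R" "I \<subseteq> Q" "Q \<inter> S = {}" using QA by (auto simp: \<A>_def)
  have max: "Y = Q" if "ideal Y R" "I \<subseteq> Y" "Y \<inter> S = {}" "Q \<subseteq> Y" for Y
    using maxA[of Y] that by (simp add: \<A>_def)
  have "\<exists>r\<in>carrier R. \<exists>s\<in>S. congr Q s (x \<otimes> r)" if x: "x \<in> carrier R" "x \<notin> Q" for x
  proof -
    have "add_principal Q x \<inter> S \<noteq> {}"
      using max[of "add_principal Q x"] add_principal_ideal[OF Q(1) x(1)]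
        add_principal_superset[OF Q(1) x(1)] add_principal_self[OF Q(1) x(1)] Q x by blast
    then show ?thesis unfolding add_principal_def by blast
  qed
  with Q that show thesis by blast
qed

text \<open>For a and b outside \<open>Q\<close>, the relations s = a r and s' = b r' modulo
  \<open>Q\<close> multiply: if a b were in \<open>Q\<close>, so would be s s', which belongs to
  \<open>S\<close>.\<close>

lemma maximal_disjoint_prime:
  assumes Q: "ideal Q R" "Q \<inter> S = {}"
    and max: "\<And>x. x \<in> carrier R \<Longrightarrow> x \<notin> Q \<Longrightarrow> \<exists>r\<in>carrier R. \<exists>s\<in>S. congr Q s (x \<otimes> r)"
    and S: "S \<subseteq> carrier R" "\<one> \<in> S" "\<And>s t. s \<in> S \<Longrightarrow> t \<in> S \<Longrightarrow> s \<otimes> t \<in> S"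
  shows "primeideal Q R"
proof (rule primeidealI[OF Q(1) cring_axioms])
  show "carrier R \<noteq> Q" using Q(2) S by blast
  fix a b assume ab: "a \<in> carrier R" "b \<in> carrier R" "a \<otimes> b \<in> Q"
  show "a \<in> Q \<or> b \<in> Q"
  proof (rule ccontr)
    assume "\<not> ?thesis"
    then obtain r s r' s' where rs: "r \<in> carrier R" "s \<in> S" "congr Q s (a \<otimes> r)"
        "r' \<in> carrier R" "s' \<in> S" "congr Q s' (b \<otimes> r')"
      using max[of a] max[of b] ab by blast
    have c: "s \<in> carrier R" "s' \<in> carrier R" using rs S by auto
    have "congr Q (s \<otimes> s') ((a \<otimes> r) \<otimes> (b \<otimes> r'))" using congr_mult[OF Q(1)] rs by blast
    moreover have "(a \<otimes> r) \<otimes> (b \<otimes> r') = (r \<otimes> r') \<otimes> (a \<otimes> b)"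
      using rs ab by (simp add: m_ac)
    ultimately have "s \<otimes> s' \<in> Q"
      using ideal_mult[OF Q(1) ab(3)] rs congr_mem[OF Q(1)] by simp
    then show False using S(3)[OF rs(2,5)] Q(2) by blast
  qed
qed

lemma maximalideal_exists:
  assumes I: "ideal I R" "\<one> \<notin> I"
  obtains M where "maximalideal M R" "I \<subseteq> M"
proof -
  obtain Q where Q: "ideal Q R" "I \<subseteq> Q" "Q \<inter> {\<one>} = {}"
    "\<And>x. x \<in> carrier R \<Longrightarrow> x \<notin> Q \<Longrightarrow> \<exists>r\<in>carrier R. \<exists>s\<in>{\<one>}. congr Q s (x \<otimes> r)"
    using ideal_maximal_disjoint[of I "{\<one>}"] I by blast
  have "maximalideal Q R"
  proof (rule maximalidealI[OF Q(1)])
    show "carrier R \<noteq> Q" using Q(3) by blast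
    fix J assume J: "ideal J R" "Q \<subseteq> J" "J \<subseteq> carrier R"
    show "J = Q \<or> J = carrier R"
    proof (rule disjCI, rule ccontr)
      assume "J \<noteq> carrier R" "J \<noteq> Q"
      then obtain x where x: "x \<in> J" "x \<notin> Q" using J by blast
      then have xc: "x \<in> carrier R" using J by blast
      obtain r where r: "r \<in> carrier R" "congr Q \<one> (x \<otimes> r)" using Q(4)[OF xc x(2)] by blast
      have "x \<otimes> r \<in> J" using J(1) x(1) r(1) ideal_mult_right by blast
      then have "\<one> \<in> J" using congr_mem[OF J(1) congr_mono[OF r(2) J(2)]] by blast
      then show False using \<open>J \<noteq> carrier R\<close> J(1) ideal.one_imp_carrier by blast
    qed
  qed
  then show thesis using that Q by blast
qed

text \<open>Otherwise each member of \<open>F\<close> has an element outside \<open>P\<close>, and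
  the product of these elements lies in every member, hence in \<open>P\<close>. The intersection is
  spelled out elementwise inside the carrier, so that an empty \<open>F\<close> stands for the whole
  ring.\<close>

lemma prime_Int_subset:
  assumes "primeideal P R" "finite F" "\<And>I. I \<in> F \<Longrightarrow> ideal I R"
    and "\<And>a. a \<in> carrier R \<Longrightarrow> (\<And>I. I \<in> F \<Longrightarrow> a \<in> I) \<Longrightarrow> a \<in> P"
  shows "\<exists>I\<in>F. I \<subseteq> P"
proof (rule ccontr)
  assume "\<not> ?thesis"
  then have "\<forall>I\<in>F. \<exists>a. a \<in> I \<and> a \<notin> P" by blast
  then obtain f where f: "\<And>I. I \<in> F \<Longrightarrow> f I \<in> I \<and> f I \<notin> P" by metis
  have fc: "f \<in> F \<rightarrow> carrier R" using f assms(3) ideal_carr by blast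
  have "finprod R f F \<in> I" if "I \<in> F" for I
    using ideal_finprod[OF assms(3)[OF that] assms(2) fc that] f[OF that] by simp
  then have "finprod R f F \<in> P" by (rule assms(4)[OF finprod_closed[OF fc]])
  then show False using prime_finprod[OF assms(1,2) fc] f by blast
qed

lemma prime_avoidance:
  assumes J: "ideal J R" and F: "finite F" "\<And>P. P \<in> F \<Longrightarrow> primeideal P R" and sub: "J \<subseteq> \<Union>F"
  shows "\<exists>P\<in>F. J \<subseteq> P"
  using F sub
proof (induction F rule: finite_psubset_induct)
  case (psubset F)
  show ?case
  proof (rule ccontr)
    assume no: "\<not> ?case"
    have "\<exists>a. a \<in> J \<and> a \<notin> \<Union>(F - {P})" if "P \<in> F" for P
    proof (rule ccontr)
      assume "\<not> ?thesis"
      then have "J \<subseteq> \<Union>(F - {P})" by blast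
      then have "\<exists>P\<in>F - {P}. J \<subseteq> P"
        using psubset.IH[of "F - {P}"] psubset.prems(1) that by (metis DiffD1 Diff_subset DiffD2 insertI1 psubsetI)
      then show False using no by blast
    qed
    then obtain f where f: "\<And>P. P \<in> F \<Longrightarrow> f P \<in> J \<and> f P \<notin> \<Union>(F - {P})" by metis
    have fP: "f P \<in> P" if "P \<in> F" for P using f[OF that] psubset.prems(2) that by blast
    have fc: "f P \<in> carrier R" if "P \<in> F" for P using f[OF that] ideal_carr[OF J] by blast
    have "F \<noteq> {}" using psubset.prems(2) ideal_zero[OF J] by blast
    then obtain P where P: "P \<in> F" by blast
    have fin: "finite (F - {P})" using psubset.hyps by simp
    have fc': "f \<in> F - {P} \<rightarrow> carrier R" using fc by blast
    define g where "g = finprod R f (F - {P})"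
    have gc: "g \<in> carrier R" unfolding g_def using fc' by simp
    have gP: "g \<notin> P"
      using prime_finprod[OF psubset.prems(1)[OF P] fin fc'] f P unfolding g_def by blast
    have gQ: "g \<in> Q" if "Q \<in> F" "Q \<noteq> P" for Q
      unfolding g_def using that fP
      by (intro ideal_finprod[where k=Q] fin fc') (auto intro: primeideal.axioms(1) psubset.prems(1))
    show False
    proof (cases "F = {P}")
      case True
      then show False using no psubset.prems(2) by auto
    next
      case False
      then obtain Q where Q: "Q \<in> F" "Q \<noteq> P" using P by blast
      have gJ: "g \<in> J"
        unfolding g_def using Q f by (intro ideal_finprod[OF J, where k=Q] fin fc') auto
      have "f P \<oplus> g \<in> J" using f P gJ ideal_add[OF J] by blast
      then obtain Q' where Q': "Q' \<in> F" "f P \<oplus> g \<in> Q'" using psubset.prems(2) by blast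
      have id: "ideal Q' R" using psubset.prems(1) Q'(1) primeideal.axioms(1) by blast
      show False
      proof (cases "Q' = P")
        case True
        have "(f P \<oplus> g) \<ominus> f P \<in> P" using True Q' fP[OF P] ideal_diff[OF id] by blast
        moreover have "(f P \<oplus> g) \<ominus> f P = g"
          using fc[OF P] gc by (simp add: a_minus_def a_comm[of "f P" g] a_assoc r_neg)
        ultimately show False using gP by simp
      next
        case False
        have "(f P \<oplus> g) \<ominus> g \<in> Q'" using False Q' gQ ideal_diff[OF id] by blast
        moreover have "(f P \<oplus> g) \<ominus> g = f P"
          using fc[OF P] gc by (simp add: a_minus_def a_assoc r_neg)
        ultimately show False using f[OF P] Q' False by auto
      qed
    qed
  qed
qed

end

text \<open>Zorn's lemma applies because a nonempty chain of ideals contains its own union.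
  Noetherianity enters the later arguments in this form.\<close>

lemma (in noetherian_ring) exists_maximal_in:
  assumes "\<A> \<noteq> {}" "\<And>I. I \<in> \<A> \<Longrightarrow> ideal I R"
  shows "\<exists>M\<in>\<A>. \<forall>I\<in>\<A>. M \<subseteq> I \<longrightarrow> I = M"
proof (rule subset_Zorn_nonempty[OF assms(1)])
  fix \<C> assume C: "\<C> \<noteq> {}" "subset.chain \<A> \<C>"
  then have "subset.chain {I. ideal I R} \<C>"
    using assms(2) unfolding subset_chain_def by auto
  then have "\<Union>\<C> \<in> \<C>" using ideal_chain_is_trivial C(1) by blast
  then show "\<Union>\<C> \<in> \<A>" using C(2) unfolding subset_chain_def by auto
qed

section \<open>Regular sequences in a localization\<close>

locale localized_ring = cring R for R (structure) +
  fixes m :: "'a set"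
  assumes prime_m: "primeideal m R"
begin

abbreviation U :: "'a set" where "U \<equiv> carrier R - m"

lemma U_one: "\<one> \<in> U"
  using prime_one_notin[OF prime_m] by simp

lemma U_mult: "s \<in> U \<Longrightarrow> t \<in> U \<Longrightarrow> s \<otimes> t \<in> U"
  using primeideal.I_prime[OF prime_m, of s t] by auto

lemma ideal_m: "ideal m R"
  using prime_m by (rule primeideal.axioms(1))

text \<open>Ideals of the localization are represented by their contractions, which are the saturated
  ideals. The ideal generated by the image of \<open>I\<close> and \<open>x\<close> corresponds to \<open>adj I x\<close>.\<close>

definition saturated :: "'a set \<Rightarrow> bool" where
  "saturated I \<longleftrightarrow> ideal I R \<and> (\<forall>s\<in>U. \<forall>a\<in>carrier R. s \<otimes> a \<in> I \<longrightarrow> a \<in> I)"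

definition adj :: "'a set \<Rightarrow> 'a \<Rightarrow> 'a set" where
  "adj I x = {a \<in> carrier R. \<exists>s\<in>U. \<exists>r\<in>carrier R. congr I (s \<otimes> a) (x \<otimes> r)}"

text \<open>Regularity of \<open>x\<close> on the quotient by \<open>I\<close>; for saturated
  \<open>I\<close> the localized quotient gives the same condition.\<close>

definition nzd :: "'a set \<Rightarrow> 'a \<Rightarrow> bool" where
  "nzd I x \<longleftrightarrow> (\<forall>a\<in>carrier R. x \<otimes> a \<in> I \<longrightarrow> a \<in> I)"

text \<open>The colon ideal (I : z).\<close>

definition ann :: "'a set \<Rightarrow> 'a \<Rightarrow> 'a set" where
  "ann I z = {a \<in> carrier R. a \<otimes> z \<in> I}"

lemma sat_ideal: "saturated I \<Longrightarrow> ideal I R"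
  by (simp add: saturated_def)

lemma sat_cancel: "saturated I \<Longrightarrow> s \<in> U \<Longrightarrow> a \<in> carrier R \<Longrightarrow> s \<otimes> a \<in> I \<Longrightarrow> a \<in> I"
  unfolding saturated_def by blast

lemma nzdD: "nzd I x \<Longrightarrow> a \<in> carrier R \<Longrightarrow> x \<otimes> a \<in> I \<Longrightarrow> a \<in> I"
  unfolding nzd_def by blast

lemma adjI: "a \<in> carrier R \<Longrightarrow> s \<in> U \<Longrightarrow> r \<in> carrier R \<Longrightarrow> congr I (s \<otimes> a) (x \<otimes> r) \<Longrightarrow> a \<in> adj I x"
  unfolding adj_def by blast

lemma adjE:
  assumes "a \<in> adj I x"
  obtains s r where "a \<in> carrier R" "s \<in> U" "s \<in> carrier R" "r \<in> carrier R" "congr I (s \<otimes> a) (x \<otimes> r)"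
  using assms unfolding adj_def by blast

lemma adj_superset:
  assumes "ideal I R" "x \<in> carrier R" shows "I \<subseteq> adj I x"
proof
  fix a assume a: "a \<in> I"
  then have ac: "a \<in> carrier R" using ideal_carr assms(1) by blast
  have "congr I (\<one> \<otimes> a) (x \<otimes> \<zero>)" using mem_congr_zero[OF assms(1) a] ac assms(2) by simp
  then show "a \<in> adj I x" using adjI[OF ac U_one] by blast
qed

lemma adj_multiple:
  assumes "ideal I R" "x \<in> carrier R" "r \<in> carrier R" shows "x \<otimes> r \<in> adj I x"
proof (rule adjI[OF _ U_one])
  show "congr I (\<one> \<otimes> (x \<otimes> r)) (x \<otimes> r)" using congr_refl[OF assms(1)] assms by simp
qed (use assms in auto)

lemma adj_self:
  assumes "ideal I R" "x \<in> carrier R" shows "x \<in> adj I x"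
  using adj_multiple[OF assms one_closed] assms by simp

lemma saturated_adj:
  assumes I: "ideal I R" and x: "x \<in> carrier R"
  shows "saturated (adj I x)"
  unfolding saturated_def
proof (intro conjI ballI impI)
  show "ideal (adj I x) R"
  proof (rule ideal_intro)
    show "adj I x \<subseteq> carrier R" by (auto simp: adj_def)
    show "\<zero> \<in> adj I x" using adj_superset[OF I x] ideal_zero[OF I] by blast
  next
    fix a b assume "a \<in> adj I x" "b \<in> adj I x"
    then obtain s r t q where
      a: "a \<in> carrier R" "s \<in> U" "s \<in> carrier R" "r \<in> carrier R" "congr I (s \<otimes> a) (x \<otimes> r)" and
      b: "b \<in> carrier R" "t \<in> U" "t \<in> carrier R" "q \<in> carrier R" "congr I (t \<otimes> b) (x \<otimes> q)"
      by (metis adjE)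
    have "congr I (t \<otimes> (s \<otimes> a) \<oplus> s \<otimes> (t \<otimes> b)) (t \<otimes> (x \<otimes> r) \<oplus> s \<otimes> (x \<otimes> q))"
      using congr_add[OF I] congr_mult_left[OF I b(3) a(5)] congr_mult_left[OF I a(3) b(5)] by blast
    moreover have "t \<otimes> (s \<otimes> a) \<oplus> s \<otimes> (t \<otimes> b) = (s \<otimes> t) \<otimes> (a \<oplus> b)"
      using a b by (simp add: r_distr m_ac)
    moreover have "t \<otimes> (x \<otimes> r) \<oplus> s \<otimes> (x \<otimes> q) = x \<otimes> (t \<otimes> r \<oplus> s \<otimes> q)"
      using a b x by (simp add: r_distr m_ac)
    ultimately show "a \<oplus> b \<in> adj I x"
      using a b by (intro adjI[of "a \<oplus> b" "s \<otimes> t" "t \<otimes> r \<oplus> s \<otimes> q"] U_mult) auto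
  next
    fix c a assume c: "c \<in> carrier R" and "a \<in> adj I x"
    then obtain s r where a: "a \<in> carrier R" "s \<in> U" "s \<in> carrier R" "r \<in> carrier R"
      "congr I (s \<otimes> a) (x \<otimes> r)" by (metis adjE)
    have "congr I (s \<otimes> (c \<otimes> a)) (x \<otimes> (c \<otimes> r))"
      using congr_mult_left[OF I c a(5)] a c x by (simp add: m_lcomm)
    then show "c \<otimes> a \<in> adj I x" using a c by (intro adjI[of _ s "c \<otimes> r"]) auto
  qed
next
  fix u a assume u: "u \<in> U" "a \<in> carrier R" "u \<otimes> a \<in> adj I x"
  obtain s r where s: "s \<in> U" "s \<in> carrier R" "r \<in> carrier R" "congr I (s \<otimes> (u \<otimes> a)) (x \<otimes> r)"
    using u(3) by (metis adjE)
  have "congr I ((s \<otimes> u) \<otimes> a) (x \<otimes> r)" using s u by (simp add: m_assoc)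
  then show "a \<in> adj I x" by (rule adjI[OF u(2) U_mult[OF s(1) u(1)] s(3)])
qed

lemma adj_mono:
  assumes "I \<subseteq> J" shows "adj I x \<subseteq> adj J x"
proof
  fix a assume "a \<in> adj I x"
  then obtain s r where "a \<in> carrier R" "s \<in> U" "r \<in> carrier R" "congr I (s \<otimes> a) (x \<otimes> r)"
    by (rule adjE)
  then show "a \<in> adj J x" using adjI congr_mono[OF _ assms] by blast
qed

lemma adj_least:
  assumes J: "saturated J" and IJ: "I \<subseteq> J" and x: "x \<in> J"
  shows "adj I x \<subseteq> J"
proof
  fix a assume "a \<in> adj I x"
  then obtain s r where a: "a \<in> carrier R" "s \<in> U" "r \<in> carrier R" "congr I (s \<otimes> a) (x \<otimes> r)"
    by (rule adjE)
  have "x \<otimes> r \<in> J" using ideal_mult_right[OF sat_ideal[OF J] x a(3)] .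
  then have "s \<otimes> a \<in> J" using congr_mem[OF sat_ideal[OF J] congr_mono[OF a(4) IJ]] by blast
  then show "a \<in> J" by (rule sat_cancel[OF J a(2,1)])
qed

text \<open>Either side is the least saturated ideal containing \<open>I\<close>, \<open>x\<close>
  and \<open>y\<close>.\<close>

lemma adj_commute:
  assumes I: "ideal I R" and x: "x \<in> carrier R" and y: "y \<in> carrier R"
  shows "adj (adj I x) y = adj (adj I y) x"
proof -
  have *: "adj (adj I x) y \<subseteq> adj (adj I y) x" if "x \<in> carrier R" "y \<in> carrier R" for x y
  proof (rule adj_least)
    have Iy: "ideal (adj I y) R" using saturated_adj[OF I that(2)] sat_ideal by blast
    show "saturated (adj (adj I y) x)" by (rule saturated_adj[OF Iy that(1)])
    show "adj I x \<subseteq> adj (adj I y) x" by (rule adj_mono[OF adj_superset[OF I that(2)]])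
    show "y \<in> adj (adj I y) x"
      using adj_self[OF I that(2)] adj_superset[OF Iy that(1)] by blast
  qed
  show ?thesis using *[OF x y] *[OF y x] by blast
qed

lemma ideal_ann:
  assumes I: "ideal I R" and z: "z \<in> carrier R" shows "ideal (ann I z) R"
proof (rule ideal_intro)
  show "ann I z \<subseteq> carrier R" by (auto simp: ann_def)
  show "\<zero> \<in> ann I z" using ideal_zero[OF I] z by (simp add: ann_def)
next
  fix a b assume "a \<in> ann I z" "b \<in> ann I z"
  then show "a \<oplus> b \<in> ann I z" using z ideal_add[OF I] by (simp add: ann_def l_distr)
next
  fix r a assume "r \<in> carrier R" "a \<in> ann I z"
  then show "r \<otimes> a \<in> ann I z" using z ideal_mult[OF I] by (simp add: ann_def m_assoc)
qed

lemma ann_subset_m: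
  assumes "saturated I" "z \<in> carrier R" "z \<notin> I" shows "ann I z \<subseteq> m"
  using assms sat_cancel unfolding ann_def by blast

lemma ann_subset_mult:
  assumes "ideal I R" "z \<in> carrier R" "c \<in> carrier R" shows "ann I z \<subseteq> ann I (c \<otimes> z)"
proof
  fix a assume "a \<in> ann I z"
  then have a: "a \<in> carrier R" "a \<otimes> z \<in> I" by (auto simp: ann_def)
  have "a \<otimes> (c \<otimes> z) = c \<otimes> (a \<otimes> z)" using a assms by (simp add: m_lcomm)
  then show "a \<in> ann I (c \<otimes> z)" using a ideal_mult[OF assms(1) a(2) assms(3)] by (simp add: ann_def)
qed

text \<open>If \<open>y z \<equiv> x w\<close>, then multiplying by \<open>y\<close> and cancelling \<open>x\<close> moves an element
  killed modulo \<open>x\<close> to one killed by the same elements modulo \<open>y\<close>: the elementary form of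
  $\mathrm{Hom}(k, M/xM) \cong \mathrm{Ext}^1(k, M) \cong \mathrm{Hom}(k, M/yM)$.\<close>

lemma socle_exchange:
  assumes I: "saturated I" and x: "x \<in> m" "nzd I x" and y: "y \<in> m" "nzd I y"
    and z: "z \<in> carrier R" "z \<notin> adj I x" "m \<subseteq> ann (adj I x) z"
  obtains w where "w \<in> carrier R" "w \<notin> adj I y" "m \<subseteq> ann (adj I y) w"
proof -
  have id: "ideal I R" using I by (rule sat_ideal)
  have c: "x \<in> carrier R" "y \<in> carrier R" using x y ideal_carr[OF ideal_m] by auto
  have "y \<otimes> z \<in> adj I x" using y(1) z(3) unfolding ann_def by blast
  then obtain s w where s: "s \<in> U" "s \<in> carrier R" "w \<in> carrier R" "congr I (s \<otimes> (y \<otimes> z)) (x \<otimes> w)"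
    by (metis adjE)
  have "w \<notin> adj I y"
  proof
    assume "w \<in> adj I y"
    then obtain t v where t: "t \<in> U" "t \<in> carrier R" "v \<in> carrier R" "congr I (t \<otimes> w) (y \<otimes> v)"
      by (metis adjE)
    have 1: "congr I (t \<otimes> (s \<otimes> (y \<otimes> z))) (t \<otimes> (x \<otimes> w))" by (rule congr_mult_left[OF id t(2) s(4)])
    have 2: "congr I (x \<otimes> (t \<otimes> w)) (x \<otimes> (y \<otimes> v))" by (rule congr_mult_left[OF id c(1) t(4)])
    have "t \<otimes> (x \<otimes> w) = x \<otimes> (t \<otimes> w)" using t s c by (simp add: m_lcomm)
    then have 3: "congr I (t \<otimes> (s \<otimes> (y \<otimes> z))) (x \<otimes> (y \<otimes> v))" using congr_trans[OF id 1] 2 by simp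
    have "y \<otimes> ((t \<otimes> s) \<otimes> z \<ominus> x \<otimes> v) = t \<otimes> (s \<otimes> (y \<otimes> z)) \<ominus> x \<otimes> (y \<otimes> v)"
      using t s c z(1) by (simp add: a_minus_def r_distr r_minus m_ac)
    then have "y \<otimes> ((t \<otimes> s) \<otimes> z \<ominus> x \<otimes> v) \<in> I" using 3 by (simp add: congr_def)
    then have "(t \<otimes> s) \<otimes> z \<ominus> x \<otimes> v \<in> I" using nzdD[OF y(2)] t s c z(1) by simp
    then have "congr I ((t \<otimes> s) \<otimes> z) (x \<otimes> v)" using t s c z(1) by (simp add: congr_def)
    then show False using adjI[OF z(1) U_mult[OF t(1) s(1)] t(3)] z(2) by blast
  qed
  moreover have "m \<subseteq> ann (adj I y) w"
  proof
    fix p assume p: "p \<in> m"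
    then have pc: "p \<in> carrier R" using ideal_carr[OF ideal_m] by blast
    have "p \<otimes> z \<in> adj I x" using p z(3) unfolding ann_def by blast
    then obtain t r where t: "t \<in> U" "t \<in> carrier R" "r \<in> carrier R" "congr I (t \<otimes> (p \<otimes> z)) (x \<otimes> r)"
      by (metis adjE)
    have tp: "t \<otimes> p \<in> carrier R" "s \<otimes> y \<in> carrier R" using t pc s c by auto
    have 1: "congr I ((t \<otimes> p) \<otimes> (x \<otimes> w)) ((t \<otimes> p) \<otimes> (s \<otimes> (y \<otimes> z)))"
      by (rule congr_sym[OF id congr_mult_left[OF id tp(1) s(4)]])
    have 2: "congr I ((s \<otimes> y) \<otimes> (t \<otimes> (p \<otimes> z))) ((s \<otimes> y) \<otimes> (x \<otimes> r))"
      by (rule congr_mult_left[OF id tp(2) t(4)])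
    have "(t \<otimes> p) \<otimes> (s \<otimes> (y \<otimes> z)) = (s \<otimes> y) \<otimes> (t \<otimes> (p \<otimes> z))"
      using t s c z(1) pc by (simp add: m_ac)
    then have 3: "congr I ((t \<otimes> p) \<otimes> (x \<otimes> w)) ((s \<otimes> y) \<otimes> (x \<otimes> r))" using congr_trans[OF id 1] 2 by simp
    have "x \<otimes> (t \<otimes> (p \<otimes> w) \<ominus> y \<otimes> (s \<otimes> r)) = (t \<otimes> p) \<otimes> (x \<otimes> w) \<ominus> (s \<otimes> y) \<otimes> (x \<otimes> r)"
      using t s c z(1) pc by (simp add: a_minus_def r_distr r_minus m_ac)
    then have "x \<otimes> (t \<otimes> (p \<otimes> w) \<ominus> y \<otimes> (s \<otimes> r)) \<in> I" using 3 by (simp add: congr_def)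
    then have "t \<otimes> (p \<otimes> w) \<ominus> y \<otimes> (s \<otimes> r) \<in> I" using nzdD[OF x(2)] t s c pc by simp
    then have "congr I (t \<otimes> (p \<otimes> w)) (y \<otimes> (s \<otimes> r))" using t s c pc by (simp add: congr_def)
    then have "p \<otimes> w \<in> adj I y" using t s pc by (intro adjI[of _ t "s \<otimes> r"]) auto
    then show "p \<in> ann (adj I y) w" using pc by (simp add: ann_def)
  qed
  ultimately show thesis using that s(3) by blast
qed

text \<open>From x a = z b modulo \<open>I\<close>, regularity of \<open>z\<close> after
  \<open>x\<close> makes b a multiple x c, and cancelling \<open>x\<close> gives a = z c, everything
  up to factors outside \<open>m\<close>.\<close>

lemma nzd_permute:
  assumes I: "saturated I" and x: "x \<in> carrier R" and z: "z \<in> carrier R" "nzd I z"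
    and xx: "nzd I x" and zx: "nzd (adj I x) z"
  shows "nzd (adj I z) x"
  unfolding nzd_def
proof (intro ballI impI)
  have id: "ideal I R" using I by (rule sat_ideal)
  fix a assume a: "a \<in> carrier R" "x \<otimes> a \<in> adj I z"
  obtain s b where s: "s \<in> U" "s \<in> carrier R" "b \<in> carrier R" "congr I (s \<otimes> (x \<otimes> a)) (z \<otimes> b)"
    using a(2) by (metis adjE)
  have "s \<otimes> (x \<otimes> a) = x \<otimes> (s \<otimes> a)" using s a x by (simp add: m_lcomm)
  then have zb: "congr I (z \<otimes> b) (x \<otimes> (s \<otimes> a))" using congr_sym[OF id s(4)] by simp
  have "\<one> \<otimes> (z \<otimes> b) = z \<otimes> b" using z s by simp
  then have "z \<otimes> b \<in> adj I x" using adjI[OF _ U_one, of "z \<otimes> b" "s \<otimes> a" I x] zb z s a by simp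
  then have "b \<in> adj I x" using nzdD[OF zx s(3)] by blast
  then obtain t c where t: "t \<in> U" "t \<in> carrier R" "c \<in> carrier R" "congr I (t \<otimes> b) (x \<otimes> c)"
    by (metis adjE)
  have 1: "congr I (z \<otimes> (t \<otimes> b)) (z \<otimes> (x \<otimes> c))" by (rule congr_mult_left[OF id z(1) t(4)])
  have 2: "congr I (t \<otimes> (x \<otimes> (s \<otimes> a))) (t \<otimes> (z \<otimes> b))"
    by (rule congr_sym[OF id congr_mult_left[OF id t(2) zb]])
  have "t \<otimes> (z \<otimes> b) = z \<otimes> (t \<otimes> b)" using t s z by (simp add: m_lcomm)
  then have 3: "congr I (t \<otimes> (x \<otimes> (s \<otimes> a))) (z \<otimes> (x \<otimes> c))" using congr_trans[OF id 2] 1 by simp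
  have "x \<otimes> ((t \<otimes> s) \<otimes> a \<ominus> z \<otimes> c) = t \<otimes> (x \<otimes> (s \<otimes> a)) \<ominus> z \<otimes> (x \<otimes> c)"
    using t s x z a by (simp add: a_minus_def r_distr r_minus m_ac)
  then have "x \<otimes> ((t \<otimes> s) \<otimes> a \<ominus> z \<otimes> c) \<in> I" using 3 by (simp add: congr_def)
  then have "(t \<otimes> s) \<otimes> a \<ominus> z \<otimes> c \<in> I" using nzdD[OF xx] t s z a by simp
  then have "congr I ((t \<otimes> s) \<otimes> a) (z \<otimes> c)" using t s z a by (simp add: congr_def)
  then show "a \<in> adj I z" by (rule adjI[OF a(1) U_mult[OF t(1) s(1)] t(3)])
qed

lemma m_carr: "x \<in> m \<Longrightarrow> x \<in> carrier R"
  using ideal_carr[OF ideal_m] .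

lemma saturated_m: "saturated m"
  unfolding saturated_def using ideal_m primeideal.I_prime[OF prime_m] by blast

primrec adjs :: "'a set \<Rightarrow> 'a list \<Rightarrow> 'a set" where
  "adjs I [] = I"
| "adjs I (x # xs) = adjs (adj I x) xs"

text \<open>Properness of the final ideal is not part of the condition: for \<open>I\<close> and
  \<open>xs\<close> inside \<open>m\<close> it is automatic, since \<open>adjs I xs\<close> then
  stays inside \<open>m\<close>.\<close>

primrec regular :: "'a set \<Rightarrow> 'a list \<Rightarrow> bool" where
  "regular I [] \<longleftrightarrow> True"
| "regular I (x # xs) \<longleftrightarrow> nzd I x \<and> regular (adj I x) xs"

lemma saturated_adjs: "saturated I \<Longrightarrow> set xs \<subseteq> m \<Longrightarrow> saturated (adjs I xs)"
  by (induction xs arbitrary: I) (auto intro: saturated_adj sat_ideal m_carr)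

text \<open>The kernel of the map from \<open>R\<close> to its localization, hence the saturated
  ideal that represents zero.\<close>

definition zero_sat :: "'a set" where
  "zero_sat = {a \<in> carrier R. \<exists>s\<in>U. s \<otimes> a = \<zero>}"

lemma saturated_zero_sat: "saturated zero_sat"
proof -
  have "zero_sat = adj {\<zero>} \<zero>"
  proof -
    have "congr {\<zero>} (s \<otimes> a) (\<zero> \<otimes> r) \<longleftrightarrow> s \<otimes> a = \<zero>"
      if "s \<in> U" "a \<in> carrier R" "r \<in> carrier R" for s a r
      using that by (simp add: congr_def a_minus_def)
    then show ?thesis unfolding zero_sat_def adj_def by auto
  qed
  then show ?thesis using saturated_adj[OF zeroideal zero_closed] by simp
qed

lemma zero_sat_subset: "zero_sat \<subseteq> m"
proof
  fix a assume "a \<in> zero_sat"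
  then obtain s where s: "a \<in> carrier R" "s \<in> U" "s \<otimes> a = \<zero>" unfolding zero_sat_def by blast
  then show "a \<in> m" using sat_cancel[OF saturated_m s(2,1)] ideal_zero[OF ideal_m] by simp
qed

end

section \<open>Associated primes, depth and unmixedness\<close>

locale noetherian_localized_ring = localized_ring R m + noetherian_ring R for R (structure) and m
begin

text \<open>The ideals \<open>ann I z\<close> for such \<open>z\<close> are the maximal ones among
  the proper colon ideals, that is, the associated primes of \<open>I\<close> maximal under
  inclusion. They already cover all zero divisors modulo \<open>I\<close>.\<close>

definition max_ann :: "'a set \<Rightarrow> 'a \<Rightarrow> bool" where
  "max_ann I z \<longleftrightarrow> z \<in> carrier R \<and> z \<notin> I \<and>
     (\<forall>w\<in>carrier R. w \<notin> I \<longrightarrow> ann I z \<subseteq> ann I w \<longrightarrow> ann I w = ann I z)"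

lemma max_ann_prime:
  assumes I: "ideal I R" and z: "max_ann I z"
  shows "primeideal (ann I z) R"
proof (rule primeidealI[OF ideal_ann[OF I] cring_axioms])
  show zc: "z \<in> carrier R" using z by (simp add: max_ann_def)
  have zI: "z \<notin> I" using z by (simp add: max_ann_def)
  have "\<one> \<notin> ann I z" using zI zc by (simp add: ann_def)
  then show "carrier R \<noteq> ann I z" by auto
  fix a b assume ab: "a \<in> carrier R" "b \<in> carrier R" "a \<otimes> b \<in> ann I z"
  show "a \<in> ann I z \<or> b \<in> ann I z"
  proof (rule disjCI)
    assume "b \<notin> ann I z"
    then have bz: "b \<otimes> z \<notin> I" "b \<otimes> z \<in> carrier R" using ab zc by (auto simp: ann_def)
    have "ann I z \<subseteq> ann I (b \<otimes> z)" by (rule ann_subset_mult[OF I zc ab(2)])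
    then have "ann I (b \<otimes> z) = ann I z" using z bz unfolding max_ann_def by blast
    moreover have "a \<in> ann I (b \<otimes> z)" using ab zc by (simp add: ann_def m_assoc)
    ultimately show "a \<in> ann I z" by simp
  qed
qed

lemma max_ann_exists:
  assumes I: "ideal I R" and z: "z \<in> carrier R" "z \<notin> I"
  obtains w where "max_ann I w" "ann I z \<subseteq> ann I w"
proof -
  define \<A> where "\<A> = {ann I w | w. w \<in> carrier R \<and> w \<notin> I \<and> ann I z \<subseteq> ann I w}"
  have "\<A> \<noteq> {}" using z unfolding \<A>_def by blast
  moreover have "ideal J R" if "J \<in> \<A>" for J using that ideal_ann[OF I] unfolding \<A>_def by blast
  ultimately obtain M where M: "M \<in> \<A>" "\<And>J. J \<in> \<A> \<Longrightarrow> M \<subseteq> J \<Longrightarrow> J = M"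
    using exists_maximal_in[of \<A>] by blast
  obtain w where w: "M = ann I w" "w \<in> carrier R" "w \<notin> I" "ann I z \<subseteq> ann I w"
    using M(1) unfolding \<A>_def by blast
  have "ann I v = ann I w" if v: "v \<in> carrier R" "v \<notin> I" "ann I w \<subseteq> ann I v" for v
  proof -
    have "ann I v \<in> \<A>" using v w(4) unfolding \<A>_def by blast
    then show ?thesis using M(2) v(3) w(1) by blast
  qed
  then have "max_ann I w" using w unfolding max_ann_def by blast
  then show thesis using that w(4) by blast
qed

text \<open>By the maximal condition a finite set \<open>F\<close> of such elements generates an
  ideal containing all of them. What kills \<open>F\<close> modulo \<open>I\<close> then kills every
  other \<open>z\<close>, so the intersection of the finitely many \<open>ann I x\<close> lies in
  the prime \<open>ann I z\<close>; primality and maximality make \<open>ann I z\<close> one of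
  them.\<close>

lemma finite_max_ann:
  assumes I: "ideal I R"
  shows "finite {ann I z | z. max_ann I z}"
proof -
  define Z where "Z = {z. max_ann I z}"
  have Zc: "Z \<subseteq> carrier R" by (auto simp: Z_def max_ann_def)
  define \<A> where "\<A> = {Idl F | F. finite F \<and> F \<subseteq> Z}"
  have "\<A> \<noteq> {}" unfolding \<A>_def by blast
  moreover have "ideal J R" if "J \<in> \<A>" for J
    using that genideal_ideal Zc unfolding \<A>_def by blast
  ultimately obtain M where M: "M \<in> \<A>" "\<And>J. J \<in> \<A> \<Longrightarrow> M \<subseteq> J \<Longrightarrow> J = M"
    using exists_maximal_in[of \<A>] by blast
  then obtain F where F: "M = Idl F" "finite F" "F \<subseteq> Z" unfolding \<A>_def by blast
  have Fc: "F \<subseteq> carrier R" using F Zc by blast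
  have ZM: "z \<in> Idl F" if z: "z \<in> Z" for z
  proof -
    have c: "insert z F \<subseteq> carrier R" using Fc z Zc by blast
    have "Idl (insert z F) \<in> \<A>" using F z unfolding \<A>_def by blast
    moreover have "Idl F \<subseteq> Idl (insert z F)" by (rule subset_Idl_subset[OF c]) auto
    ultimately have "Idl (insert z F) = Idl F" using M(2) F(1) by blast
    then show ?thesis using genideal_self[OF c] by blast
  qed
  have "{ann I z | z. max_ann I z} \<subseteq> ann I ` F"
  proof
    fix P assume "P \<in> {ann I z | z. max_ann I z}"
    then obtain z where z: "max_ann I z" "P = ann I z" by blast
    have "\<exists>J\<in>ann I ` F. J \<subseteq> P"
    proof (rule prime_Int_subset)
      show "primeideal P R" using max_ann_prime[OF I z(1)] z(2) by simp
      show "finite (ann I ` F)" using F(2) by simp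
      show "ideal J R" if "J \<in> ann I ` F" for J using that ideal_ann[OF I] Fc by blast
      fix a assume a: "a \<in> carrier R" "\<And>J. J \<in> ann I ` F \<Longrightarrow> a \<in> J"
      have "F \<subseteq> {x \<in> carrier R. x \<otimes> a \<in> I}"
      proof
        fix x assume x: "x \<in> F"
        then have "a \<in> ann I x" using a(2) by blast
        then show "x \<in> {x \<in> carrier R. x \<otimes> a \<in> I}" using x Fc a(1) by (auto simp: ann_def m_comm)
      qed
      moreover have "ideal {x \<in> carrier R. x \<otimes> a \<in> I} R" using ideal_ann[OF I a(1)] by (simp add: ann_def)
      ultimately have "Idl F \<subseteq> {x \<in> carrier R. x \<otimes> a \<in> I}" using genideal_minimal by blast
      moreover have "z \<in> Idl F" using ZM z(1) by (simp add: Z_def)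
      ultimately have "z \<in> carrier R" "z \<otimes> a \<in> I" by auto
      then show "a \<in> P" using z a(1) by (simp add: ann_def m_comm)
    qed
    then obtain w where w: "w \<in> F" "ann I w \<subseteq> ann I z" using z(2) by blast
    then have "max_ann I w" using F(3) by (auto simp: Z_def)
    then have "ann I z = ann I w" using w(2) z(1) unfolding max_ann_def by blast
    then show "P \<in> ann I ` F" using w z by blast
  qed
  then show ?thesis using F(2) finite_subset finite_imageI by blast
qed

lemma not_nzd_max_ann:
  assumes I: "ideal I R" and x: "x \<in> carrier R" "\<not> nzd I x"
  obtains w where "max_ann I w" "x \<in> ann I w"
proof -
  obtain a where a: "a \<in> carrier R" "x \<otimes> a \<in> I" "a \<notin> I" using x unfolding nzd_def by blast
  obtain w where "max_ann I w" "ann I a \<subseteq> ann I w" using max_ann_exists[OF I a(1,3)] .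
  moreover have "x \<in> ann I a" using a x by (simp add: ann_def)
  ultimately show thesis using that by blast
qed

text \<open>Depth at least \<open>n\<close> for the localized quotient by \<open>I\<close>. A
  predicate for each \<open>n\<close> replaces the supremum and exposes the first element of a
  sequence to induction.\<close>

primrec dep :: "nat \<Rightarrow> 'a set \<Rightarrow> bool" where
  "dep 0 I \<longleftrightarrow> True"
| "dep (Suc n) I \<longleftrightarrow> (\<exists>y\<in>m. nzd I y \<and> dep n (adj I y))"

lemma dep_Suc_imp: "dep (Suc n) I \<Longrightarrow> dep n I"
  by (induction n arbitrary: I) auto

lemma dep_antimono: "n \<le> k \<Longrightarrow> dep k I \<Longrightarrow> dep n I"
  by (induction k rule: dec_induct) (use dep_Suc_imp in blast)+

text \<open>This is the independence of depth from the chosen sequence. With \<open>y\<close> the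
  first element of the given sequence, an element \<open>z\<close> is chosen that is regular modulo
  \<open>I\<close>, modulo \<open>I\<close> and \<open>x\<close>, and modulo \<open>I\<close> and
  \<open>y\<close>. The induction hypothesis moves the length from \<open>y\<close> to
  \<open>z\<close> and then from \<open>z\<close> to \<open>x\<close>.\<close>

lemma dep_adj:
  assumes "saturated I" "x \<in> m" "nzd I x" "dep (Suc n) I"
  shows "dep n (adj I x)"
  using assms
proof (induction n arbitrary: I x)
  case 0
  then show ?case by simp
next
  case (Suc n)
  have id: "ideal I R" by (rule sat_ideal[OF Suc.prems(1)])
  obtain y where y: "y \<in> m" "nzd I y" "dep (Suc n) (adj I y)" using Suc.prems(4) by auto
  obtain y2 where y2: "y2 \<in> m" "nzd (adj I y) y2" using y(3) by auto
  have xc: "x \<in> carrier R" and yc: "y \<in> carrier R" using Suc.prems y m_carr by auto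
  have sx: "saturated (adj I x)" and sy: "saturated (adj I y)"
    using saturated_adj[OF id] xc yc by auto
  \<comment> \<open>A second regular element is available after \<open>y\<close>, so no nonzero
    class modulo \<open>adj I y\<close> is killed by all of \<open>m\<close>.
    \<open>socle_exchange\<close> carries this over from \<open>y\<close> to
    \<open>x\<close>.\<close>
  have no_y: False if "w \<in> carrier R" "w \<notin> adj I y" "m \<subseteq> ann (adj I y) w" for w
    using that y2 nzdD[OF y2(2)] unfolding ann_def by blast
  have no_x: False if z: "z \<in> carrier R" "z \<notin> adj I x" "m \<subseteq> ann (adj I x) z" for z
    using socle_exchange[OF Suc.prems(1,2,3) y(1,2) z] no_y by blast
  have no_I: False if "z \<in> carrier R" "z \<notin> I" "m \<subseteq> ann I z" for z
    using that y(1) nzdD[OF y(2)] unfolding ann_def by blast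
  \<comment> \<open>All zero divisors modulo the three ideals lie in these finitely many primes, and
    none of the primes contains \<open>m\<close>.\<close>
  define F where "F = {ann I z | z. max_ann I z} \<union> {ann (adj I x) z | z. max_ann (adj I x) z}
     \<union> {ann (adj I y) z | z. max_ann (adj I y) z}"
  have "finite F" unfolding F_def using finite_max_ann id sx sy sat_ideal by auto
  moreover have "primeideal P R" if "P \<in> F" for P
    using that max_ann_prime id sat_ideal[OF sx] sat_ideal[OF sy] unfolding F_def by blast
  moreover have "\<not> (\<exists>P\<in>F. m \<subseteq> P)"
    using no_x no_y no_I unfolding F_def max_ann_def by blast
  ultimately have "\<not> m \<subseteq> \<Union>F" using prime_avoidance[OF ideal_m] by metis
  then obtain z where z: "z \<in> m" "z \<notin> \<Union>F" by blast
  have zc: "z \<in> carrier R" using z m_carr by blast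
  have zI: "nzd I z" "nzd (adj I x) z" "nzd (adj I y) z"
    using not_nzd_max_ann[OF _ zc] id sat_ideal[OF sx] sat_ideal[OF sy] z(2) unfolding F_def by blast+
  have sz: "saturated (adj I z)" by (rule saturated_adj[OF id zc])
  \<comment> \<open>The first two elements are y, z here; they are turned into z, y, then replaced
    by z, x, and finally swapped to x, z.\<close>
  have "dep n (adj (adj I y) z)" by (rule Suc.IH[OF sy z(1) zI(3) y(3)])
  then have "dep n (adj (adj I z) y)" using adj_commute[OF id yc zc] by simp
  moreover have "nzd (adj I z) y" by (rule nzd_permute[OF Suc.prems(1) yc zc zI(1) y(2) zI(3)])
  ultimately have dz: "dep (Suc n) (adj I z)" using y(1) by auto
  have "nzd (adj I z) x" by (rule nzd_permute[OF Suc.prems(1) xc zc zI(1) Suc.prems(3) zI(2)])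
  then have "dep n (adj (adj I z) x)" by (rule Suc.IH[OF sz Suc.prems(2) _ dz])
  then have "dep n (adj (adj I x) z)" using adj_commute[OF id xc zc] by simp
  then show ?case using z(1) zI(2) by auto
qed

text \<open>Among the saturated ideals in \<open>m\<close> of unbounded depth a maximal one is
  taken. Adjoining a regular \<open>y\<close> keeps all depths by \<open>dep_adj\<close>, so
  \<open>y\<close> already lies in the ideal; being regular modulo it, \<open>y\<close> forces 1
  into the ideal.\<close>

lemma dep_bounded:
  assumes "saturated I" "I \<subseteq> m"
  shows "\<exists>n. \<not> dep n I"
proof (rule ccontr)
  assume unbounded: "\<not> (\<exists>n. \<not> dep n I)"
  define \<A> where "\<A> = {J. saturated J \<and> J \<subseteq> m \<and> (\<forall>n. dep n J)}"
  have "\<A> \<noteq> {}" using assms unbounded unfolding \<A>_def by blast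
  moreover have "ideal J R" if "J \<in> \<A>" for J using that sat_ideal unfolding \<A>_def by blast
  ultimately obtain J where JA: "J \<in> \<A>" and max: "\<And>K. K \<in> \<A> \<Longrightarrow> J \<subseteq> K \<Longrightarrow> K = J"
    using exists_maximal_in[of \<A>] by blast
  have J: "saturated J" "J \<subseteq> m" "\<And>n. dep n J" using JA unfolding \<A>_def by auto
  obtain y where y: "y \<in> m" "nzd J y" using J(3)[of "Suc 0"] by auto
  have yc: "y \<in> carrier R" using y m_carr by blast
  have "dep n (adj J y)" for n by (rule dep_adj[OF J(1) y J(3)])
  moreover have "saturated (adj J y)" by (rule saturated_adj[OF sat_ideal[OF J(1)] yc])
  moreover have "adj J y \<subseteq> m" by (rule adj_least[OF saturated_m J(2) y(1)])
  ultimately have "adj J y = J"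
    using max adj_superset[OF sat_ideal[OF J(1)] yc] unfolding \<A>_def by blast
  then have "y \<in> J" using adj_self[OF sat_ideal[OF J(1)] yc] by simp
  then have "\<one> \<in> J" using nzdD[OF y(2) one_closed] yc by simp
  then show False using J(2) prime_one_notin[OF prime_m] by blast
qed

text \<open>If all elements killed by \<open>ann I z\<close> were divisible by \<open>y\<close> modulo \<open>I\<close>, the quotients
  by \<open>y\<close> would be killed as well, and iterating contradicts the chain condition.\<close>

lemma ann_step:
  assumes I: "saturated I" and z: "z \<in> carrier R" "z \<notin> I" and y: "y \<in> m" "nzd I y"
  obtains w where "max_ann (adj I y) w" "ann I z \<subset> ann (adj I y) w"
proof -
  have id: "ideal I R" by (rule sat_ideal[OF I])
  have yc: "y \<in> carrier R" using y m_carr by blast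
  have idy: "ideal (adj I y) R" by (rule sat_ideal[OF saturated_adj[OF id yc]])
  define V where "V = {u \<in> carrier R. u \<notin> I \<and> ann I z \<subseteq> ann I u}"
  have "\<exists>u\<in>V. u \<notin> adj I y"
  proof (rule ccontr)
    assume no: "\<not> ?thesis"
    \<comment> \<open>An element of \<open>V\<close> with \<open>adj I w\<close> maximal is chosen.
      Dividing it by \<open>y\<close> gives \<open>v\<close> in \<open>V\<close> whose
      \<open>adj I v\<close> is at least as large, hence equal.\<close>
    have "adj I ` V \<noteq> {}" using z unfolding V_def by blast
    moreover have "ideal J R" if "J \<in> adj I ` V" for J
      using that sat_ideal[OF saturated_adj[OF id]] unfolding V_def by blast
    ultimately have "\<exists>J\<in>adj I ` V. \<forall>K\<in>adj I ` V. J \<subseteq> K \<longrightarrow> K = J"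
      by (rule exists_maximal_in)
    then obtain J where J: "J \<in> adj I ` V" "\<forall>K\<in>adj I ` V. J \<subseteq> K \<longrightarrow> K = J" ..
    obtain w where w: "w \<in> V" "J = adj I w" using J(1) by blast
    have wc: "w \<in> carrier R" "w \<notin> I" "ann I z \<subseteq> ann I w" using w unfolding V_def by auto
    have "w \<in> adj I y" using no w by blast
    then obtain s v where s: "s \<in> U" "s \<in> carrier R" "v \<in> carrier R" "congr I (s \<otimes> w) (y \<otimes> v)"
      by (metis adjE)
    have vI: "v \<notin> I"
    proof
      assume "v \<in> I"
      then have "s \<otimes> w \<in> I" using congr_mem[OF id s(4)] ideal_mult[OF id _ yc] by blast
      then show False using sat_cancel[OF I s(1) wc(1)] wc(2) by blast
    qed
    have "ann I z \<subseteq> ann I v"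
    proof
      fix p assume p: "p \<in> ann I z"
      then have pc: "p \<in> carrier R" by (simp add: ann_def)
      have "p \<otimes> w \<in> I" using p wc(3) by (auto simp: ann_def)
      then have "s \<otimes> (p \<otimes> w) \<in> I" using ideal_mult[OF id] s(2) by blast
      moreover have "s \<otimes> (p \<otimes> w) = p \<otimes> (s \<otimes> w)" using s pc wc by (simp add: m_lcomm)
      ultimately have "p \<otimes> (y \<otimes> v) \<in> I"
        using congr_mem[OF id congr_mult_left[OF id pc s(4)]] by simp
      moreover have "p \<otimes> (y \<otimes> v) = y \<otimes> (p \<otimes> v)" using s pc yc by (simp add: m_lcomm)
      ultimately have "p \<otimes> v \<in> I" using nzdD[OF y(2)] pc s(3) by simp
      then show "p \<in> ann I v" using pc by (simp add: ann_def)
    qed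
    then have vV: "v \<in> V" using s(3) vI unfolding V_def by blast
    have sv: "saturated (adj I v)" by (rule saturated_adj[OF id s(3)])
    have "y \<otimes> v \<in> adj I v" using adj_multiple[OF id s(3) yc] yc s(3) by (simp add: m_comm)
    then have "s \<otimes> w \<in> adj I v"
      using congr_mem[OF sat_ideal[OF sv] congr_mono[OF s(4) adj_superset[OF id s(3)]]] by blast
    then have "w \<in> adj I v" by (rule sat_cancel[OF sv s(1) wc(1)])
    then have "adj I w \<subseteq> adj I v" by (rule adj_least[OF sv adj_superset[OF id s(3)]])
    then have "adj I v = adj I w" using J(2) vV w(2) by auto
    then have "v \<in> adj I w" using adj_self[OF id s(3)] by simp
    then obtain t r where t: "t \<in> U" "t \<in> carrier R" "r \<in> carrier R" "congr I (t \<otimes> v) (w \<otimes> r)"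
      by (metis adjE)
    have 1: "congr I (s \<otimes> (t \<otimes> v)) (s \<otimes> (w \<otimes> r))" by (rule congr_mult_left[OF id s(2) t(4)])
    have "s \<otimes> (w \<otimes> r) = r \<otimes> (s \<otimes> w)" using s t wc by (simp add: m_ac)
    then have 2: "congr I (s \<otimes> (t \<otimes> v)) (r \<otimes> (y \<otimes> v))"
      using congr_trans[OF id 1] congr_mult_left[OF id t(3) s(4)] by simp
    have "(s \<otimes> t \<ominus> y \<otimes> r) \<otimes> v = s \<otimes> (t \<otimes> v) \<ominus> r \<otimes> (y \<otimes> v)"
      using s t yc by (simp add: a_minus_def l_distr r_distr l_minus r_minus m_ac)
    then have "(s \<otimes> t \<ominus> y \<otimes> r) \<otimes> v \<in> I" using 2 by (simp add: congr_def)
    \<comment> \<open>Nakayama's lemma in elementary form: \<open>y\<close> lies in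
      \<open>m\<close>, so this difference becomes a unit in the localization and \<open>v\<close>
      would be zero there.\<close>
    moreover have "s \<otimes> t \<ominus> y \<otimes> r \<in> U"
    proof -
      have "y \<otimes> r \<in> m" by (rule ideal_mult_right[OF ideal_m y(1) t(3)])
      then have "s \<otimes> t \<ominus> y \<otimes> r \<notin> m"
        using ideal_cancel_right[OF ideal_m _ \<open>y \<otimes> r \<in> m\<close>] U_mult[OF s(1) t(1)] by blast
      then show ?thesis using s t yc by simp
    qed
    ultimately show False using sat_cancel[OF I _ s(3)] vI by blast
  qed
  then obtain u where u: "u \<in> carrier R" "u \<notin> I" "ann I z \<subseteq> ann I u" "u \<notin> adj I y"
    unfolding V_def by blast
  obtain w where w: "max_ann (adj I y) w" "ann (adj I y) u \<subseteq> ann (adj I y) w"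
    using max_ann_exists[OF idy u(1,4)] .
  have "ann I u \<subseteq> ann (adj I y) u" using adj_superset[OF id yc] by (auto simp: ann_def)
  then have "ann I z \<subseteq> ann (adj I y) w" using u w by blast
  moreover have "y \<in> ann (adj I y) u" using adj_multiple[OF id yc u(1)] yc by (simp add: ann_def)
  moreover have "y \<notin> ann I z" using nzdD[OF y(2) z(1)] z(2) by (auto simp: ann_def)
  ultimately show thesis using that w by blast
qed

text \<open>This bounds depth by the dimension of the quotient by an associated prime: every regular
  element of \<open>m\<close> strictly enlarges the prime by \<open>ann_step\<close>. The last
  clause is there because the localization sees only chains inside \<open>m\<close>.\<close>

lemma dep_prime_chain:
  assumes "saturated I" "dep n I" "z \<in> carrier R" "z \<notin> I" "primeideal (ann I z) R"
  shows "\<exists>C. prime_chain R n C \<and> C 0 = ann I z \<and> C n \<subseteq> m"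
  using assms
proof (induction n arbitrary: I z)
  case 0
  then have "prime_chain R 0 (\<lambda>_. ann I z)" by (simp add: prime_chain_def)
  then show ?case using ann_subset_m[OF 0(1,3,4)] by fastforce
next
  case (Suc n)
  obtain y where y: "y \<in> m" "nzd I y" "dep n (adj I y)" using Suc.prems(2) by auto
  have id: "ideal I R" by (rule sat_ideal[OF Suc.prems(1)])
  have sy: "saturated (adj I y)" by (rule saturated_adj[OF id m_carr[OF y(1)]])
  obtain w where w: "max_ann (adj I y) w" "ann I z \<subset> ann (adj I y) w"
    using ann_step[OF Suc.prems(1,3,4) y(1,2)] .
  have "w \<in> carrier R" "w \<notin> adj I y" using w(1) by (auto simp: max_ann_def)
  then obtain C where C: "prime_chain R n C" "C 0 = ann (adj I y) w" "C n \<subseteq> m"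
    using Suc.IH[OF sy y(3) _ _ max_ann_prime[OF sat_ideal[OF sy] w(1)]] by blast
  have "prime_chain R (Suc n) (case_nat (ann I z) C)"
    using C w(2) Suc.prems(5) unfolding prime_chain_def by (auto split: nat.split)
  then show ?case using C by (intro exI[of _ "case_nat (ann I z) C"]) simp
qed

lemma regular_dep: "regular I xs \<Longrightarrow> set xs \<subseteq> m \<Longrightarrow> dep (length xs) I"
  by (induction xs arbitrary: I) auto

lemma dep_adjs:
  "saturated I \<Longrightarrow> regular I xs \<Longrightarrow> set xs \<subseteq> m \<Longrightarrow> dep (n + length xs) I \<Longrightarrow> dep n (adjs I xs)"
proof (induction xs arbitrary: I)
  case (Cons x xs)
  then have "dep (n + length xs) (adj I x)" using dep_adj[of I x "n + length xs"] by simp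
  then show ?case using Cons saturated_adj[OF sat_ideal m_carr] by simp
qed simp

text \<open>Let d be the depth at \<open>m\<close> and l the length of \<open>xs\<close>. A chain of
  length n ending at the associated prime and the chain of length d - l starting there, given by
  \<open>dep_prime_chain\<close>, glue to one of length at most d, so n is at most l. The premise
  \<open>cm\<close> is the Cohen-Macaulay condition in the form that depth is at least the
  dimension.\<close>

lemma height_associated_prime:
  assumes cm: "\<And>n C. prime_chain R n C \<Longrightarrow> C n \<subseteq> m \<Longrightarrow> dep n zero_sat"
    and xs: "regular zero_sat xs" "set xs \<subseteq> m"
    and z: "max_ann (adjs zero_sat xs) z"
  shows "height R (ann (adjs zero_sat xs) z) \<le> enat (length xs)"
proof -
  define P where "P = ann (adjs zero_sat xs) z"
  define l where "l = length xs"
  have sat: "saturated (adjs zero_sat xs)" by (rule saturated_adjs[OF saturated_zero_sat xs(2)])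
  have zc: "z \<in> carrier R" "z \<notin> adjs zero_sat xs" using z by (auto simp: max_ann_def)
  have prime: "primeideal P R" unfolding P_def by (rule max_ann_prime[OF sat_ideal[OF sat] z])
  obtain d where d: "dep d zero_sat" "\<not> dep (Suc d) zero_sat"
  proof -
    obtain n where "\<not> dep n zero_sat" using dep_bounded[OF saturated_zero_sat zero_sat_subset] by blast
    then show thesis using that by (induction n) auto
  qed
  have "dep l zero_sat" unfolding l_def by (rule regular_dep[OF xs])
  then have ld: "l \<le> d" using dep_antimono[of "Suc d" l] d(2) by (meson not_less_eq_eq)
  have "dep (d - l) (adjs zero_sat xs)"
    using dep_adjs[OF saturated_zero_sat xs, of "d - l"] d(1) ld by (simp add: l_def)
  then obtain D where D: "prime_chain R (d - l) D" "D 0 = P" "D (d - l) \<subseteq> m"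
    using dep_prime_chain[OF sat _ zc] prime unfolding P_def by blast
  have "enat n \<le> enat l" if C: "prime_chain R n C" "C n = P" for n C
  proof (rule ccontr)
    assume "\<not> ?thesis"
    then have nl: "l < n" by simp
    \<comment> \<open>Both chains pass through \<open>P\<close>, which occupies the single index
      \<open>n\<close>.\<close>
    define E where "E i = (if i \<le> n then C i else D (i - n))" for i
    have "prime_chain R (n + (d - l)) E"
      unfolding prime_chain_def
    proof (intro conjI allI impI)
      fix i assume "i \<le> n + (d - l)"
      then show "primeideal (E i) R" using C D unfolding prime_chain_def E_def by auto
    next
      fix i assume i: "i < n + (d - l)"
      consider "i < n" | "i = n" | "i > n" by linarith
      then show "E i \<subset> E (Suc i)"
      proof cases
        case 1
        then show ?thesis using C unfolding prime_chain_def E_def by auto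
      next
        case 2
        then have "0 < d - l" using i by simp
        then have "D 0 \<subset> D (Suc 0)" using D(1) unfolding prime_chain_def by blast
        then show ?thesis using 2 C(2) D(2) unfolding E_def by simp
      next
        case 3
        then have "i - n < d - l" "Suc i - n = Suc (i - n)" using i by auto
        then show ?thesis using 3 D unfolding prime_chain_def E_def by auto
      qed
    qed
    moreover have "E (n + (d - l)) \<subseteq> m" using C(2) D unfolding E_def by auto
    ultimately have "dep (n + (d - l)) zero_sat" by (rule cm)
    moreover have "Suc d \<le> n + (d - l)" using nl ld by simp
    ultimately show False using dep_antimono d(2) by blast
  qed
  then show ?thesis unfolding height_def P_def[symmetric] l_def[symmetric]
    by (intro Sup_least) auto
qed

lemma nzd_outside_small_primes:
  assumes "\<And>n C. prime_chain R n C \<Longrightarrow> C n \<subseteq> m \<Longrightarrow> dep n zero_sat"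
    and "regular zero_sat xs" "set xs \<subseteq> m"
  shows "\<exists>F. finite F \<and> (\<forall>P\<in>F. primeideal P R \<and> height R P \<le> enat (length xs)) \<and>
    (\<forall>x\<in>carrier R. x \<notin> \<Union>F \<longrightarrow> nzd (adjs zero_sat xs) x)"
proof -
  have id: "ideal (adjs zero_sat xs) R"
    by (rule sat_ideal[OF saturated_adjs[OF saturated_zero_sat assms(3)]])
  let ?F = "{ann (adjs zero_sat xs) z | z. max_ann (adjs zero_sat xs) z}"
  have "finite ?F" by (rule finite_max_ann[OF id])
  moreover have "primeideal P R \<and> height R P \<le> enat (length xs)" if P: "P \<in> ?F" for P
  proof -
    obtain z where z: "max_ann (adjs zero_sat xs) z" "P = ann (adjs zero_sat xs) z" using P by blast
    have "height R (ann (adjs zero_sat xs) z) \<le> enat (length xs)"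
      by (rule height_associated_prime) (fact assms z)+
    then show ?thesis using max_ann_prime[OF id z(1)] z(2) by simp
  qed
  moreover have "nzd (adjs zero_sat xs) x" if "x \<in> carrier R" "x \<notin> \<Union>?F" for x
    using that not_nzd_max_ann[OF id that(1)] by blast
  ultimately show ?thesis by blast
qed

end

section \<open>Localizations of Cohen--Macaulay rings\<close>

context localized_ring
begin

abbreviation frac :: "'a \<Rightarrow> 'a \<Rightarrow> ('a \<times> 'a) set" where "frac \<equiv> fraction R U"

abbreviation L :: "('a \<times> 'a) set ring" where "L \<equiv> localization_at R m"

lemma ideal_zero_sat: "ideal zero_sat R"
  by (rule sat_ideal[OF saturated_zero_sat])

lemma zero_sat_least:
  assumes "saturated I" shows "zero_sat \<subseteq> I"
proof
  fix a assume "a \<in> zero_sat"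
  then obtain s where s: "a \<in> carrier R" "s \<in> U" "s \<otimes> a = \<zero>" unfolding zero_sat_def by blast
  then show "a \<in> I" using sat_cancel[OF assms s(2,1)] ideal_zero[OF sat_ideal[OF assms]] by simp
qed

text \<open>Vanishing of a cross difference after multiplication by an element of \<open>U\<close>
  means congruence modulo \<open>zero_sat\<close>; this reduces identities between fractions to the
  calculus of \<open>congr\<close>.\<close>

lemma mem_frac_iff:
  assumes "r \<in> carrier R" "s \<in> U"
  shows "(r', s') \<in> frac r s \<longleftrightarrow> r' \<in> carrier R \<and> s' \<in> U \<and> congr zero_sat (r \<otimes> s') (r' \<otimes> s)"
  using assms unfolding fraction_def zero_sat_def congr_def by auto

lemma frac_equiv_trans:
  assumes "r \<in> carrier R" "s \<in> U" "r' \<in> carrier R" "s' \<in> U" "r'' \<in> carrier R" "s'' \<in> U"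
    and 1: "congr zero_sat (r \<otimes> s') (r' \<otimes> s)" and 2: "congr zero_sat (r' \<otimes> s'') (r'' \<otimes> s')"
  shows "congr zero_sat (r \<otimes> s'') (r'' \<otimes> s)"
proof -
  have c: "r \<in> carrier R" "s \<in> carrier R" "r' \<in> carrier R" "s' \<in> carrier R" "r'' \<in> carrier R" "s'' \<in> carrier R"
    using assms by auto
  have "congr zero_sat (s'' \<otimes> (r \<otimes> s')) (s'' \<otimes> (r' \<otimes> s))"
    by (rule congr_mult_left[OF ideal_zero_sat c(6) 1])
  moreover have "congr zero_sat (s \<otimes> (r' \<otimes> s'')) (s \<otimes> (r'' \<otimes> s'))"
    by (rule congr_mult_left[OF ideal_zero_sat c(2) 2])
  moreover have "s'' \<otimes> (r' \<otimes> s) = s \<otimes> (r' \<otimes> s'')" using c by (simp add: m_ac)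
  ultimately have "congr zero_sat (s'' \<otimes> (r \<otimes> s')) (s \<otimes> (r'' \<otimes> s'))"
    using congr_trans[OF ideal_zero_sat] by simp
  moreover have "s'' \<otimes> (r \<otimes> s') \<ominus> s \<otimes> (r'' \<otimes> s') = s' \<otimes> (r \<otimes> s'' \<ominus> r'' \<otimes> s)"
    using c by (simp add: a_minus_def r_distr r_minus m_ac)
  ultimately have "s' \<otimes> (r \<otimes> s'' \<ominus> r'' \<otimes> s) \<in> zero_sat" by (simp add: congr_def)
  then have "r \<otimes> s'' \<ominus> r'' \<otimes> s \<in> zero_sat"
    using sat_cancel[OF saturated_zero_sat assms(4)] c by simp
  then show ?thesis using c by (simp add: congr_def)
qed

lemma frac_eq_iff:
  assumes "r \<in> carrier R" "s \<in> U" "r' \<in> carrier R" "s' \<in> U"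
  shows "frac r s = frac r' s' \<longleftrightarrow> congr zero_sat (r \<otimes> s') (r' \<otimes> s)"
proof
  assume "frac r s = frac r' s'"
  moreover have "(r', s') \<in> frac r' s'"
    using assms mem_frac_iff[OF assms(3,4)] congr_refl[OF ideal_zero_sat] by simp
  ultimately show "congr zero_sat (r \<otimes> s') (r' \<otimes> s)" using mem_frac_iff[OF assms(1,2)] by simp
next
  assume c: "congr zero_sat (r \<otimes> s') (r' \<otimes> s)"
  have "(a, b) \<in> frac r s \<longleftrightarrow> (a, b) \<in> frac r' s'" for a b
    using frac_equiv_trans[OF assms(3,4,1,2), of a b] frac_equiv_trans[OF assms, of a b]
      c congr_sym[OF ideal_zero_sat c] mem_frac_iff assms by auto
  then show "frac r s = frac r' s'" by auto
qed

lemma frac_self: "r \<in> carrier R \<Longrightarrow> s \<in> U \<Longrightarrow> (r, s) \<in> frac r s"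
  using mem_frac_iff congr_refl[OF ideal_zero_sat] by simp

lemma frac_cancel:
  assumes "r \<in> carrier R" "s \<in> U" "u \<in> U"
  shows "frac (u \<otimes> r) (u \<otimes> s) = frac r s"
proof -
  have "(u \<otimes> r) \<otimes> s = r \<otimes> (u \<otimes> s)" using assms by (simp add: m_ac)
  then show ?thesis
    using frac_eq_iff[of "u \<otimes> r" "u \<otimes> s" r s] assms U_mult[of u s] congr_refl[OF ideal_zero_sat]
    by simp
qed

text \<open>The operations on fractions are unions over all pairs of representatives; once every
  pair yields the same class, the union collapses to it.\<close>

lemma UN_frac:
  assumes c: "r \<in> carrier R" "s \<in> U" "r' \<in> carrier R" "s' \<in> U"
    and eq: "\<And>a b a' b'. (a, b) \<in> frac r s \<Longrightarrow> (a', b') \<in> frac r' s' \<Longrightarrow> f a b a' b' = f r s r' s'"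
  shows "(\<Union>(a, b)\<in>frac r s. \<Union>(a', b')\<in>frac r' s'. f a b a' b') = f r s r' s'"
proof (intro equalityI subsetI)
  fix x assume "x \<in> (\<Union>(a, b)\<in>frac r s. \<Union>(a', b')\<in>frac r' s'. f a b a' b')"
  then obtain a b a' b' where "(a, b) \<in> frac r s" "(a', b') \<in> frac r' s'" "x \<in> f a b a' b'" by auto
  then show "x \<in> f r s r' s'" using eq by simp
next
  fix x assume "x \<in> f r s r' s'"
  then have "x \<in> (\<Union>(a', b')\<in>frac r' s'. f r s a' b')"
    by (intro UN_I[OF frac_self[OF c(3,4)]]) simp
  then show "x \<in> (\<Union>(a, b)\<in>frac r s. \<Union>(a', b')\<in>frac r' s'. f a b a' b')"
    by (intro UN_I[OF frac_self[OF c(1,2)]]) (simp only: prod.case)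
qed

lemma L_mult:
  assumes c: "r \<in> carrier R" "s \<in> U" "r' \<in> carrier R" "s' \<in> U"
  shows "frac r s \<otimes>\<^bsub>L\<^esub> frac r' s' = frac (r \<otimes> r') (s \<otimes> s')"
proof -
  have "(\<Union>(a, b)\<in>frac r s. \<Union>(a', b')\<in>frac r' s'. frac (a \<otimes> a') (b \<otimes> b')) = frac (r \<otimes> r') (s \<otimes> s')"
  proof (rule UN_frac[OF c, where f = "\<lambda>a b a' b'. frac (a \<otimes> a') (b \<otimes> b')"])
    fix a b a' b' assume "(a, b) \<in> frac r s" "(a', b') \<in> frac r' s'"
    then have a: "a \<in> carrier R" "b \<in> U" "a' \<in> carrier R" "b' \<in> U"
      and e: "congr zero_sat (r \<otimes> b) (a \<otimes> s)" "congr zero_sat (r' \<otimes> b') (a' \<otimes> s')"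
      using mem_frac_iff c by auto
    have "congr zero_sat ((a \<otimes> s) \<otimes> (a' \<otimes> s')) ((r \<otimes> b) \<otimes> (r' \<otimes> b'))"
      using congr_sym[OF ideal_zero_sat congr_mult[OF ideal_zero_sat e]] .
    moreover have "(a \<otimes> s) \<otimes> (a' \<otimes> s') = (a \<otimes> a') \<otimes> (s \<otimes> s')" "(r \<otimes> b) \<otimes> (r' \<otimes> b') = (r \<otimes> r') \<otimes> (b \<otimes> b')"
      using a c by (simp_all add: m_ac)
    ultimately show "frac (a \<otimes> a') (b \<otimes> b') = frac (r \<otimes> r') (s \<otimes> s')"
      using frac_eq_iff[of "a \<otimes> a'" "b \<otimes> b'" "r \<otimes> r'" "s \<otimes> s'"] a c U_mult by simp
  qed
  then show ?thesis by (simp add: localization_at_def localization_def)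
qed

lemma L_add:
  assumes c: "r \<in> carrier R" "s \<in> U" "r' \<in> carrier R" "s' \<in> U"
  shows "frac r s \<oplus>\<^bsub>L\<^esub> frac r' s' = frac (r \<otimes> s' \<oplus> r' \<otimes> s) (s \<otimes> s')"
proof -
  have "(\<Union>(a, b)\<in>frac r s. \<Union>(a', b')\<in>frac r' s'. frac (a \<otimes> b' \<oplus> a' \<otimes> b) (b \<otimes> b'))
    = frac (r \<otimes> s' \<oplus> r' \<otimes> s) (s \<otimes> s')"
  proof (rule UN_frac[OF c, where f = "\<lambda>a b a' b'. frac (a \<otimes> b' \<oplus> a' \<otimes> b) (b \<otimes> b')"])
    fix a b a' b' assume "(a, b) \<in> frac r s" "(a', b') \<in> frac r' s'"
    then have a: "a \<in> carrier R" "b \<in> U" "a' \<in> carrier R" "b' \<in> U"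
      and e: "congr zero_sat (r \<otimes> b) (a \<otimes> s)" "congr zero_sat (r' \<otimes> b') (a' \<otimes> s')"
      using mem_frac_iff c by auto
    have cc: "a \<in> carrier R" "b \<in> carrier R" "a' \<in> carrier R" "b' \<in> carrier R"
      "s \<in> carrier R" "s' \<in> carrier R" "b' \<otimes> s' \<in> carrier R" "b \<otimes> s \<in> carrier R" using a c by auto
    have "congr zero_sat ((b' \<otimes> s') \<otimes> (a \<otimes> s) \<oplus> (b \<otimes> s) \<otimes> (a' \<otimes> s'))
        ((b' \<otimes> s') \<otimes> (r \<otimes> b) \<oplus> (b \<otimes> s) \<otimes> (r' \<otimes> b'))"
      by (rule congr_add[OF ideal_zero_sat
          congr_mult_left[OF ideal_zero_sat cc(7) congr_sym[OF ideal_zero_sat e(1)]]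
          congr_mult_left[OF ideal_zero_sat cc(8) congr_sym[OF ideal_zero_sat e(2)]]])
    moreover have "(b' \<otimes> s') \<otimes> (a \<otimes> s) \<oplus> (b \<otimes> s) \<otimes> (a' \<otimes> s') = (a \<otimes> b' \<oplus> a' \<otimes> b) \<otimes> (s \<otimes> s')"
      using a c by (simp add: l_distr r_distr m_ac)
    moreover have "(b' \<otimes> s') \<otimes> (r \<otimes> b) \<oplus> (b \<otimes> s) \<otimes> (r' \<otimes> b') = (r \<otimes> s' \<oplus> r' \<otimes> s) \<otimes> (b \<otimes> b')"
      using a c by (simp add: l_distr r_distr m_ac)
    ultimately show "frac (a \<otimes> b' \<oplus> a' \<otimes> b) (b \<otimes> b') = frac (r \<otimes> s' \<oplus> r' \<otimes> s) (s \<otimes> s')"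
      using frac_eq_iff[of "a \<otimes> b' \<oplus> a' \<otimes> b" "b \<otimes> b'" "r \<otimes> s' \<oplus> r' \<otimes> s" "s \<otimes> s'"] a c U_mult by simp
  qed
  then show ?thesis by (simp add: localization_at_def localization_def)
qed

lemma L_carrier: "carrier L = {frac r s | r s. r \<in> carrier R \<and> s \<in> U}"
  by (simp add: localization_at_def localization_def)

lemma L_carrierE:
  assumes "x \<in> carrier L" obtains r s where "r \<in> carrier R" "s \<in> U" "x = frac r s"
  using assms unfolding L_carrier by blast

lemma frac_carrier: "r \<in> carrier R \<Longrightarrow> s \<in> U \<Longrightarrow> frac r s \<in> carrier L"
  unfolding L_carrier by blast

lemma L_one: "\<one>\<^bsub>L\<^esub> = frac \<one> \<one>" and L_zero: "\<zero>\<^bsub>L\<^esub> = frac \<zero> \<one>"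
  by (simp_all add: localization_at_def localization_def)

lemma frac_zero:
  assumes "s \<in> U" shows "frac \<zero> s = \<zero>\<^bsub>L\<^esub>"
  unfolding L_zero using frac_eq_iff[of \<zero> s \<zero> \<one>] U_one assms congr_refl[OF ideal_zero_sat] by simp

lemma cring_L: "cring L"
proof (rule cringI)
  show "abelian_group L"
  proof (rule abelian_groupI)
    fix x y assume x: "x \<in> carrier L" and y: "y \<in> carrier L"
    obtain r s where r: "r \<in> carrier R" "s \<in> U" "x = frac r s" using x by (rule L_carrierE)
    obtain r' s' where r': "r' \<in> carrier R" "s' \<in> U" "y = frac r' s'" using y by (rule L_carrierE)
    show "x \<oplus>\<^bsub>L\<^esub> y \<in> carrier L" using r r' U_mult by (auto simp: L_add intro!: frac_carrier)
    show "x \<oplus>\<^bsub>L\<^esub> y = y \<oplus>\<^bsub>L\<^esub> x" using r r' by (simp add: L_add a_comm m_comm)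
    fix z assume z: "z \<in> carrier L"
    obtain r'' s'' where r'': "r'' \<in> carrier R" "s'' \<in> U" "z = frac r'' s''" using z by (rule L_carrierE)
    have U': "s \<otimes> s' \<in> U" "s' \<otimes> s'' \<in> U" using r r' r'' U_mult by auto
    have "(r \<otimes> s' \<oplus> r' \<otimes> s) \<otimes> s'' \<oplus> r'' \<otimes> (s \<otimes> s') = r \<otimes> (s' \<otimes> s'') \<oplus> (r' \<otimes> s'' \<oplus> r'' \<otimes> s') \<otimes> s"
      using r r' r'' by (simp add: l_distr r_distr m_ac a_ac)
    moreover have "s \<otimes> s' \<otimes> s'' = s \<otimes> (s' \<otimes> s'')" using r r' r'' by (simp add: m_assoc)
    ultimately show "x \<oplus>\<^bsub>L\<^esub> y \<oplus>\<^bsub>L\<^esub> z = x \<oplus>\<^bsub>L\<^esub> (y \<oplus>\<^bsub>L\<^esub> z)"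
      using r r' r'' U' by (simp add: L_add del: Diff_iff) (simp add: L_add)
  next
    show "\<zero>\<^bsub>L\<^esub> \<in> carrier L" unfolding L_zero using U_one by (simp add: frac_carrier)
  next
    fix x assume x: "x \<in> carrier L"
    obtain r s where r: "r \<in> carrier R" "s \<in> U" "x = frac r s" using x by (rule L_carrierE)
    show "\<zero>\<^bsub>L\<^esub> \<oplus>\<^bsub>L\<^esub> x = x" unfolding L_zero using r U_one by (simp add: L_add)
    have "frac (\<ominus> r) s \<oplus>\<^bsub>L\<^esub> x = frac (\<ominus> r \<otimes> s \<oplus> r \<otimes> s) (s \<otimes> s)" using r by (simp add: L_add)
    also have "\<ominus> r \<otimes> s \<oplus> r \<otimes> s = \<zero>" using r by (simp add: l_minus l_neg)
    finally have "frac (\<ominus> r) s \<oplus>\<^bsub>L\<^esub> x = \<zero>\<^bsub>L\<^esub>" using r frac_zero U_mult by simp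
    then show "\<exists>y\<in>carrier L. y \<oplus>\<^bsub>L\<^esub> x = \<zero>\<^bsub>L\<^esub>" using r frac_carrier a_inv_closed by blast
  qed
  show "comm_monoid L"
  proof (rule comm_monoidI)
    fix x y assume x: "x \<in> carrier L" and y: "y \<in> carrier L"
    obtain r s where r: "r \<in> carrier R" "s \<in> U" "x = frac r s" using x by (rule L_carrierE)
    obtain r' s' where r': "r' \<in> carrier R" "s' \<in> U" "y = frac r' s'" using y by (rule L_carrierE)
    show "x \<otimes>\<^bsub>L\<^esub> y \<in> carrier L" using r r' U_mult by (auto simp: L_mult intro!: frac_carrier)
    show "x \<otimes>\<^bsub>L\<^esub> y = y \<otimes>\<^bsub>L\<^esub> x" using r r' by (simp add: L_mult m_comm)
    fix z assume z: "z \<in> carrier L"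
    obtain r'' s'' where r'': "r'' \<in> carrier R" "s'' \<in> U" "z = frac r'' s''" using z by (rule L_carrierE)
    have U': "s \<otimes> s' \<in> U" "s' \<otimes> s'' \<in> U" using r r' r'' U_mult by auto
    show "x \<otimes>\<^bsub>L\<^esub> y \<otimes>\<^bsub>L\<^esub> z = x \<otimes>\<^bsub>L\<^esub> (y \<otimes>\<^bsub>L\<^esub> z)"
      using r r' r'' U' by (simp add: L_mult m_assoc)
  next
    show "\<one>\<^bsub>L\<^esub> \<in> carrier L" unfolding L_one using U_one by (simp add: frac_carrier)
  next
    fix x assume x: "x \<in> carrier L"
    obtain r s where r: "r \<in> carrier R" "s \<in> U" "x = frac r s" using x by (rule L_carrierE)
    show "\<one>\<^bsub>L\<^esub> \<otimes>\<^bsub>L\<^esub> x = x" unfolding L_one using r U_one by (simp add: L_mult)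
  qed
  fix x y z assume x: "x \<in> carrier L" and y: "y \<in> carrier L" and z: "z \<in> carrier L"
  obtain a s where a: "a \<in> carrier R" "s \<in> U" "x = frac a s" using x by (rule L_carrierE)
  obtain b t where b: "b \<in> carrier R" "t \<in> U" "y = frac b t" using y by (rule L_carrierE)
  obtain c u where c: "c \<in> carrier R" "u \<in> U" "z = frac c u" using z by (rule L_carrierE)
  have U': "s \<otimes> t \<in> U" "s \<otimes> u \<in> U" "t \<otimes> u \<in> U" using a b c U_mult by auto
  have C: "s \<in> carrier R" "t \<in> carrier R" "u \<in> carrier R" using a b c by auto
  have "(x \<oplus>\<^bsub>L\<^esub> y) \<otimes>\<^bsub>L\<^esub> z = frac ((a \<otimes> t \<oplus> b \<otimes> s) \<otimes> c) ((s \<otimes> t) \<otimes> u)"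
    using a b c U' C by (simp add: L_add L_mult del: Diff_iff)
  \<comment> \<open>The sum on the other side has denominator (s u)(t u), so the fraction is
    expanded by \<open>u\<close> first.\<close>
  also have "\<dots> = frac (u \<otimes> ((a \<otimes> t \<oplus> b \<otimes> s) \<otimes> c)) (u \<otimes> ((s \<otimes> t) \<otimes> u))"
    by (rule frac_cancel[symmetric]) (use a b c U' C U_mult in auto)
  also have "u \<otimes> ((a \<otimes> t \<oplus> b \<otimes> s) \<otimes> c) = (a \<otimes> c) \<otimes> (t \<otimes> u) \<oplus> (b \<otimes> c) \<otimes> (s \<otimes> u)"
    using a(1) b(1) c(1) C by (simp add: r_distr l_distr m_ac)
  also have "u \<otimes> ((s \<otimes> t) \<otimes> u) = (s \<otimes> u) \<otimes> (t \<otimes> u)"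
    using C by (simp add: m_ac)
  also have "frac ((a \<otimes> c) \<otimes> (t \<otimes> u) \<oplus> (b \<otimes> c) \<otimes> (s \<otimes> u)) ((s \<otimes> u) \<otimes> (t \<otimes> u))
    = x \<otimes>\<^bsub>L\<^esub> z \<oplus>\<^bsub>L\<^esub> y \<otimes>\<^bsub>L\<^esub> z"
    using a b c U' C by (simp add: L_add L_mult del: Diff_iff)
  finally show "(x \<oplus>\<^bsub>L\<^esub> y) \<otimes>\<^bsub>L\<^esub> z = x \<otimes>\<^bsub>L\<^esub> z \<oplus>\<^bsub>L\<^esub> y \<otimes>\<^bsub>L\<^esub> z" .
qed

section \<open>Primes, ideals and regular sequences of the localization\<close>

definition ext :: "'a set \<Rightarrow> ('a \<times> 'a) set set" where
  "ext I = {frac a s | a s. a \<in> I \<and> s \<in> U}"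

text \<open>Saturation is what makes membership independent of the numerator that represents the
  fraction.\<close>

lemma frac_mem_ext_iff:
  assumes I: "saturated I" and r: "r \<in> carrier R" "s \<in> U"
  shows "frac r s \<in> ext I \<longleftrightarrow> r \<in> I"
proof
  assume "frac r s \<in> ext I"
  then obtain a t where a: "a \<in> I" "t \<in> U" "frac r s = frac a t" unfolding ext_def by blast
  have ac: "a \<in> carrier R" "t \<in> carrier R" "s \<in> carrier R" using a(2) r(2) ideal_carr[OF sat_ideal[OF I] a(1)] by auto
  have "congr zero_sat (r \<otimes> t) (a \<otimes> s)" using frac_eq_iff[OF r ac(1) a(2)] a(3) by simp
  then have "congr I (r \<otimes> t) (a \<otimes> s)" by (rule congr_mono[OF _ zero_sat_least[OF I]])
  moreover have "a \<otimes> s \<in> I" by (rule ideal_mult_right[OF sat_ideal[OF I] a(1) ac(3)])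
  ultimately have "r \<otimes> t \<in> I" using congr_mem[OF sat_ideal[OF I]] by blast
  then have "t \<otimes> r \<in> I" using r ac by (simp add: m_comm)
  then show "r \<in> I" by (rule sat_cancel[OF I a(2) r(1)])
qed (use r in \<open>auto simp: ext_def\<close>)

lemma ideal_ext:
  assumes I: "saturated I" shows "ideal (ext I) L"
proof (rule cring.ideal_intro[OF cring_L])
  have id: "ideal I R" by (rule sat_ideal[OF I])
  show "ext I \<subseteq> carrier L" using ideal_carr[OF id] by (auto simp: ext_def intro: frac_carrier)
  show "\<zero>\<^bsub>L\<^esub> \<in> ext I" unfolding L_zero using frac_mem_ext_iff[OF I zero_closed U_one] ideal_zero[OF id] by simp
  fix x y assume x: "x \<in> ext I"
  obtain a s where a: "a \<in> I" "a \<in> carrier R" "s \<in> U" "x = frac a s"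
    using x ideal_carr[OF id] unfolding ext_def by blast
  {
    assume y: "y \<in> ext I"
    obtain b t where b: "b \<in> I" "b \<in> carrier R" "t \<in> U" "y = frac b t"
      using y ideal_carr[OF id] unfolding ext_def by blast
    have "a \<otimes> t \<oplus> b \<otimes> s \<in> I" using a b by (intro ideal_add[OF id] ideal_mult_right[OF id]) auto
    moreover have "x \<oplus>\<^bsub>L\<^esub> y = frac (a \<otimes> t \<oplus> b \<otimes> s) (s \<otimes> t)" using a b by (simp add: L_add)
    ultimately show "x \<oplus>\<^bsub>L\<^esub> y \<in> ext I" using U_mult[OF a(3) b(3)] unfolding ext_def by blast
  }
  assume y: "y \<in> carrier L"
  then obtain b t where b: "b \<in> carrier R" "t \<in> U" "y = frac b t" by (rule L_carrierE)
  have "b \<otimes> a \<in> I" by (rule ideal_mult[OF id a(1) b(1)])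
  moreover have "y \<otimes>\<^bsub>L\<^esub> x = frac (b \<otimes> a) (t \<otimes> s)" using a b by (simp add: L_mult)
  ultimately show "y \<otimes>\<^bsub>L\<^esub> x \<in> ext I" using U_mult[OF b(2) a(3)] unfolding ext_def by blast
qed

lemma saturated_prime:
  assumes P: "primeideal P R" "P \<subseteq> m" shows "saturated P"
  unfolding saturated_def using primeideal.I_prime[OF P(1)] primeideal.axioms(1)[OF P(1)] P(2) by blast

lemma prime_ext:
  assumes P: "primeideal P R" "P \<subseteq> m" shows "primeideal (ext P) L"
proof (rule primeidealI[OF ideal_ext cring_L])
  show sP: "saturated P" by (rule saturated_prime[OF P])
  have "frac \<one> \<one> \<notin> ext P" using frac_mem_ext_iff[OF sP one_closed U_one] prime_one_notin[OF P(1)] by simp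
  then show "carrier L \<noteq> ext P" using frac_carrier[OF one_closed U_one] by blast
  fix x y assume x: "x \<in> carrier L" and y: "y \<in> carrier L" and xy: "x \<otimes>\<^bsub>L\<^esub> y \<in> ext P"
  obtain a s where a: "a \<in> carrier R" "s \<in> U" "x = frac a s" using x by (rule L_carrierE)
  obtain b t where b: "b \<in> carrier R" "t \<in> U" "y = frac b t" using y by (rule L_carrierE)
  have "frac (a \<otimes> b) (s \<otimes> t) \<in> ext P" using xy a b by (simp add: L_mult)
  then have "a \<otimes> b \<in> P" using frac_mem_ext_iff[OF sP _ U_mult[OF a(2) b(2)]] a(1) b(1) by simp
  then show "x \<in> ext P \<or> y \<in> ext P"
    using primeideal.I_prime[OF P(1) a(1) b(1)] a b frac_mem_ext_iff[OF sP] by blast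
qed

lemma prime_chain_ext:
  assumes C: "prime_chain R n C" "C n \<subseteq> m"
  shows "prime_chain L n (\<lambda>i. ext (C i))"
proof -
  have "C i \<subseteq> C n" if "i \<le> n" for i
    using that C(1) by (induction rule: inc_induct) (auto simp: prime_chain_def)
  then have sub: "C i \<subseteq> m" if "i \<le> n" for i using that C(2) by blast
  have prime: "primeideal (C i) R" if "i \<le> n" for i using that C(1) by (simp add: prime_chain_def)
  have "ext (C i) \<subset> ext (C (Suc i))" if i: "i < n" for i
  proof -
    have ss: "C i \<subset> C (Suc i)" using C(1) i by (simp add: prime_chain_def)
    then obtain a where a: "a \<in> C (Suc i)" "a \<notin> C i" by blast
    have ac: "a \<in> carrier R" using ideal_carr[OF primeideal.axioms(1)[OF prime] a(1)] i by simp
    have "frac a \<one> \<in> ext (C (Suc i))" using a(1) U_one unfolding ext_def by blast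
    moreover have "frac a \<one> \<notin> ext (C i)"
      using frac_mem_ext_iff[OF saturated_prime[OF prime sub] ac U_one] a(2) i by simp
    moreover have "ext (C i) \<subseteq> ext (C (Suc i))" using ss unfolding ext_def by blast
    ultimately show ?thesis by blast
  qed
  then show ?thesis using prime_ext[OF prime sub] by (simp add: prime_chain_def)
qed

text \<open>This evaluates the description inside \<open>local_depth\<close>: a fraction outside
  \<open>ext m\<close> is a unit, so \<open>ext m\<close> contains every proper ideal.\<close>

lemma the_maximal_L: "(THE M. maximalideal M L) = ext m"
proof -
  have notin: "\<one>\<^bsub>L\<^esub> \<notin> ext m"
    unfolding L_one using frac_mem_ext_iff[OF saturated_m one_closed U_one] U_one by simp
  have sub: "J \<subseteq> ext m" if J: "ideal J L" "J \<noteq> carrier L" for J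
  proof
    fix x assume x: "x \<in> J"
    then have "x \<in> carrier L" using cring.ideal_carr[OF cring_L J(1)] by blast
    then obtain r s where r: "r \<in> carrier R" "s \<in> U" "x = frac r s" by (rule L_carrierE)
    show "x \<in> ext m"
    proof (rule ccontr)
      assume "x \<notin> ext m"
      then have rU: "r \<in> U" using r unfolding ext_def by blast
      have "frac s r \<otimes>\<^bsub>L\<^esub> x \<in> J"
        by (rule cring.ideal_mult[OF cring_L J(1) x]) (use r rU in \<open>simp add: frac_carrier\<close>)
      moreover have "frac s r \<otimes>\<^bsub>L\<^esub> x = frac (s \<otimes> r) (r \<otimes> s)" using r rU by (simp add: L_mult)
      moreover have "frac (s \<otimes> r) (r \<otimes> s) = \<one>\<^bsub>L\<^esub>" unfolding L_one
        using frac_eq_iff[of "s \<otimes> r" "r \<otimes> s" \<one> \<one>] U_one U_mult[OF rU r(2)] r rU congr_refl[OF ideal_zero_sat]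
        by (simp add: m_comm)
      ultimately have "\<one>\<^bsub>L\<^esub> \<in> J" by simp
      then show False using J ideal.one_imp_carrier by blast
    qed
  qed
  have id: "ideal (ext m) L" by (rule ideal_ext[OF saturated_m])
  have ne: "carrier L \<noteq> ext m"
    using notin frac_carrier[OF one_closed U_one] by (metis L_one)
  have "maximalideal (ext m) L"
    by (rule maximalidealI[OF id ne]) (use sub in blast)
  moreover have "M = ext m" if M: "maximalideal M L" for M
  proof -
    have "M \<subseteq> ext m" using sub maximalideal.axioms(1)[OF M] maximalideal.I_notcarr[OF M] by blast
    then show ?thesis
      using maximalideal.I_maximal[OF M id] ne cring.ideal_carr[OF cring_L id] by blast
  qed
  ultimately show ?thesis by (rule the_equality)
qed

lemma adjs_append: "adjs I (xs @ ys) = adjs (adjs I xs) ys"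
  by (induction xs arbitrary: I) auto

lemma regular_iff_nth: "regular I xs \<longleftrightarrow> (\<forall>i<length xs. nzd (adjs I (take i xs)) (xs ! i))"
proof (induction xs arbitrary: I)
  case (Cons x xs)
  show ?case using Cons by (auto simp: less_Suc_eq_0_disj)
qed simp

text \<open>The bridge from generated ideals of the localization to iterated \<open>adj\<close>.
  Denominators are units, so only the numerators survive; induction from the end of the list adjoins
  the last generator last, as \<open>adjs\<close> does.\<close>

lemma genideal_frac:
  assumes "set ps \<subseteq> m \<times> U"
  shows "genideal L (set (map (\<lambda>(r, s). frac r s) ps)) = ext (adjs zero_sat (map fst ps))"
  using assms
proof (induction ps rule: rev_induct)
  interpret L: cring L by (rule cring_L)
  case Nil
  have "ext zero_sat \<subseteq> genideal L {}"
  proof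
    fix x assume "x \<in> ext zero_sat"
    then obtain a s where a: "a \<in> zero_sat" "s \<in> U" "x = frac a s" unfolding ext_def by blast
    have ac: "a \<in> carrier R" using ideal_carr[OF ideal_zero_sat a(1)] .
    have "congr zero_sat (a \<otimes> \<one>) (\<zero> \<otimes> s)" using mem_congr_zero[OF ideal_zero_sat a(1)] ac a(2) by simp
    then have "x = \<zero>\<^bsub>L\<^esub>" unfolding L_zero using frac_eq_iff[OF ac a(2) zero_closed U_one] a(3) by simp
    then show "x \<in> genideal L {}" using L.ideal_zero[OF L.genideal_ideal] by simp
  qed
  moreover have "genideal L {} \<subseteq> ext zero_sat"
    by (rule L.genideal_minimal[OF ideal_ext[OF saturated_zero_sat]]) simp
  ultimately show ?case by simp
next
  interpret L: cring L by (rule cring_L)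
  case (snoc p ps)
  obtain r s where p: "p = (r, s)" by fastforce
  then have r: "r \<in> m" "s \<in> U" using snoc.prems by auto
  have rc: "r \<in> carrier R" and sc: "s \<in> carrier R" using r m_carr by auto
  define K where "K = adjs zero_sat (map fst ps)"
  define Y where "Y = set (map (\<lambda>(r, s). frac r s) ps)"
  have sub: "set ps \<subseteq> m \<times> U" using snoc.prems by simp
  have sK: "saturated K" unfolding K_def
    by (rule saturated_adjs[OF saturated_zero_sat]) (use sub in force)
  have Yc: "Y \<subseteq> carrier L" unfolding Y_def using sub m_carr by (force intro: frac_carrier)
  have IH: "genideal L Y = ext K" unfolding Y_def K_def by (rule snoc.IH[OF sub])
  have yc: "insert (frac r s) Y \<subseteq> carrier L" using Yc frac_carrier[OF rc r(2)] by simp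
  define G where "G = genideal L (insert (frac r s) Y)"
  have idG: "ideal G L" unfolding G_def by (rule L.genideal_ideal[OF yc])
  have YG: "insert (frac r s) Y \<subseteq> G" unfolding G_def by (rule L.genideal_self[OF yc])
  have sKr: "saturated (adj K r)" by (rule saturated_adj[OF sat_ideal[OF sK] rc])
  have "G \<subseteq> ext (adj K r)"
    unfolding G_def
  proof (rule L.genideal_minimal[OF ideal_ext[OF sKr]])
    have "Y \<subseteq> ext K" using L.genideal_self[OF Yc] IH by simp
    also have "\<dots> \<subseteq> ext (adj K r)" using adj_superset[OF sat_ideal[OF sK] rc] unfolding ext_def by blast
    finally show "insert (frac r s) Y \<subseteq> ext (adj K r)"
      using adj_self[OF sat_ideal[OF sK] rc] r(2) unfolding ext_def by blast
  qed
  moreover have "ext (adj K r) \<subseteq> G"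
  proof
    fix x assume "x \<in> ext (adj K r)"
    then obtain a t where a: "a \<in> adj K r" "t \<in> U" "x = frac a t" unfolding ext_def by blast
    obtain u c where u: "a \<in> carrier R" "u \<in> U" "u \<in> carrier R" "c \<in> carrier R" "congr K (u \<otimes> a) (r \<otimes> c)"
      using a(1) by (rule adjE)
    have "ext K \<subseteq> G" using L.genideal_minimal[OF idG, of Y] YG IH by simp
    moreover have "u \<otimes> a \<ominus> r \<otimes> c \<in> K" using u(5) by (simp add: congr_def)
    ultimately have 1: "frac (u \<otimes> a \<ominus> r \<otimes> c) \<one> \<in> G" using U_one unfolding ext_def by blast
    have "frac (c \<otimes> s) \<one> \<otimes>\<^bsub>L\<^esub> frac r s \<in> G"
      by (rule L.ideal_mult[OF idG]) (use YG U_one sc u in \<open>auto intro!: frac_carrier\<close>)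
    moreover have "frac (c \<otimes> s) \<one> \<otimes>\<^bsub>L\<^esub> frac r s = frac (s \<otimes> (r \<otimes> c)) (s \<otimes> \<one>)"
      using L_mult[of "c \<otimes> s" \<one> r s] u sc rc r U_one by (simp add: m_ac)
    moreover have "frac (s \<otimes> (r \<otimes> c)) (s \<otimes> \<one>) = frac (r \<otimes> c) \<one>"
      by (rule frac_cancel) (use u rc r U_one in auto)
    ultimately have 2: "frac (r \<otimes> c) \<one> \<in> G" by simp
    have "frac (u \<otimes> a \<ominus> r \<otimes> c) \<one> \<oplus>\<^bsub>L\<^esub> frac (r \<otimes> c) \<one> = frac (u \<otimes> a) \<one>"
      using L_add[of "u \<otimes> a \<ominus> r \<otimes> c" \<one> "r \<otimes> c" \<one>] u rc U_one by (simp add: a_minus_def a_assoc l_neg)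
    then have 3: "frac (u \<otimes> a) \<one> \<in> G" using L.ideal_add[OF idG 1 2] by simp
    have "frac \<one> (u \<otimes> t) \<otimes>\<^bsub>L\<^esub> frac (u \<otimes> a) \<one> \<in> G"
      by (rule L.ideal_mult[OF idG 3 frac_carrier[OF one_closed U_mult[OF u(2) a(2)]]])
    moreover have "frac \<one> (u \<otimes> t) \<otimes>\<^bsub>L\<^esub> frac (u \<otimes> a) \<one> = frac (u \<otimes> a) (u \<otimes> t)"
      using L_mult[OF one_closed U_mult[OF u(2) a(2)] _ U_one, of "u \<otimes> a"] u a by simp
    ultimately show "x \<in> G" using frac_cancel[OF u(1) a(2) u(2)] a(3) by simp
  qed
  ultimately have "G = ext (adj K r)" by blast
  moreover have "genideal L (set (map (\<lambda>(r, s). frac r s) (ps @ [p]))) = G"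
    unfolding G_def Y_def p by (rule arg_cong[of _ _ "genideal L"]) auto
  moreover have "adjs zero_sat (map fst (ps @ [p])) = adj K r" by (simp add: adjs_append K_def p)
  ultimately show ?case by simp
qed

lemma regular_sequence_frac:
  assumes ps: "set ps \<subseteq> m \<times> U" and reg: "regular_sequence L (map (\<lambda>(r, s). frac r s) ps)"
  shows "regular zero_sat (map fst ps)"
  unfolding regular_iff_nth
proof (intro allI impI)
  fix i assume "i < length (map fst ps)"
  then have i: "i < length ps" by simp
  obtain r s where p: "ps ! i = (r, s)" by fastforce
  have "(r, s) \<in> set ps" using i p nth_mem by metis
  then have r: "r \<in> m" "s \<in> U" using ps by auto
  have rc: "r \<in> carrier R" using r m_carr by auto
  define K where "K = adjs zero_sat (map fst (take i ps))"
  have sub: "set (take i ps) \<subseteq> m \<times> U" by (rule order_trans[OF set_take_subset ps])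
  have sK: "saturated K" unfolding K_def
    by (rule saturated_adjs[OF saturated_zero_sat]) (use sub in force)
  have gen: "genideal L (set (take i (map (\<lambda>(r, s). frac r s) ps))) = ext K"
    unfolding take_map K_def by (rule genideal_frac[OF sub])
  have nz: "b \<in> ext K" if "b \<in> carrier L" "frac r s \<otimes>\<^bsub>L\<^esub> b \<in> ext K" for b
    using reg that i p gen unfolding regular_sequence_def by force
  have "nzd K r"
    unfolding nzd_def
  proof (intro ballI impI)
    fix a assume a: "a \<in> carrier R" "r \<otimes> a \<in> K"
    have "frac r s \<otimes>\<^bsub>L\<^esub> frac a \<one> = frac (r \<otimes> a) s" using L_mult[OF rc r(2) a(1) U_one] r by simp
    moreover have "frac (r \<otimes> a) s \<in> ext K" using a(2) r(2) unfolding ext_def by blast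
    ultimately have "frac a \<one> \<in> ext K" using nz[OF frac_carrier[OF a(1) U_one]] by simp
    then show "a \<in> K" using frac_mem_ext_iff[OF sK a(1) U_one] by simp
  qed
  then show "nzd (adjs zero_sat (take i (map fst ps))) (map fst ps ! i)"
    using i p by (simp add: K_def take_map)
qed

end

lemma (in noetherian_localized_ring) dep_of_prime_chain:
  assumes cm: "local_depth L = krull_dim L"
    and C: "prime_chain R n C" "C n \<subseteq> m"
  shows "dep n zero_sat"
proof (cases n)
  case (Suc k)
  have "enat n \<le> krull_dim L"
    unfolding krull_dim_def using prime_chain_ext[OF C] by (intro Sup_upper) blast
  \<comment> \<open>The supremum need not be attained a priori, so the strict inequality for
    \<open>k\<close> is used: a sequence longer than \<open>k\<close> has length at least
    \<open>n\<close>.\<close>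
  then have "enat k < local_depth L" using cm Suc by (metis enat_ord_simps(2) less_le_trans lessI)
  then obtain ys where ys: "regular_sequence L ys" "set ys \<subseteq> ext m" "k < length ys"
    unfolding local_depth_def the_maximal_L less_Sup_iff by auto
  have "\<forall>y\<in>set ys. \<exists>p. p \<in> m \<times> U \<and> y = (\<lambda>(r, s). frac r s) p"
    using ys(2) unfolding ext_def by fastforce
  then obtain f where f: "\<And>y. y \<in> set ys \<Longrightarrow> f y \<in> m \<times> U \<and> y = (\<lambda>(r, s). frac r s) (f y)" by metis
  have eq: "map (\<lambda>(r, s). frac r s) (map f ys) = ys" using f by (simp add: map_idI)
  have sub: "set (map f ys) \<subseteq> m \<times> U"
    unfolding set_map using f by (intro image_subsetI) blast
  have "regular zero_sat (map fst (map f ys))"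
    by (rule regular_sequence_frac[OF sub]) (simp only: eq ys(1))
  moreover have "set (map fst (map f ys)) \<subseteq> m" using sub by force
  ultimately have "dep (length (map fst (map f ys))) zero_sat" by (rule regular_dep)
  then show ?thesis using dep_antimono[of n "length ys"] ys(3) Suc by simp
qed simp


text \<open>The consequence of the Cohen-Macaulay property on which the main argument rests. It is
  stated outside the locale, with \<open>R\<close> and \<open>M\<close> explicit, since it is
  applied to the ring and to its invariants.\<close>

theorem cohen_macaulay_nzd:
  assumes cm: "cohen_macaulay R" and M: "maximalideal M R"
    and xs: "localized_ring.regular R M (localized_ring.zero_sat R M) xs" "set xs \<subseteq> M"
  shows "\<exists>F. finite F \<and> (\<forall>P\<in>F. primeideal P R \<and> height R P \<le> enat (length xs)) \<and>
    (\<forall>x\<in>carrier R. x \<notin> \<Union>F \<longrightarrow>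
      localized_ring.nzd R (localized_ring.adjs R M (localized_ring.zero_sat R M) xs) x)"
proof -
  have R: "cring R" "noetherian_ring R" using cm by (simp_all add: cohen_macaulay_def)
  interpret noetherian_localized_ring R M
    using R cring.maximalideal_prime[OF R(1) M]
    by (simp add: noetherian_localized_ring_def localized_ring_def localized_ring_axioms_def)
  have "local_depth L = krull_dim L" using cm M by (simp add: cohen_macaulay_def)
  then show ?thesis by (intro nzd_outside_small_primes[OF dep_of_prime_chain] xs)
qed

section \<open>Elementary symmetric functions and independence of characters\<close>

context cring
begin

lemma sum_cong:
  "(\<And>k. k \<in> K \<Longrightarrow> f k = g k) \<Longrightarrow> (\<And>k. k \<in> K \<Longrightarrow> g k \<in> carrier R) \<Longrightarrow>
    (\<Oplus>k\<in>K. f k) = (\<Oplus>k\<in>K. g k)"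
  by (rule finsum_cong') auto

lemma prod_cong:
  "(\<And>k. k \<in> K \<Longrightarrow> f k = g k) \<Longrightarrow> (\<And>k. k \<in> K \<Longrightarrow> g k \<in> carrier R) \<Longrightarrow>
    (\<Otimes>k\<in>K. f k) = (\<Otimes>k\<in>K. g k)"
  by (rule finprod_cong') auto

text \<open>Indexed families are used instead of sets of elements, because the translates of an
  element under a group may coincide.\<close>

definition esym :: "'k set \<Rightarrow> ('k \<Rightarrow> 'a) \<Rightarrow> nat \<Rightarrow> 'a" where
  "esym K y j = (\<Oplus>S\<in>{S. S \<subseteq> K \<and> card S = j}. \<Otimes>k\<in>S. y k)"

text \<open>The subset \<open>S\<close> records the factors from which \<open>y k\<close> is taken.
  A new index splits the power set into the subsets without it and those with it.\<close>

lemma finprod_add_expand_Pow: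
  assumes "finite K" "x \<in> carrier R" "y \<in> K \<rightarrow> carrier R"
  shows "(\<Otimes>k\<in>K. x \<oplus> y k) = (\<Oplus>S\<in>Pow K. x [^] card (K - S) \<otimes> (\<Otimes>k\<in>S. y k))"
  using assms(1,3)
proof (induction K rule: finite_induct)
  case empty
  then show ?case using assms(2) by (simp add: finsum_insert[of "{}" "{}", simplified])
next
  case (insert k K)
  let ?f = "\<lambda>K S. x [^] card (K - S) \<otimes> (\<Otimes>k\<in>S. y k)"
  have yk: "y k \<in> carrier R" and yK: "y \<in> K \<rightarrow> carrier R" using insert.prems by auto
  have pc: "(\<Otimes>k\<in>S. y k) \<in> carrier R" if "S \<in> Pow K" for S
    using that yK by (intro finprod_closed) auto
  have inj: "inj_on (Set.insert k) (Pow K)" using insert.hyps by (auto simp: inj_on_def)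
  have 1: "x \<otimes> (\<Oplus>S\<in>Pow K. ?f K S) = (\<Oplus>S\<in>Pow K. ?f (Set.insert k K) S)"
  proof -
    have "x \<otimes> (\<Oplus>S\<in>Pow K. ?f K S) = (\<Oplus>S\<in>Pow K. x \<otimes> ?f K S)"
      using insert.hyps assms(2) pc by (intro finsum_rdistr) auto
    also have "\<dots> = (\<Oplus>S\<in>Pow K. ?f (Set.insert k K) S)"
    proof (rule sum_cong)
      fix S assume S: "S \<in> Pow K"
      then have "Set.insert k K - S = Set.insert k (K - S)" "k \<notin> K - S" "finite (K - S)"
        using insert.hyps by auto
      then have "card (Set.insert k K - S) = Suc (card (K - S))" by simp
      then show "x \<otimes> ?f K S = ?f (Set.insert k K) S"
        using assms(2) pc[OF S] by (simp add: m_ac)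
    qed (use assms(2) pc in auto)
    finally show ?thesis .
  qed
  have 2: "y k \<otimes> (\<Oplus>S\<in>Pow K. ?f K S) = (\<Oplus>S\<in>Set.insert k ` Pow K. ?f (Set.insert k K) S)"
  proof -
    have "y k \<otimes> (\<Oplus>S\<in>Pow K. ?f K S) = (\<Oplus>S\<in>Pow K. y k \<otimes> ?f K S)"
      using insert.hyps assms(2) pc yk by (intro finsum_rdistr) auto
    also have "\<dots> = (\<Oplus>S\<in>Pow K. ?f (Set.insert k K) (Set.insert k S))"
    proof (rule sum_cong)
      fix S assume S: "S \<in> Pow K"
      have kS: "k \<notin> S" "finite S" using S insert.hyps finite_subset by auto
      have "Set.insert k K - Set.insert k S = K - S" using insert.hyps by auto
      moreover have "(\<Otimes>k\<in>Set.insert k S. y k) = y k \<otimes> (\<Otimes>k\<in>S. y k)"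
        using S yK yk kS by (intro finprod_insert) auto
      ultimately show "y k \<otimes> ?f K S = ?f (Set.insert k K) (Set.insert k S)"
        using assms(2) pc[OF S] yk by (simp add: m_ac)
      show "?f (Set.insert k K) (Set.insert k S) \<in> carrier R"
        using S yK yk assms(2) by (intro m_closed finprod_closed nat_pow_closed) auto
    qed
    also have "\<dots> = (\<Oplus>S\<in>Set.insert k ` Pow K. ?f (Set.insert k K) S)"
      by (rule finsum_reindex[OF _ inj, symmetric]) (use yK yk assms(2) in \<open>auto intro!: m_closed finprod_closed\<close>)
    finally show ?thesis .
  qed
  have "(\<Otimes>k\<in>Set.insert k K. x \<oplus> y k) = (x \<oplus> y k) \<otimes> (\<Oplus>S\<in>Pow K. ?f K S)"
  proof -
    have "(\<Otimes>k\<in>Set.insert k K. x \<oplus> y k) = (x \<oplus> y k) \<otimes> (\<Otimes>k\<in>K. x \<oplus> y k)"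
      using insert.hyps yk yK assms(2) by (intro finprod_insert) auto
    then show ?thesis using insert.IH[OF yK] by simp
  qed
  also have "\<dots> = (\<Oplus>S\<in>Pow K. ?f (Set.insert k K) S) \<oplus> (\<Oplus>S\<in>Set.insert k ` Pow K. ?f (Set.insert k K) S)"
    using assms(2) yk pc by (simp add: l_distr 1 2 Pi_def del: Pow_iff)
  also have "\<dots> = (\<Oplus>S\<in>Pow K \<union> Set.insert k ` Pow K. ?f (Set.insert k K) S)"
    using insert.hyps yK yk assms(2)
    by (intro finsum_Un_disjoint[symmetric]) (auto intro!: m_closed finprod_closed)
  finally show ?case by (simp add: Pow_insert)
qed

lemma finprod_add_expand:
  assumes "finite K" "x \<in> carrier R" "y \<in> K \<rightarrow> carrier R"
  shows "(\<Otimes>k\<in>K. x \<oplus> y k) = (\<Oplus>j\<in>{..card K}. x [^] (card K - j) \<otimes> esym K y j)"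
proof -
  let ?f = "\<lambda>S. x [^] card (K - S) \<otimes> (\<Otimes>k\<in>S. y k)"
  have pc: "(\<Otimes>k\<in>S. y k) \<in> carrier R" if "S \<subseteq> K" for S
    using that assms(3) by (intro finprod_closed) auto
  have un: "Pow K = (\<Union>j\<in>{..card K}. {S. S \<subseteq> K \<and> card S = j})"
    using assms(1) by (auto intro: card_mono)
  have fin: "finite {S. S \<subseteq> K \<and> card S = j}" for j using assms(1) by simp
  have "(\<Otimes>k\<in>K. x \<oplus> y k) = (\<Oplus>S\<in>(\<Union>j\<in>{..card K}. {S. S \<subseteq> K \<and> card S = j}). ?f S)"
    using finprod_add_expand_Pow[OF assms] un by simp
  also have "\<dots> = (\<Oplus>j\<in>{..card K}. \<Oplus>S\<in>{S. S \<subseteq> K \<and> card S = j}. ?f S)"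
    by (rule add.finprod_UN_disjoint) (use fin pc assms(2) in \<open>auto simp: pairwise_def disjnt_def\<close>)
  also have "\<dots> = (\<Oplus>j\<in>{..card K}. x [^] (card K - j) \<otimes> esym K y j)"
  proof (rule sum_cong)
    fix j
    have "(\<Oplus>S\<in>{S. S \<subseteq> K \<and> card S = j}. ?f S)
      = (\<Oplus>S\<in>{S. S \<subseteq> K \<and> card S = j}. x [^] (card K - j) \<otimes> (\<Otimes>k\<in>S. y k))"
      by (rule sum_cong)
        (use pc assms(1,2) in \<open>auto simp: card_Diff_subset finite_subset[of _ K]\<close>)
    also have "\<dots> = x [^] (card K - j) \<otimes> esym K y j"
      unfolding esym_def by (rule finsum_rdistr[symmetric]) (use fin pc assms(2) in auto)
    finally show "(\<Oplus>S\<in>{S. S \<subseteq> K \<and> card S = j}. ?f S) = x [^] (card K - j) \<otimes> esym K y j" .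
    show "x [^] (card K - j) \<otimes> esym K y j \<in> carrier R"
      unfolding esym_def using pc assms(2) by (intro m_closed finsum_closed nat_pow_closed) auto
  qed
  finally show ?thesis .
qed

lemma esym_closed: "y \<in> K \<rightarrow> carrier R \<Longrightarrow> esym K y j \<in> carrier R"
  unfolding esym_def by (intro finsum_closed funcsetI finprod_closed) auto

lemma esym_0: 
  assumes "finite K" shows "esym K y 0 = \<one>"
proof -
  have "{S. S \<subseteq> K \<and> card S = 0} = {{}}" using assms by (auto simp: card_eq_0_iff dest: finite_subset)
  then show ?thesis by (simp add: esym_def finsum_insert[of "{}" "{}", simplified])
qed

lemma esym_mult:
  assumes "finite K" "x \<in> carrier R" "y \<in> K \<rightarrow> carrier R"
  shows "esym K (\<lambda>k. x \<otimes> y k) j = x [^] j \<otimes> esym K y j"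
proof -
  have pc: "(\<Otimes>k\<in>S. y k) \<in> carrier R" if "S \<subseteq> K" for S
    using that assms(3) by (intro finprod_closed) auto
  have "(\<Otimes>k\<in>S. x \<otimes> y k) = x [^] j \<otimes> (\<Otimes>k\<in>S. y k)" if S: "S \<subseteq> K" "card S = j" for S
  proof -
    have "(\<Otimes>k\<in>S. x \<otimes> y k) = (\<Otimes>k\<in>S. x) \<otimes> (\<Otimes>k\<in>S. y k)"
      using S assms by (intro finprod_multf) auto
    then show ?thesis using assms(2) S(2) by (simp add: finprod_const)
  qed
  then have "esym K (\<lambda>k. x \<otimes> y k) j = (\<Oplus>S\<in>{S. S \<subseteq> K \<and> card S = j}. x [^] j \<otimes> (\<Otimes>k\<in>S. y k))"
    unfolding esym_def using pc assms(2) by (intro sum_cong) auto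
  also have "\<dots> = x [^] j \<otimes> esym K y j"
    unfolding esym_def by (rule finsum_rdistr[symmetric]) (use assms pc in auto)
  finally show ?thesis .
qed

text \<open>A permutation of the indices permutes the subsets of each size. With translation by a
  group element as the permutation this becomes invariance.\<close>

lemma esym_reindex:
  assumes "bij_betw \<pi> K K" "y \<in> K \<rightarrow> carrier R"
  shows "esym K (\<lambda>k. y (\<pi> k)) j = esym K y j"
proof -
  let ?A = "{S. S \<subseteq> K \<and> card S = j}"
  have inj: "inj_on \<pi> K" and im: "\<pi> ` K = K" using assms(1) by (auto simp: bij_betw_def)
  have injA: "inj_on ((`) \<pi>) ?A"
    by (rule inj_on_subset[OF inj_on_image_Pow[OF inj]]) auto
  have "?A \<subseteq> (`) \<pi> ` ?A"
  proof
    fix S assume S: "S \<in> ?A"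
    define T where "T = {k \<in> K. \<pi> k \<in> S}"
    have "\<pi> ` T = S" using S im by (auto simp: T_def image_iff)
    moreover have "card T = card S" using \<open>\<pi> ` T = S\<close> card_image[OF inj_on_subset[OF inj, of T]] by (auto simp: T_def)
    ultimately show "S \<in> (`) \<pi> ` ?A" using S by (intro image_eqI[of _ _ T]) (auto simp: T_def)
  qed
  moreover have "(`) \<pi> ` ?A \<subseteq> ?A"
  proof
    fix T assume "T \<in> (`) \<pi> ` ?A"
    then obtain S where S: "S \<subseteq> K" "card S = j" "T = \<pi> ` S" by blast
    then show "T \<in> ?A" using im card_image[OF inj_on_subset[OF inj S(1)]] by auto
  qed
  ultimately have imA: "(`) \<pi> ` ?A = ?A" by blast
  have pc: "(\<Otimes>k\<in>S. y k) \<in> carrier R" if "S \<subseteq> K" for S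
    using that assms(2) by (intro finprod_closed) auto
  have y\<pi>: "y (\<pi> k) \<in> carrier R" if "k \<in> K" for k
    using that assms(2) im by blast
  have "esym K y j = (\<Oplus>S\<in>(`) \<pi> ` ?A. \<Otimes>k\<in>S. y k)" unfolding esym_def imA ..
  also have "\<dots> = (\<Oplus>S\<in>?A. \<Otimes>k\<in>\<pi> ` S. y k)"
    by (rule finsum_reindex[OF _ injA]) (use pc imA in auto)
  also have "\<dots> = esym K (\<lambda>k. y (\<pi> k)) j"
    unfolding esym_def
  proof (rule sum_cong)
    fix S assume S: "S \<in> ?A"
    show "(\<Otimes>k\<in>\<pi> ` S. y k) = (\<Otimes>k\<in>S. y (\<pi> k))"
      by (rule finprod_reindex) (use S y\<pi> inj_on_subset[OF inj] in auto)
    show "(\<Otimes>k\<in>S. y (\<pi> k)) \<in> carrier R" using S y\<pi> by (intro finprod_closed) auto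
  qed
  finally show ?thesis by simp
qed

lemma esym_hom:
  assumes S: "cring S" and h: "h \<in> ring_hom R S" and y: "y \<in> K \<rightarrow> carrier R"
  shows "h (esym K y j) = cring.esym S K (\<lambda>k. h (y k)) j"
proof -
  interpret S: cring S by (rule S)
  interpret h: ring_hom_cring R S h
    using h by unfold_locales
  have pc: "(\<Otimes>k\<in>T. y k) \<in> carrier R" if "T \<subseteq> K" for T
    using that y by (intro finprod_closed) auto
  have "h (esym K y j) = (\<Oplus>\<^bsub>S\<^esub>T\<in>{T. T \<subseteq> K \<and> card T = j}. h (\<Otimes>k\<in>T. y k))"
    unfolding esym_def by (subst h.hom_finsum) (use pc in \<open>auto simp: comp_def\<close>)
  also have "\<dots> = S.esym K (\<lambda>k. h (y k)) j"
    unfolding S.esym_def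
  proof (rule S.sum_cong)
    fix T assume T: "T \<in> {T. T \<subseteq> K \<and> card T = j}"
    then have "y \<in> T \<rightarrow> carrier R" using y by auto
    then show "h (\<Otimes>k\<in>T. y k) = (\<Otimes>\<^bsub>S\<^esub>k\<in>T. h (y k))"
      by (subst h.hom_finprod) (auto simp: comp_def)
    show "(\<Otimes>\<^bsub>S\<^esub>k\<in>T. h (y k)) \<in> carrier S" using T y h.hom_closed by (intro S.finprod_closed) auto
  qed
  finally show ?thesis .
qed

text \<open>Dedekind's argument for the induced maps into the domain R/Q. Subtracting
  \<open>f l d\<close> times the relation at b from the relation at d b removes the index
  \<open>l\<close> and multiplies \<open>c k\<close> by \<open>f k d \<ominus> f l d\<close>. For
  each \<open>k\<close> a suitable d makes this factor lie outside \<open>Q\<close>; evaluation at 1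
  finally settles \<open>c l\<close>.\<close>

lemma independence_of_characters_mod_prime:
  assumes Q: "primeideal Q R" and K: "finite K"
    and f: "\<And>k. k \<in> K \<Longrightarrow> f k \<in> ring_hom R R"
    and dist: "\<And>k l. k \<in> K \<Longrightarrow> l \<in> K \<Longrightarrow> k \<noteq> l \<Longrightarrow> \<exists>b\<in>carrier R. f k b \<ominus> f l b \<notin> Q"
    and c: "c \<in> K \<rightarrow> carrier R"
    and zero: "\<And>b. b \<in> carrier R \<Longrightarrow> (\<Oplus>k\<in>K. c k \<otimes> f k b) \<in> Q"
  shows "\<forall>k\<in>K. c k \<in> Q"
  using K f dist c zero
proof (induction K arbitrary: c rule: finite_induct)
  case (insert l K)
  have id: "ideal Q R" using Q by (rule primeideal.axioms(1))
  have fc: "f k b \<in> carrier R" if "k \<in> Set.insert l K" "b \<in> carrier R" for k b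
    using insert.prems(1)[OF that(1)] that(2) by (rule ring_hom_closed)
  have cc: "c k \<in> carrier R" if "k \<in> Set.insert l K" for k using insert.prems(3) that by auto
  have cK: "c k \<in> Q" if k: "k \<in> K" for k
  proof -
    obtain d where d: "d \<in> carrier R" "f k d \<ominus> f l d \<notin> Q"
      using insert.prems(2)[of k l] insert.hyps k by blast
    have "\<forall>k\<in>K. c k \<otimes> (f k d \<ominus> f l d) \<in> Q"
    proof (rule insert.IH)
      show "(\<lambda>k. c k \<otimes> (f k d \<ominus> f l d)) \<in> K \<rightarrow> carrier R" using cc fc d by auto
      fix b assume b: "b \<in> carrier R"
      have exp: "(\<Oplus>k\<in>Set.insert l K. c k \<otimes> f k b) = c l \<otimes> f l b \<oplus> (\<Oplus>k\<in>K. c k \<otimes> f k b)"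
        if "b \<in> carrier R" for b
        using insert.hyps cc fc that by (intro finsum_insert) auto
      have 1: "(\<Oplus>k\<in>Set.insert l K. c k \<otimes> f k (d \<otimes> b)) \<in> Q" using insert.prems(4) d b by simp
      have "f l d \<otimes> (\<Oplus>k\<in>Set.insert l K. c k \<otimes> f k b) \<in> Q"
        using ideal_mult[OF id insert.prems(4)[OF b]] fc d by simp
      then have 2: "(\<Oplus>k\<in>Set.insert l K. c k \<otimes> f k (d \<otimes> b)) \<ominus>
          f l d \<otimes> (\<Oplus>k\<in>Set.insert l K. c k \<otimes> f k b) \<in> Q" using ideal_diff[OF id 1] by simp
      have fm: "f k (d \<otimes> b) = f k d \<otimes> f k b" if "k \<in> Set.insert l K" for k
        by (rule ring_hom_mult[OF insert.prems(1)[OF that] d(1) b])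
      have S1: "(\<Oplus>k\<in>K. c k \<otimes> f k (d \<otimes> b)) \<in> carrier R" and S2: "(\<Oplus>k\<in>K. c k \<otimes> f k b) \<in> carrier R"
        using cc fc d b by (auto intro!: finsum_closed)
      have "(\<Oplus>k\<in>Set.insert l K. c k \<otimes> f k (d \<otimes> b)) \<ominus> f l d \<otimes> (\<Oplus>k\<in>Set.insert l K. c k \<otimes> f k b)
        = (\<Oplus>k\<in>K. c k \<otimes> f k (d \<otimes> b)) \<ominus> f l d \<otimes> (\<Oplus>k\<in>K. c k \<otimes> f k b)"
      proof -
        have "c l \<otimes> f l (d \<otimes> b) = f l d \<otimes> (c l \<otimes> f l b)"
          using fm[of l] cc[of l] fc[of l] d b by (simp add: m_ac)
        moreover have "f l d \<otimes> (c l \<otimes> f l b) \<in> carrier R" "f l d \<in> carrier R" "c l \<otimes> f l b \<in> carrier R"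
          using cc fc d b by auto
        ultimately show ?thesis
          using exp[OF b] exp[OF m_closed[OF d(1) b]] S1 S2
          by (simp add: a_minus_def r_distr minus_add a_ac r_neg1 r_neg2)
      qed
      also have "\<dots> = (\<Oplus>k\<in>K. c k \<otimes> f k (d \<otimes> b)) \<oplus> (\<Oplus>k\<in>K. \<ominus> f l d \<otimes> (c k \<otimes> f k b))"
      proof -
        have "(\<ominus> f l d) \<otimes> (\<Oplus>k\<in>K. c k \<otimes> f k b) = (\<Oplus>k\<in>K. \<ominus> f l d \<otimes> (c k \<otimes> f k b))"
          using insert.hyps cc fc d b by (intro finsum_rdistr) auto
        then show ?thesis using fc[of l] d S2 by (simp add: a_minus_def l_minus)
      qed
      also have "\<dots> = (\<Oplus>k\<in>K. c k \<otimes> f k (d \<otimes> b) \<oplus> \<ominus> f l d \<otimes> (c k \<otimes> f k b))"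
        using cc fc d b by (intro finsum_addf[symmetric]) auto
      also have "\<dots> = (\<Oplus>k\<in>K. c k \<otimes> (f k d \<ominus> f l d) \<otimes> f k b)"
      proof (rule sum_cong)
        fix k assume k: "k \<in> K"
        show "c k \<otimes> f k (d \<otimes> b) \<oplus> \<ominus> f l d \<otimes> (c k \<otimes> f k b) = c k \<otimes> (f k d \<ominus> f l d) \<otimes> f k b"
          using k fm[of k] cc[of k] fc[of k] fc[of l] d b
          by (simp add: a_minus_def l_distr r_distr l_minus r_minus m_ac)
      qed (use cc fc d b in auto)
      finally show "(\<Oplus>k\<in>K. c k \<otimes> (f k d \<ominus> f l d) \<otimes> f k b) \<in> Q" using 2 by simp
    qed (use insert.prems in auto)
    then have "c k \<otimes> (f k d \<ominus> f l d) \<in> Q" using k by blast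
    then show ?thesis
      using primeideal.I_prime[OF Q, of "c k" "f k d \<ominus> f l d"] cc fc d k by auto
  qed
  have "(\<Oplus>k\<in>Set.insert l K. c k \<otimes> f k \<one>) = c l \<otimes> f l \<one> \<oplus> (\<Oplus>k\<in>K. c k \<otimes> f k \<one>)"
    using insert.hyps cc fc by (intro finsum_insert) auto
  moreover have "f k \<one> = \<one>" if "k \<in> Set.insert l K" for k
    using insert.prems(1)[OF that] by (rule ring_hom_one)
  moreover have "(\<Oplus>k\<in>K. c k \<otimes> f k \<one>) \<in> Q"
    using cK fc by (intro ideal_finsum[OF id] ideal_mult_right[OF id]) auto
  ultimately have "c l \<oplus> (\<Oplus>k\<in>K. c k \<otimes> f k \<one>) \<in> Q" "(\<Oplus>k\<in>K. c k \<otimes> f k \<one>) \<in> Q"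
    using insert.prems(4)[OF one_closed] cc by simp_all
  then have "(c l \<oplus> (\<Oplus>k\<in>K. c k \<otimes> f k \<one>)) \<ominus> (\<Oplus>k\<in>K. c k \<otimes> f k \<one>) \<in> Q"
    by (rule ideal_diff[OF id])
  moreover have "(\<Oplus>k\<in>K. c k \<otimes> f k \<one>) \<in> carrier R" using cc fc by (auto intro!: finsum_closed)
  ultimately have "c l \<in> Q" using cc[of l] by (simp add: a_minus_def a_assoc r_neg)
  then show ?case using cK by blast
qed simp

end

section \<open>Finite group actions on rings\<close>

context cring
begin

lemma esym_cong:
  assumes "\<And>k. k \<in> K \<Longrightarrow> f k = g k" "g \<in> K \<rightarrow> carrier R" shows "esym K f j = esym K g j"
  unfolding esym_def
proof (rule sum_cong)
  fix S assume S: "S \<in> {S. S \<subseteq> K \<and> card S = j}"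
  show "(\<Otimes>k\<in>S. f k) = (\<Otimes>k\<in>S. g k)" by (rule prod_cong) (use assms S in auto)
  show "(\<Otimes>k\<in>S. g k) \<in> carrier R" by (rule finprod_closed) (use assms S in auto)
qed

end

text \<open>The action is an abstract map \<open>\<rho>\<close>, so that the same results serve a
  group of automorphisms, a subgroup, the quotient group on a ring of invariants, and the induced
  action on polynomials.\<close>

locale ring_action = cring R for R (structure) +
  fixes H :: "('g, 'h) monoid_scheme" and \<rho> :: "'g \<Rightarrow> 'a \<Rightarrow> 'a"
  assumes group_H: "group H" and finite_H: "finite (carrier H)"
    and act_hom: "g \<in> carrier H \<Longrightarrow> \<rho> g \<in> ring_hom R R"
    and act_comp: "g \<in> carrier H \<Longrightarrow> h \<in> carrier H \<Longrightarrow> a \<in> carrier R \<Longrightarrow> \<rho> (g \<otimes>\<^bsub>H\<^esub> h) a = \<rho> g (\<rho> h a)"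
    and act_id: "a \<in> carrier R \<Longrightarrow> \<rho> \<one>\<^bsub>H\<^esub> a = a"
begin

sublocale H: group H by (rule group_H)

lemma act_cring: "g \<in> carrier H \<Longrightarrow> ring_hom_cring R R (\<rho> g)"
  using act_hom by unfold_locales

lemma act_closed [simp]: "g \<in> carrier H \<Longrightarrow> a \<in> carrier R \<Longrightarrow> \<rho> g a \<in> carrier R"
  by (rule ring_hom_closed[OF act_hom])

lemma act_mult: "g \<in> carrier H \<Longrightarrow> a \<in> carrier R \<Longrightarrow> b \<in> carrier R \<Longrightarrow> \<rho> g (a \<otimes> b) = \<rho> g a \<otimes> \<rho> g b"
  by (rule ring_hom_mult[OF act_hom])

lemma act_add: "g \<in> carrier H \<Longrightarrow> a \<in> carrier R \<Longrightarrow> b \<in> carrier R \<Longrightarrow> \<rho> g (a \<oplus> b) = \<rho> g a \<oplus> \<rho> g b"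
  by (rule ring_hom_add[OF act_hom])

lemma act_one: "g \<in> carrier H \<Longrightarrow> \<rho> g \<one> = \<one>"
  by (rule ring_hom_one[OF act_hom])

lemma act_zero: "g \<in> carrier H \<Longrightarrow> \<rho> g \<zero> = \<zero>"
  using ring_hom_cring.hom_zero[OF act_cring] .

lemma act_uminus: "g \<in> carrier H \<Longrightarrow> a \<in> carrier R \<Longrightarrow> \<rho> g (\<ominus> a) = \<ominus> \<rho> g a"
  using ring_hom_cring.hom_a_inv[OF act_cring] .

lemma act_diff: "g \<in> carrier H \<Longrightarrow> a \<in> carrier R \<Longrightarrow> b \<in> carrier R \<Longrightarrow> \<rho> g (a \<ominus> b) = \<rho> g a \<ominus> \<rho> g b"
  by (simp add: a_minus_def act_add act_uminus)

lemma act_finsum: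
  "g \<in> carrier H \<Longrightarrow> f \<in> K \<rightarrow> carrier R \<Longrightarrow> \<rho> g (\<Oplus>k\<in>K. f k) = (\<Oplus>k\<in>K. \<rho> g (f k))"
  using ring_hom_cring.hom_finsum[OF act_cring] by (simp add: comp_def)

lemma act_finprod:
  "g \<in> carrier H \<Longrightarrow> f \<in> K \<rightarrow> carrier R \<Longrightarrow> \<rho> g (\<Otimes>k\<in>K. f k) = (\<Otimes>k\<in>K. \<rho> g (f k))"
  using ring_hom_cring.hom_finprod[OF act_cring] by (simp add: comp_def)

lemma act_inv_left: "g \<in> carrier H \<Longrightarrow> a \<in> carrier R \<Longrightarrow> \<rho> (inv\<^bsub>H\<^esub> g) (\<rho> g a) = a"
  using act_comp[of "inv\<^bsub>H\<^esub> g" g a] act_id by simp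

lemma act_inv_right: "g \<in> carrier H \<Longrightarrow> a \<in> carrier R \<Longrightarrow> \<rho> g (\<rho> (inv\<^bsub>H\<^esub> g) a) = a"
  using act_comp[of g "inv\<^bsub>H\<^esub> g" a] act_id by simp

lemma act_pow: "g \<in> carrier H \<Longrightarrow> a \<in> carrier R \<Longrightarrow> \<rho> g (a [^] (n::nat)) = \<rho> g a [^] n"
  by (induction n) (simp_all add: act_one act_mult)

definition fixset :: "'g set \<Rightarrow> 'a set" where
  "fixset K = {a \<in> carrier R. \<forall>g\<in>K. \<rho> g a = a}"

definition fixring :: "'g set \<Rightarrow> ('a, 'b) ring_scheme" where
  "fixring K = R\<lparr>carrier := fixset K\<rparr>"

lemma fixset_carr: "a \<in> fixset K \<Longrightarrow> a \<in> carrier R" by (simp add: fixset_def)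

lemma fixsetD: "a \<in> fixset K \<Longrightarrow> g \<in> K \<Longrightarrow> \<rho> g a = a" by (simp add: fixset_def)

lemma fixsetI: "a \<in> carrier R \<Longrightarrow> (\<And>g. g \<in> K \<Longrightarrow> \<rho> g a = a) \<Longrightarrow> a \<in> fixset K" by (simp add: fixset_def)

lemma fixset_antimono: "K \<subseteq> K' \<Longrightarrow> fixset K' \<subseteq> fixset K" by (auto simp: fixset_def)

lemma
  assumes "K \<subseteq> carrier H"
  shows fixset_one: "\<one> \<in> fixset K" and fixset_zero: "\<zero> \<in> fixset K"
    and fixset_add: "a \<in> fixset K \<Longrightarrow> b \<in> fixset K \<Longrightarrow> a \<oplus> b \<in> fixset K"
    and fixset_mult: "a \<in> fixset K \<Longrightarrow> b \<in> fixset K \<Longrightarrow> a \<otimes> b \<in> fixset K"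
    and fixset_uminus: "a \<in> fixset K \<Longrightarrow> \<ominus> a \<in> fixset K"
    and fixset_diff: "a \<in> fixset K \<Longrightarrow> b \<in> fixset K \<Longrightarrow> a \<ominus> b \<in> fixset K"
    and fixset_pow: "a \<in> fixset K \<Longrightarrow> a [^] (n::nat) \<in> fixset K"
proof -
  have "g \<in> carrier H" if "g \<in> K" for g using that assms by blast
  then show "\<one> \<in> fixset K" "\<zero> \<in> fixset K"
    "a \<in> fixset K \<Longrightarrow> b \<in> fixset K \<Longrightarrow> a \<oplus> b \<in> fixset K"
    "a \<in> fixset K \<Longrightarrow> b \<in> fixset K \<Longrightarrow> a \<otimes> b \<in> fixset K"
    "a \<in> fixset K \<Longrightarrow> \<ominus> a \<in> fixset K"
    "a \<in> fixset K \<Longrightarrow> b \<in> fixset K \<Longrightarrow> a \<ominus> b \<in> fixset K"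
    "a \<in> fixset K \<Longrightarrow> a [^] n \<in> fixset K"
    by (auto simp: fixset_def act_one act_zero act_add act_mult act_uminus act_diff act_pow)
qed

lemma fixset_finsum:
  assumes "K \<subseteq> carrier H" "\<And>j. j \<in> J \<Longrightarrow> f j \<in> fixset K"
  shows "(\<Oplus>j\<in>J. f j) \<in> fixset K"
  using assms(2)
proof (induction J rule: infinite_finite_induct)
  case (insert x F)
  have "(\<Oplus>j\<in>Set.insert x F. f j) = f x \<oplus> (\<Oplus>j\<in>F. f j)"
    using insert fixset_carr by (intro finsum_insert) auto
  then show ?case using insert fixset_add[OF assms(1)] by simp
qed (use fixset_zero[OF assms(1)] in auto)

lemma cring_fixring:
  assumes "K \<subseteq> carrier H" shows "cring (fixring K)"
proof -
  have "subcring (fixset K) R"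
  proof (rule subcringI)
    show "subring (fixset K) R"
      by (rule subringI)
        (use assms fixset_one fixset_uminus fixset_mult fixset_add in \<open>auto simp: fixset_def\<close>)
  qed (auto simp: fixset_def m_comm)
  then show ?thesis
    unfolding fixring_def using subcring_iff[of "fixset K"] fixset_carr by (simp add: subset_iff)
qed

lemma fixring_simps [simp]:
  "carrier (fixring K) = fixset K" "monoid.mult (fixring K) = monoid.mult R"
  "one (fixring K) = \<one>" "ring.zero (fixring K) = \<zero>" "add (fixring K) = add R"
  by (simp_all add: fixring_def)

lemma fixring_diff:
  assumes K: "K \<subseteq> carrier H" and ab: "a \<in> fixset K" "b \<in> fixset K"
  shows "a \<ominus>\<^bsub>fixring K\<^esub> b = a \<ominus> b"
proof -
  interpret F: cring "fixring K" by (rule cring_fixring[OF K])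
  have "\<ominus>\<^bsub>fixring K\<^esub> b = \<ominus> b"
    by (rule F.minus_equality) (use ab fixset_uminus[OF K] fixset_carr l_neg in auto)
  then show ?thesis by (simp add: a_minus_def)
qed

lemma ideal_contract:
  assumes K: "K \<subseteq> carrier H" and P: "ideal P R"
  shows "ideal (P \<inter> fixset K) (fixring K)"
proof -
  interpret F: cring "fixring K" by (rule cring_fixring[OF K])
  show ?thesis
    by (rule F.ideal_intro)
      (use K fixset_zero[OF K] ideal_zero[OF P] ideal_add[OF P] ideal_mult[OF P] fixset_add[OF K]
        fixset_mult[OF K] fixset_carr in auto)
qed

lemma prime_contract:
  assumes K: "K \<subseteq> carrier H" and P: "primeideal P R"
  shows "primeideal (P \<inter> fixset K) (fixring K)"
proof (rule primeidealI[OF ideal_contract[OF K primeideal.axioms(1)[OF P]] cring_fixring[OF K]])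
  show "carrier (fixring K) \<noteq> P \<inter> fixset K"
    using prime_one_notin[OF P] fixset_one[OF K] by auto
  fix a b assume "a \<in> carrier (fixring K)" "b \<in> carrier (fixring K)" "a \<otimes>\<^bsub>fixring K\<^esub> b \<in> P \<inter> fixset K"
  then show "a \<in> P \<inter> fixset K \<or> b \<in> P \<inter> fixset K"
    using primeideal.I_prime[OF P, of a b] fixset_carr by auto
qed

lemma bij_left_mult:
  assumes "subgroup K H" "g \<in> K" shows "bij_betw (\<lambda>k. g \<otimes>\<^bsub>H\<^esub> k) K K"
proof (rule bij_betwI[where g = "\<lambda>k. inv\<^bsub>H\<^esub> g \<otimes>\<^bsub>H\<^esub> k"])
  have sub: "k \<in> carrier H" if "k \<in> K" for k using assms(1) that subgroup.mem_carrier by metis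
  show "(\<lambda>k. g \<otimes>\<^bsub>H\<^esub> k) \<in> K \<rightarrow> K" using assms by (auto intro: subgroup.m_closed)
  show "(\<lambda>k. inv\<^bsub>H\<^esub> g \<otimes>\<^bsub>H\<^esub> k) \<in> K \<rightarrow> K"
    using assms by (auto intro: subgroup.m_closed subgroup.m_inv_closed)
  fix k assume "k \<in> K"
  then show "inv\<^bsub>H\<^esub> g \<otimes>\<^bsub>H\<^esub> (g \<otimes>\<^bsub>H\<^esub> k) = k" "g \<otimes>\<^bsub>H\<^esub> (inv\<^bsub>H\<^esub> g \<otimes>\<^bsub>H\<^esub> k) = k"
    using sub assms(2) by (simp_all add: H.m_assoc[symmetric])
qed

lemma subgroup_subset: "subgroup K H \<Longrightarrow> K \<subseteq> carrier H"
  by (rule subgroup.subset)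

lemma finite_subgroup: "subgroup K H \<Longrightarrow> finite K"
  using subgroup_subset finite_H finite_subset by blast

text \<open>What matters is that left multiplication by \<open>K\<close> permutes \<open>T\<close>.
  Besides subgroups, the complement of a subgroup is used for \<open>T\<close> later.\<close>

lemma norm_fixed_on:
  assumes T: "T \<subseteq> carrier H" and K: "K \<subseteq> carrier H"
    and bij: "\<And>g. g \<in> K \<Longrightarrow> bij_betw (\<lambda>k. g \<otimes>\<^bsub>H\<^esub> k) T T" and a: "a \<in> carrier R"
  shows "(\<Otimes>k\<in>T. \<rho> k a) \<in> fixset K"
proof (rule fixsetI)
  have c: "k \<in> carrier H" if "k \<in> T" for k using T that by blast
  show "(\<Otimes>k\<in>T. \<rho> k a) \<in> carrier R" using c a by (intro finprod_closed) auto
  fix g assume g: "g \<in> K"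
  then have gc: "g \<in> carrier H" using K by blast
  have "\<rho> g (\<Otimes>k\<in>T. \<rho> k a) = (\<Otimes>k\<in>T. \<rho> g (\<rho> k a))"
    using c gc a by (intro act_finprod) auto
  also have "\<dots> = (\<Otimes>k\<in>T. \<rho> (g \<otimes>\<^bsub>H\<^esub> k) a)"
    by (rule prod_cong) (use c gc a act_comp in auto)
  also have "\<dots> = (\<Otimes>k\<in>(\<lambda>k. g \<otimes>\<^bsub>H\<^esub> k) ` T. \<rho> k a)"
    by (rule finprod_reindex[symmetric]) (use bij[OF g] c gc a in \<open>auto simp: bij_betw_def\<close>)
  also have "(\<lambda>k. g \<otimes>\<^bsub>H\<^esub> k) ` T = T" using bij[OF g] by (simp add: bij_betw_def)
  finally show "\<rho> g (\<Otimes>k\<in>T. \<rho> k a) = (\<Otimes>k\<in>T. \<rho> k a)" .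
qed

lemma norm_fixed:
  assumes "subgroup K H" "a \<in> carrier R"
  shows "(\<Otimes>k\<in>K. \<rho> k a) \<in> fixset K"
  using assms subgroup_subset bij_left_mult by (intro norm_fixed_on) auto

lemma esym_fixed:
  assumes K: "subgroup K H" and a: "a \<in> carrier R"
  shows "esym K (\<lambda>k. \<rho> k a) j \<in> fixset K"
proof (rule fixsetI)
  have c: "k \<in> carrier H" if "k \<in> K" for k using subgroup_subset[OF K] that by blast
  have y: "(\<lambda>k. \<rho> k a) \<in> K \<rightarrow> carrier R" using c a by auto
  show "esym K (\<lambda>k. \<rho> k a) j \<in> carrier R" by (rule esym_closed[OF y])
  fix g assume g: "g \<in> K"
  have "\<rho> g (esym K (\<lambda>k. \<rho> k a) j) = esym K (\<lambda>k. \<rho> g (\<rho> k a)) j"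
    by (rule esym_hom[OF cring_axioms act_hom[OF c[OF g]] y])
  also have "\<dots> = esym K (\<lambda>k. \<rho> (g \<otimes>\<^bsub>H\<^esub> k) a) j"
    by (rule esym_cong) (use c g a act_comp in auto)
  also have "\<dots> = esym K (\<lambda>k. \<rho> k a) j"
    by (rule esym_reindex[OF bij_left_mult[OF K g] y])
  finally show "\<rho> g (esym K (\<lambda>k. \<rho> k a) j) = esym K (\<lambda>k. \<rho> k a) j" .
qed

section \<open>Conjugate primes and primes of the ring of invariants\<close>

definition pull :: "'g \<Rightarrow> 'a set \<Rightarrow> 'a set" where
  "pull g P = {a \<in> carrier R. \<rho> g a \<in> P}"

lemma prime_pull:
  assumes g: "g \<in> carrier H" and P: "primeideal P R" shows "primeideal (pull g P) R"
proof -
  have id: "ideal P R" using P by (rule primeideal.axioms(1))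
  have "ideal (pull g P) R"
    by (rule ideal_intro)
      (use g ideal_zero[OF id] ideal_add[OF id] ideal_mult[OF id] in
        \<open>auto simp: pull_def act_zero act_add act_mult\<close>)
  then show ?thesis
  proof (rule primeidealI[OF _ cring_axioms])
    have "\<one> \<notin> pull g P" using prime_one_notin[OF P] g by (simp add: pull_def act_one)
    then show "carrier R \<noteq> pull g P" by auto
    fix a b assume "a \<in> carrier R" "b \<in> carrier R" "a \<otimes> b \<in> pull g P"
    then show "a \<in> pull g P \<or> b \<in> pull g P"
      using primeideal.I_prime[OF P, of "\<rho> g a" "\<rho> g b"] g by (auto simp: pull_def act_mult)
  qed
qed

lemma pull_inv:
  assumes "g \<in> carrier H" "P \<subseteq> carrier R"
  shows "pull (inv\<^bsub>H\<^esub> g) (pull g P) = P" "pull g (pull (inv\<^bsub>H\<^esub> g) P) = P"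
  using assms act_inv_left act_inv_right by (auto simp: pull_def)

lemma height_pull:
  assumes g: "g \<in> carrier H" and P: "P \<subseteq> carrier R"
  shows "height R (pull g P) \<le> height R P"
  unfolding height_def[of R "pull g P"]
proof (rule Sup_least)
  fix e assume "e \<in> {enat n |n. \<exists>C. prime_chain R n C \<and> C n = pull g P}"
  then obtain n C where C: "e = enat n" "prime_chain R n C" "C n = pull g P" by blast
  let ?C = "\<lambda>i. pull (inv\<^bsub>H\<^esub> g) (C i)"
  have g': "inv\<^bsub>H\<^esub> g \<in> carrier H" using g by simp
  have "pull (inv\<^bsub>H\<^esub> g) (C i) \<subset> pull (inv\<^bsub>H\<^esub> g) (C (Suc i))" if i: "i < n" for i
  proof -
    have s: "C i \<subset> C (Suc i)" "primeideal (C i) R" "primeideal (C (Suc i)) R"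
      using C(2) i by (auto simp: prime_chain_def)
    have c: "C i \<subseteq> carrier R" "C (Suc i) \<subseteq> carrier R"
      using s ideal_carr primeideal.axioms(1) by blast+
    have "pull (inv\<^bsub>H\<^esub> g) (C i) \<noteq> pull (inv\<^bsub>H\<^esub> g) (C (Suc i))"
      using s(1) pull_inv(2)[OF g c(1)] pull_inv(2)[OF g c(2)] by (metis less_irrefl)
    moreover have "pull (inv\<^bsub>H\<^esub> g) (C i) \<subseteq> pull (inv\<^bsub>H\<^esub> g) (C (Suc i))"
      using s(1) by (auto simp: pull_def)
    ultimately show ?thesis by blast
  qed
  then have "prime_chain R n ?C"
    using C(2) prime_pull[OF g'] by (simp add: prime_chain_def)
  moreover have "?C n = P" using C(3) pull_inv(1)[OF g P] by simp
  ultimately show "e \<le> height R P"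
    unfolding height_def C(1) by (intro Sup_upper) blast
qed

text \<open>The norm of an element a of \<open>Q\<close> is an invariant element of
  \<open>Q\<close>, hence lies in \<open>P\<close>, so some translate of a lies in \<open>P\<close>.
  Thus \<open>Q\<close> is covered by the finitely many conjugates of \<open>P\<close>.\<close>

lemma prime_over_conjugate:
  assumes P: "primeideal P R" and Q: "ideal Q R" and sub: "Q \<inter> fixset (carrier H) \<subseteq> P"
  shows "\<exists>g\<in>carrier H. Q \<subseteq> pull g P"
proof -
  have "Q \<subseteq> \<Union>((\<lambda>g. pull g P) ` carrier H)"
  proof
    fix a assume a: "a \<in> Q"
    then have ac: "a \<in> carrier R" using ideal_carr[OF Q] by blast
    have f: "(\<lambda>g. \<rho> g a) \<in> carrier H \<rightarrow> carrier R" using ac by auto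
    have "(\<Otimes>g\<in>carrier H. \<rho> g a) \<in> Q"
      by (rule ideal_finprod[OF Q finite_H f H.one_closed]) (simp add: act_id ac a)
    moreover have "(\<Otimes>g\<in>carrier H. \<rho> g a) \<in> fixset (carrier H)"
      by (rule norm_fixed[OF H.subgroup_self ac])
    ultimately have "(\<Otimes>g\<in>carrier H. \<rho> g a) \<in> P" using sub by blast
    then obtain g where "g \<in> carrier H" "\<rho> g a \<in> P"
      using prime_finprod[OF P finite_H f] by blast
    then show "a \<in> \<Union>((\<lambda>g. pull g P) ` carrier H)" using ac by (auto simp: pull_def)
  qed
  then have "\<exists>P'\<in>(\<lambda>g. pull g P) ` carrier H. Q \<subseteq> P'"
    using finite_H prime_pull P by (intro prime_avoidance[OF Q]) auto
  then show ?thesis by blast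
qed

text \<open>Some \<open>g\<close> maps \<open>Q\<close> into \<open>P\<close>, and \<open>P\<close>
  is contained in \<open>Q\<close>, so every positive power of \<open>g\<close> maps
  \<open>Q\<close> into \<open>P\<close>. The power whose exponent is the group order is the
  identity.\<close>

lemma incomparable:
  assumes P: "primeideal P R" and Q: "primeideal Q R" and PQ: "P \<subseteq> Q"
    and eq: "P \<inter> fixset (carrier H) = Q \<inter> fixset (carrier H)"
  shows "P = Q"
proof
  have idQ: "ideal Q R" using Q by (rule primeideal.axioms(1))
  have "Q \<inter> fixset (carrier H) \<subseteq> P" using eq by blast
  then obtain g where g: "g \<in> carrier H" "Q \<subseteq> pull g P"
    using prime_over_conjugate[OF P idQ] by blast
  have iter: "\<rho> (g [^]\<^bsub>H\<^esub> Suc n) a \<in> P" if a: "a \<in> Q" for a n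
  proof (induction n)
    case 0
    then show ?case using a g by (auto simp: pull_def)
  next
    case (Suc n)
    have ac: "a \<in> carrier R" using ideal_carr[OF idQ a] .
    have "g [^]\<^bsub>H\<^esub> Suc (Suc n) = g \<otimes>\<^bsub>H\<^esub> g [^]\<^bsub>H\<^esub> Suc n" using g(1) by (rule H.nat_pow_Suc2)
    then have "\<rho> (g [^]\<^bsub>H\<^esub> Suc (Suc n)) a = \<rho> g (\<rho> (g [^]\<^bsub>H\<^esub> Suc n) a)"
      using act_comp[OF g(1) H.nat_pow_closed[OF g(1)] ac] by metis
    then show ?case using Suc PQ g(2) by (auto simp: pull_def)
  qed
  show "Q \<subseteq> P"
  proof
    fix a assume a: "a \<in> Q"
    have "order H > 0" using finite_H H.order_gt_0_iff_finite by blast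
    then obtain n where n: "order H = Suc n" using gr0_implies_Suc by blast
    have "g [^]\<^bsub>H\<^esub> Suc n = \<one>\<^bsub>H\<^esub>" using H.pow_order_eq_1[OF g(1)] n by simp
    then show "a \<in> P" using iter[OF a, of n] act_id ideal_carr[OF idQ a] by simp
  qed
qed (rule PQ)

text \<open>By \<open>incomparable\<close> the inclusions of a prime chain stay strict under
  contraction.\<close>

lemma height_contract:
  assumes "primeideal Q R"
  shows "height R Q \<le> height (fixring (carrier H)) (Q \<inter> fixset (carrier H))"
  unfolding height_def[of R]
proof (rule Sup_least)
  fix e assume "e \<in> {enat n |n. \<exists>C. prime_chain R n C \<and> C n = Q}"
  then obtain n C where C: "e = enat n" "prime_chain R n C" "C n = Q" by blast
  let ?C = "\<lambda>i. C i \<inter> fixset (carrier H)"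
  have "C i \<inter> fixset (carrier H) \<subset> C (Suc i) \<inter> fixset (carrier H)" if i: "i < n" for i
  proof -
    have s: "C i \<subset> C (Suc i)" "primeideal (C i) R" "primeideal (C (Suc i)) R"
      using C(2) i by (auto simp: prime_chain_def)
    have "C i \<inter> fixset (carrier H) \<noteq> C (Suc i) \<inter> fixset (carrier H)"
      using incomparable[OF s(2,3)] s(1) by blast
    then show ?thesis using s(1) by blast
  qed
  then have "prime_chain (fixring (carrier H)) n ?C"
    using C(2) prime_contract[OF subset_refl] by (simp add: prime_chain_def)
  then show "e \<le> height (fixring (carrier H)) (Q \<inter> fixset (carrier H))"
    unfolding height_def C(1) C(3)[symmetric] by (intro Sup_upper) blast
qed

text \<open>For \<open>x\<close> in the prime \<open>p\<close> below, a relation \<open>c = u + x b\<close> with \<open>u \<in> Q\<close> and \<open>c \<notin> p\<close>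
  is impossible: the norm of \<open>u = c - x b\<close> is congruent to a power of \<open>c\<close> modulo \<open>p\<close>.\<close>

lemma lying_over:
  assumes p: "primeideal p (fixring (carrier H))"
  obtains Q where "primeideal Q R" "Q \<inter> fixset (carrier H) = p"
proof -
  let ?C = "fixset (carrier H)"
  interpret F: cring "fixring (carrier H)" by (rule cring_fixring) simp
  have idp: "ideal p (fixring (carrier H))" using p by (rule primeideal.axioms(1))
  have pC: "p \<subseteq> ?C" using F.ideal_carr[OF idp] by auto
  have one: "\<one> \<in> ?C - p" using fixset_one[OF subset_refl] F.prime_one_notin[OF p] by simp
  have "{\<zero>} \<inter> (?C - p) = {}" using F.ideal_zero[OF idp] by simp
  then obtain Q where Q: "ideal Q R" "Q \<inter> (?C - p) = {}"
    and max: "\<And>x. x \<in> carrier R \<Longrightarrow> x \<notin> Q \<Longrightarrow> \<exists>r\<in>carrier R. \<exists>s\<in>?C - p. congr Q s (x \<otimes> r)"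
    using ideal_maximal_disjoint[OF zeroideal, of "?C - p"] by metis
  have prime: "primeideal Q R"
  proof (rule maximal_disjoint_prime[OF Q max])
    show "?C - p \<subseteq> carrier R" using fixset_carr by blast
    show "\<one> \<in> ?C - p" by (rule one)
    fix s t assume st: "s \<in> ?C - p" "t \<in> ?C - p"
    then show "s \<otimes> t \<in> ?C - p"
      using fixset_mult[OF subset_refl, of s t] primeideal.I_prime[OF p, of s t] by auto
  qed
  have "p \<subseteq> Q"
  proof
    fix x assume x: "x \<in> p"
    then have xC: "x \<in> ?C" "x \<in> carrier R" using pC fixset_carr by auto
    show "x \<in> Q"
    proof (rule ccontr)
      assume "x \<notin> Q"
      then obtain b c where b: "b \<in> carrier R" and c: "c \<in> ?C" "c \<notin> p" and cb: "congr Q c (x \<otimes> b)"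
        using max xC by blast
      have cc: "c \<in> carrier R" using c fixset_carr by blast
      define y where "y g = \<rho> g (\<ominus> b)" for g
      have yc: "y \<in> carrier H \<rightarrow> carrier R" using b by (auto simp: y_def)
      define n where "n = card (carrier H)"
      have n: "0 < n" unfolding n_def using finite_H H.one_closed card_gt_0_iff by blast
      have u: "c \<ominus> x \<otimes> b \<in> Q" using cb by (simp add: congr_def)
      have uc: "c \<ominus> x \<otimes> b \<in> carrier R" using cc xC b by simp
      have "(\<Otimes>g\<in>carrier H. \<rho> g (c \<ominus> x \<otimes> b)) \<in> Q"
        by (rule ideal_finprod[OF Q(1) finite_H _ H.one_closed]) (use u uc act_id in auto)
      moreover have "(\<Otimes>g\<in>carrier H. \<rho> g (c \<ominus> x \<otimes> b)) \<in> ?C"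
        by (rule norm_fixed[OF H.subgroup_self uc])
      ultimately have "(\<Otimes>g\<in>carrier H. \<rho> g (c \<ominus> x \<otimes> b)) \<in> p" using Q(2) by blast
      moreover have "(\<Otimes>g\<in>carrier H. \<rho> g (c \<ominus> x \<otimes> b)) = (\<Otimes>g\<in>carrier H. c \<oplus> x \<otimes> y g)"
      proof (rule prod_cong)
        fix g assume g: "g \<in> carrier H"
        show "\<rho> g (c \<ominus> x \<otimes> b) = c \<oplus> x \<otimes> y g"
          using g cc xC b fixsetD[OF c(1) g] fixsetD[OF xC(1) g]
          by (simp add: a_minus_def y_def act_add act_uminus act_mult r_minus)
        show "c \<oplus> x \<otimes> y g \<in> carrier R" using g cc xC yc by auto
      qed
      moreover have "(\<Otimes>g\<in>carrier H. c \<oplus> x \<otimes> y g)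
        = (\<Oplus>j\<in>{..n}. c [^] (n - j) \<otimes> (x [^] j \<otimes> esym (carrier H) y j))"
      proof -
        have "(\<lambda>g. x \<otimes> y g) \<in> carrier H \<rightarrow> carrier R" using xC yc by auto
        then show ?thesis
          using finprod_add_expand[OF finite_H cc, of "\<lambda>g. x \<otimes> y g"] esym_mult[OF finite_H xC(2) yc]
          by (simp add: n_def)
      qed
      moreover have "(\<Oplus>j\<in>{..n}. c [^] (n - j) \<otimes> (x [^] j \<otimes> esym (carrier H) y j))
        = c [^] n \<oplus> (\<Oplus>j\<in>{1..n}. c [^] (n - j) \<otimes> (x [^] j \<otimes> esym (carrier H) y j))"
      proof -
        have "{..n} = Set.insert 0 {1..n}" by auto
        moreover have "(\<lambda>j. c [^] (n - j) \<otimes> (x [^] j \<otimes> esym (carrier H) y j)) \<in> {..n} \<rightarrow> carrier R"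
          using cc xC esym_closed[OF yc] by auto
        ultimately show ?thesis
          using finsum_insert[of "{1..n}" 0 "\<lambda>j. c [^] (n - j) \<otimes> (x [^] j \<otimes> esym (carrier H) y j)"]
            cc xC esym_closed[OF yc] esym_0[OF finite_H] by simp
      qed
      ultimately have sum: "c [^] n \<oplus> (\<Oplus>j\<in>{1..n}. c [^] (n - j) \<otimes> (x [^] j \<otimes> esym (carrier H) y j)) \<in> p"
        by simp
      \<comment> \<open>Each term with j at least 1 contains the factor \<open>x\<close>;
        \<open>T\<close> is the sum with that factor taken out once. As \<open>T\<close> is
        invariant, x T lies in \<open>p\<close>, and only the power of \<open>c\<close>
        remains.\<close>
      define T where "T = (\<Oplus>j\<in>{1..n}. c [^] (n - j) \<otimes> (x [^] (j - 1) \<otimes> esym (carrier H) y j))"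
      have eC: "esym (carrier H) y j \<in> ?C" for j
        unfolding y_def using esym_fixed[OF H.subgroup_self] b by simp
      have TC: "T \<in> ?C" unfolding T_def
        by (intro fixset_finsum fixset_mult fixset_pow eC c xC subset_refl)
      have "(\<Oplus>j\<in>{1..n}. c [^] (n - j) \<otimes> (x [^] j \<otimes> esym (carrier H) y j)) = x \<otimes> T"
      proof -
        have "x \<otimes> T = (\<Oplus>j\<in>{1..n}. x \<otimes> (c [^] (n - j) \<otimes> (x [^] (j - 1) \<otimes> esym (carrier H) y j)))"
          unfolding T_def using cc xC esym_closed[OF yc] by (intro finsum_rdistr) auto
        also have "\<dots> = (\<Oplus>j\<in>{1..n}. c [^] (n - j) \<otimes> (x [^] j \<otimes> esym (carrier H) y j))"
        proof (rule sum_cong)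
          fix j assume "j \<in> {1..n}"
          then have "x [^] j = x \<otimes> x [^] (j - 1)" using xC nat_pow_Suc2[of x "j - 1"] by simp
          then show "x \<otimes> (c [^] (n - j) \<otimes> (x [^] (j - 1) \<otimes> esym (carrier H) y j)) =
            c [^] (n - j) \<otimes> (x [^] j \<otimes> esym (carrier H) y j)"
            using cc xC esym_closed[OF yc] by (simp add: m_ac)
        qed (use cc xC esym_closed[OF yc] in auto)
        finally show ?thesis by simp
      qed
      moreover have "x \<otimes> T \<in> p" using F.ideal_mult_right[OF idp x] TC by simp
      moreover have cn: "c [^] n \<in> ?C" by (rule fixset_pow[OF subset_refl c(1)])
      ultimately have "c [^] n \<in> p"
      proof -
        assume 1: "(\<Oplus>j\<in>{1..n}. c [^] (n - j) \<otimes> (x [^] j \<otimes> esym (carrier H) y j)) = x \<otimes> T"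
          and 2: "x \<otimes> T \<in> p"
        have "(c [^] n \<oplus> x \<otimes> T) \<ominus>\<^bsub>fixring (carrier H)\<^esub> x \<otimes> T \<in> p"
          using F.ideal_diff[OF idp] sum 1 2 by simp
        moreover have "(c [^] n \<oplus> x \<otimes> T) \<ominus>\<^bsub>fixring (carrier H)\<^esub> x \<otimes> T = (c [^] n \<oplus> x \<otimes> T) \<ominus> x \<otimes> T"
          by (rule fixring_diff[OF subset_refl]) (use cn TC xC fixset_mult fixset_add in auto)
        moreover have "(c [^] n \<oplus> x \<otimes> T) \<ominus> x \<otimes> T = c [^] n"
          using cc xC fixset_carr[OF TC] by (simp add: a_minus_def a_assoc r_neg)
        ultimately show ?thesis by simp
      qed
      moreover have "c [^]\<^bsub>fixring (carrier H)\<^esub> n = c [^] n" for n :: nat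
        by (induction n) (simp_all add: nat_pow_def)
      ultimately have "c \<in> p" using F.prime_pow[OF p, of c n] c(1) by simp
      then show False using c(2) by simp
    qed
  qed
  then have "Q \<inter> ?C = p" using Q(2) pC by blast
  then show thesis using that prime by blast
qed

end

section \<open>Polynomial rings and detection of the inertia group\<close>

lemma carrier_UP: "carrier (UP R) = up R"
  by (simp add: UP_def)

lemma coeff_UP: "p \<in> carrier (UP R) \<Longrightarrow> coeff (UP R) p = p"
  by (simp add: UP_def)

definition up_map :: "('a, 'b) ring_scheme \<Rightarrow> ('a \<Rightarrow> 'c) \<Rightarrow> (nat \<Rightarrow> 'a) \<Rightarrow> nat \<Rightarrow> 'c" where
  "up_map R h p = (\<lambda>n. h (coeff (UP R) p n))"

context
  fixes R (structure) and S (structure) and h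
  assumes R: "cring R" and S: "cring S" and h: "h \<in> ring_hom R S"
begin

interpretation R: UP_cring R "UP R" by (simp add: UP_cring_def R)
interpretation S: UP_cring S "UP S" by (simp add: UP_cring_def S)
interpretation h: ring_hom_cring R S h
  by (intro ring_hom_cring.intro ring_hom_cring_axioms.intro R S h)

lemma up_map_closed:
  assumes p: "p \<in> carrier (UP R)" shows "up_map R h p \<in> carrier (UP S)"
proof -
  have pu: "p \<in> up R" using p by (simp only: carrier_UP)
  have cp: "coeff (UP R) p = p" by (rule coeff_UP[OF p])
  obtain n where n: "bound \<zero>\<^bsub>R\<^esub> n p" using R.R.bound_upD[OF pu] by (rule exE)
  have "up_map R h p \<in> up S"
  proof (rule mem_upI)
    show "up_map R h p i \<in> carrier S" for i
      unfolding up_map_def by (rule h.hom_closed[OF R.coeff_closed[OF p]])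
    have "bound \<zero>\<^bsub>S\<^esub> n (up_map R h p)"
    proof
      fix i assume "n < i"
      then have "p i = \<zero>\<^bsub>R\<^esub>" by (rule bound.bound[OF n])
      then show "up_map R h p i = \<zero>\<^bsub>S\<^esub>" using cp by (simp add: up_map_def)
    qed
    then show "\<exists>n. bound \<zero>\<^bsub>S\<^esub> n (up_map R h p)" by (rule exI)
  qed
  then show ?thesis by (simp only: carrier_UP)
qed

lemma coeff_up_map: "p \<in> carrier (UP R) \<Longrightarrow> coeff (UP S) (up_map R h p) n = h (coeff (UP R) p n)"
  using coeff_UP[OF up_map_closed] by (simp only: up_map_def)

lemma up_map_hom: "up_map R h \<in> ring_hom (UP R) (UP S)"
proof (rule ring_hom_memI)
  fix p q assume p: "p \<in> carrier (UP R)" and q: "q \<in> carrier (UP R)"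
  show pc: "up_map R h p \<in> carrier (UP S)" by (rule up_map_closed[OF p])
  have qc: "up_map R h q \<in> carrier (UP S)" by (rule up_map_closed[OF q])
  show "up_map R h (p \<oplus>\<^bsub>UP R\<^esub> q) = up_map R h p \<oplus>\<^bsub>UP S\<^esub> up_map R h q"
    by (rule S.up_eqI) (use p q pc qc up_map_closed in \<open>simp_all add: coeff_up_map\<close>)
  show "up_map R h (p \<otimes>\<^bsub>UP R\<^esub> q) = up_map R h p \<otimes>\<^bsub>UP S\<^esub> up_map R h q"
  proof (rule S.up_eqI)
    fix n
    show "coeff (UP S) (up_map R h (p \<otimes>\<^bsub>UP R\<^esub> q)) n = coeff (UP S) (up_map R h p \<otimes>\<^bsub>UP S\<^esub> up_map R h q) n"
      using p q pc qc by (simp add: coeff_up_map comp_def Pi_def)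
  qed (use p q pc qc up_map_closed in simp_all)
next
  show "up_map R h \<one>\<^bsub>UP R\<^esub> = \<one>\<^bsub>UP S\<^esub>"
    by (rule S.up_eqI) (use up_map_closed in \<open>simp_all add: coeff_up_map\<close>)
qed

end

context ring_action
begin

text \<open>With the group acting on polynomials, finitely many ring elements can be combined into a
  single polynomial and moved together.\<close>

lemma up_ring_action: "ring_action (UP R) H (\<lambda>g. up_map R (\<rho> g))"
proof -
  interpret U: UP_cring R "UP R" by (simp add: UP_cring_def cring_axioms)
  show ?thesis
  proof (intro ring_action.intro ring_action_axioms.intro)
    fix g h p assume g: "g \<in> carrier H" and h: "h \<in> carrier H" and p: "p \<in> carrier (UP R)"
    show "up_map R (\<rho> (g \<otimes>\<^bsub>H\<^esub> h)) p = up_map R (\<rho> g) (up_map R (\<rho> h) p)"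
      unfolding up_map_def[of R "\<rho> (g \<otimes>\<^bsub>H\<^esub> h)"] up_map_def[of R "\<rho> g"]
      using coeff_up_map[OF cring_axioms cring_axioms act_hom[OF h] p] act_comp[OF g h] p by simp
  next
    fix p assume p: "p \<in> carrier (UP R)"
    then have "up_map R (\<rho> \<one>\<^bsub>H\<^esub>) p = up_ring.coeff (UP R) p" by (simp add: up_map_def act_id)
    then show "up_map R (\<rho> \<one>\<^bsub>H\<^esub>) p = p" using coeff_UP[OF p] by simp
  qed (use U.UP_cring group_H finite_H up_map_hom cring_axioms act_hom in auto)
qed

text \<open>The coefficients of the polynomial \<open>\<alpha>\<close> separate all elements outside the inertia group
  modulo \<open>Q\<close>. As \<open>u\<close> fixes the elementary symmetric functions of the \<open>K\<close>-conjugates of \<open>\<alpha>\<close>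
  modulo \<open>Q\<close>, the product of all \<open>\<alpha> - u k \<alpha>\<close> vanishes in a polynomial ring over a domain.\<close>

lemma mem_of_trivial_on_fixset:
  assumes K: "subgroup K H" and Q: "primeideal Q R"
    and inertia: "\<And>g. g \<in> carrier H \<Longrightarrow> (\<forall>a\<in>carrier R. \<rho> g a \<ominus> a \<in> Q) \<Longrightarrow> g \<in> K"
    and s: "u \<in> carrier H" and triv: "\<And>b. b \<in> fixset K \<Longrightarrow> \<rho> u b \<ominus> b \<in> Q"
  shows "u \<in> K"
proof -
  have idQ: "ideal Q R" using Q by (rule primeideal.axioms(1))
  define D where "D = R Quot Q"
  define cls where "cls = (+>\<^bsub>R\<^esub>) Q"
  have domD: "domain D" unfolding D_def by (rule primeideal.quotient_is_domain[OF Q])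
  then have cD: "cring D" by (simp add: domain_def)
  have hcls: "cls \<in> ring_hom R D" unfolding cls_def D_def by (rule ideal.rcos_ring_hom[OF idQ])
  have cls_eq: "cls a = cls b \<longleftrightarrow> a \<ominus> b \<in> Q" if "a \<in> carrier R" "b \<in> carrier R" for a b
    unfolding cls_def using quotient_eq_iff_same_a_r_cos[OF idQ that] by simp
  interpret P: ring_action "UP R" H "\<lambda>g. up_map R (\<rho> g)" by (rule up_ring_action)
  interpret UR: UP_cring R "UP R" by (simp add: UP_cring_def cring_axioms)
  interpret UD: UP_domain D "UP D" by (simp add: UP_domain_def domD)
  \<comment> \<open>\<open>\<Theta> g\<close> applies \<open>g\<close> to the coefficients and
    reduces them modulo \<open>Q\<close>. Its values lie in a polynomial ring over a domain, where a
    vanishing product has a vanishing factor.\<close>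
  define \<Theta> where "\<Theta> g = up_map R (\<lambda>a. cls (\<rho> g a))" for g
  have hg: "(\<lambda>a. cls (\<rho> g a)) \<in> ring_hom R D" if "g \<in> carrier H" for g
    using ring_hom_trans[OF act_hom[OF that] hcls] by (simp add: comp_def)
  have \<Theta>hom: "\<Theta> g \<in> ring_hom (UP R) (UP D)" if "g \<in> carrier H" for g
    unfolding \<Theta>_def by (rule up_map_hom[OF cring_axioms cD hg[OF that]])
  have \<Theta>c: "\<Theta> g p \<in> carrier (UP D)" if "g \<in> carrier H" "p \<in> carrier (UP R)" for g p
    using ring_hom_closed[OF \<Theta>hom that(2)] that(1) .
  have \<Theta>comp: "\<Theta> g (up_map R (\<rho> h) p) = \<Theta> (g \<otimes>\<^bsub>H\<^esub> h) p"
    if "g \<in> carrier H" "h \<in> carrier H" "p \<in> carrier (UP R)" for g h p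
    unfolding \<Theta>_def up_map_def[of R "\<lambda>a. cls (\<rho> g a)"] up_map_def[of R "\<lambda>a. cls (\<rho> (g \<otimes>\<^bsub>H\<^esub> h) a)"]
    using coeff_up_map[OF cring_axioms cring_axioms act_hom[OF that(2)] that(3)] act_comp that by simp
  \<comment> \<open>If \<open>\<tau>\<close> moves some element modulo \<open>Q\<close>, then
    \<open>a \<tau>\<close> is such an element; otherwise it is an arbitrary element of the
    ring.\<close>
  define a where "a \<tau> = (SOME x. x \<in> carrier R \<and> ((\<exists>x\<in>carrier R. \<rho> \<tau> x \<ominus> x \<notin> Q) \<longrightarrow> \<rho> \<tau> x \<ominus> x \<notin> Q))" for \<tau>
  have a: "a \<tau> \<in> carrier R \<and> ((\<exists>x\<in>carrier R. \<rho> \<tau> x \<ominus> x \<notin> Q) \<longrightarrow> \<rho> \<tau> (a \<tau>) \<ominus> a \<tau> \<notin> Q)" for \<tau>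
    unfolding a_def by (rule someI_ex) (use zero_closed in blast)
  \<comment> \<open>Distinct exponents keep the chosen elements apart as coefficients of the one
    polynomial \<open>\<alpha>\<close>.\<close>
  obtain idx :: "'g \<Rightarrow> nat" where idx: "inj_on idx (carrier H)"
    using finite_imp_inj_to_nat_seg[OF finite_H] by blast
  define \<alpha> where "\<alpha> n = (if n \<in> idx ` carrier H then a (inv_into (carrier H) idx n) else \<zero>)" for n
  have \<alpha>_idx: "\<alpha> (idx \<tau>) = a \<tau>" if "\<tau> \<in> carrier H" for \<tau>
    using that idx by (simp add: \<alpha>_def)
  have \<alpha>: "\<alpha> \<in> carrier (UP R)"
  proof -
    have "bound \<zero> (Max (idx ` carrier H)) \<alpha>"
    proof
      fix n assume "Max (idx ` carrier H) < n"
      then have "n \<notin> idx ` carrier H" using finite_H Max_ge by (metis finite_imageI not_le)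
      then show "\<alpha> n = \<zero>" by (simp add: \<alpha>_def)
    qed
    moreover have "\<alpha> n \<in> carrier R" for n using a by (simp add: \<alpha>_def)
    ultimately have "\<alpha> \<in> up R" by (intro mem_upI) auto
    then show ?thesis by (simp only: carrier_UP)
  qed
  have coeff\<alpha>: "up_ring.coeff (UP R) \<alpha> n = \<alpha> n" for n using coeff_UP[OF \<alpha>] by simp
  have separate: "\<tau> \<in> K" if t: "\<tau> \<in> carrier H" and eq: "\<Theta> \<one>\<^bsub>H\<^esub> \<alpha> = \<Theta> \<tau> \<alpha>" for \<tau>
  proof (rule inertia[OF t])
    have "up_ring.coeff (UP D) (\<Theta> g \<alpha>) (idx \<tau>) = cls (\<rho> g (a \<tau>))" if "g \<in> carrier H" for g
      unfolding \<Theta>_def using coeff_up_map[OF cring_axioms cD hg[OF that] \<alpha>] coeff\<alpha> \<alpha>_idx[OF t] by simp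
    then have "cls (\<rho> \<tau> (a \<tau>)) = cls (a \<tau>)" using eq t a act_id by (metis H.one_closed)
    then have "\<rho> \<tau> (a \<tau>) \<ominus> a \<tau> \<in> Q" using cls_eq a t by simp
    then show "\<forall>x\<in>carrier R. \<rho> \<tau> x \<ominus> x \<in> Q" using a by blast
  qed
  define \<beta> where "\<beta> = \<ominus>\<^bsub>UP R\<^esub> \<alpha>"
  have \<beta>: "\<beta> \<in> carrier (UP R)" using \<alpha> by (simp add: \<beta>_def)
  have Kc: "k \<in> carrier H" if "k \<in> K" for k using subgroup_subset[OF K] that by blast
  have finK: "finite K" by (rule finite_subgroup[OF K])
  define y where "y k = up_map R (\<rho> k) \<beta>" for k
  have y: "y \<in> K \<rightarrow> carrier (UP R)" unfolding y_def using \<beta> Kc P.act_closed by auto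
  define e where "e j = P.esym K y j" for j
  have ec: "e j \<in> carrier (UP R)" for j unfolding e_def by (rule P.esym_closed[OF y])
  have \<Theta>e: "\<Theta> u (e j) = \<Theta> \<one>\<^bsub>H\<^esub> (e j)" for j
  proof -
    have fx: "e j \<in> P.fixset K" unfolding e_def y_def by (rule P.esym_fixed[OF K \<beta>])
    have "up_ring.coeff (UP R) (e j) n \<in> fixset K" for n
    proof (rule fixsetI)
      show "up_ring.coeff (UP R) (e j) n \<in> carrier R" using ec by simp
      fix g assume g: "g \<in> K"
      have "up_ring.coeff (UP R) (up_map R (\<rho> g) (e j)) n = \<rho> g (up_ring.coeff (UP R) (e j) n)"
        by (rule coeff_up_map[OF cring_axioms cring_axioms act_hom[OF Kc[OF g]] ec])
      then show "\<rho> g (up_ring.coeff (UP R) (e j) n) = up_ring.coeff (UP R) (e j) n" using P.fixsetD[OF fx g] by simp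
    qed
    then have "cls (\<rho> u (up_ring.coeff (UP R) (e j) n)) = cls (\<rho> \<one>\<^bsub>H\<^esub> (up_ring.coeff (UP R) (e j) n))" for n
      using triv[of "up_ring.coeff (UP R) (e j) n"] cls_eq s ec act_id by simp
    then show ?thesis by (simp add: \<Theta>_def up_map_def)
  qed
  have \<Theta>y: "(\<lambda>k. \<Theta> g (y k)) \<in> K \<rightarrow> carrier (UP D)" if "g \<in> carrier H" for g
    using \<Theta>c[OF that] y by auto
  have exp: "(\<Otimes>\<^bsub>UP D\<^esub>k\<in>K. \<Theta> \<one>\<^bsub>H\<^esub> \<alpha> \<oplus>\<^bsub>UP D\<^esub> \<Theta> g (y k)) =
      (\<Oplus>\<^bsub>UP D\<^esub>j\<in>{..card K}. \<Theta> \<one>\<^bsub>H\<^esub> \<alpha> [^]\<^bsub>UP D\<^esub> (card K - j) \<otimes>\<^bsub>UP D\<^esub> \<Theta> g (e j))"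
    if g: "g \<in> carrier H" for g
    using UD.P.finprod_add_expand[OF finK \<Theta>c[OF H.one_closed \<alpha>] \<Theta>y[OF g]]
      P.esym_hom[OF UD.UP_cring \<Theta>hom[OF g] y] by (simp add: e_def)
  \<comment> \<open>The symmetric functions have \<open>K\<close>-invariant coefficients, so
    \<open>u\<close> leaves them unchanged modulo \<open>Q\<close>. With the identity in place of
    \<open>u\<close>, the factor at the neutral element of \<open>K\<close> vanishes.\<close>
  have "(\<Otimes>\<^bsub>UP D\<^esub>k\<in>K. \<Theta> \<one>\<^bsub>H\<^esub> \<alpha> \<oplus>\<^bsub>UP D\<^esub> \<Theta> u (y k)) =
      (\<Otimes>\<^bsub>UP D\<^esub>k\<in>K. \<Theta> \<one>\<^bsub>H\<^esub> \<alpha> \<oplus>\<^bsub>UP D\<^esub> \<Theta> \<one>\<^bsub>H\<^esub> (y k))"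
    using exp[OF s] exp[OF H.one_closed] \<Theta>e by simp
  also have "\<dots> \<in> {\<zero>\<^bsub>UP D\<^esub>}"
  proof (rule UD.P.ideal_finprod[OF UD.P.zeroideal finK])
    show oneK: "\<one>\<^bsub>H\<^esub> \<in> K" by (rule subgroup.one_closed[OF K])
    show "(\<lambda>k. \<Theta> \<one>\<^bsub>H\<^esub> \<alpha> \<oplus>\<^bsub>UP D\<^esub> \<Theta> \<one>\<^bsub>H\<^esub> (y k)) \<in> K \<rightarrow> carrier (UP D)"
      using \<Theta>y[OF H.one_closed] \<Theta>c[OF H.one_closed \<alpha>] by auto
    have "y \<one>\<^bsub>H\<^esub> = \<beta>" unfolding y_def by (rule P.act_id[OF \<beta>])
    moreover have "\<Theta> \<one>\<^bsub>H\<^esub> \<alpha> \<oplus>\<^bsub>UP D\<^esub> \<Theta> \<one>\<^bsub>H\<^esub> \<beta> = \<Theta> \<one>\<^bsub>H\<^esub> (\<alpha> \<oplus>\<^bsub>UP R\<^esub> \<beta>)"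
      using ring_hom_add[OF \<Theta>hom[OF H.one_closed] \<alpha> \<beta>] by simp
    moreover have "\<alpha> \<oplus>\<^bsub>UP R\<^esub> \<beta> = \<zero>\<^bsub>UP R\<^esub>" unfolding \<beta>_def by (rule P.r_neg[OF \<alpha>])
    moreover have "\<Theta> \<one>\<^bsub>H\<^esub> \<zero>\<^bsub>UP R\<^esub> = \<zero>\<^bsub>UP D\<^esub>"
      by (rule ring_hom_zero[OF \<Theta>hom[OF H.one_closed] UR.UP_ring UD.UP_ring])
    ultimately show "\<Theta> \<one>\<^bsub>H\<^esub> \<alpha> \<oplus>\<^bsub>UP D\<^esub> \<Theta> \<one>\<^bsub>H\<^esub> (y \<one>\<^bsub>H\<^esub>) \<in> {\<zero>\<^bsub>UP D\<^esub>}" by simp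
  qed
  finally have "\<exists>k\<in>K. \<Theta> \<one>\<^bsub>H\<^esub> \<alpha> \<oplus>\<^bsub>UP D\<^esub> \<Theta> u (y k) \<in> {\<zero>\<^bsub>UP D\<^esub>}"
    by (intro UD.P.prime_finprod[OF UD.zeroprimeideal finK])
      (use \<Theta>y[OF s] \<Theta>c[OF H.one_closed \<alpha>] in auto)
  then obtain k where k: "k \<in> K" "\<Theta> \<one>\<^bsub>H\<^esub> \<alpha> \<oplus>\<^bsub>UP D\<^esub> \<Theta> u (y k) = \<zero>\<^bsub>UP D\<^esub>" by blast
  have kc: "k \<in> carrier H" using Kc k(1) .
  have sk: "u \<otimes>\<^bsub>H\<^esub> k \<in> carrier H" using s kc by simp
  have "\<Theta> u (y k) = \<Theta> (u \<otimes>\<^bsub>H\<^esub> k) \<beta>" unfolding y_def by (rule \<Theta>comp[OF s kc \<beta>])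
  also have "\<dots> = \<ominus>\<^bsub>UP D\<^esub> \<Theta> (u \<otimes>\<^bsub>H\<^esub> k) \<alpha>"
  proof -
    interpret T: ring_hom_cring "UP R" "UP D" "\<Theta> (u \<otimes>\<^bsub>H\<^esub> k)"
      by (intro ring_hom_cring.intro ring_hom_cring_axioms.intro UR.UP_cring UD.UP_cring \<Theta>hom[OF sk])
    show ?thesis unfolding \<beta>_def by (rule T.hom_a_inv[OF \<alpha>])
  qed
  finally have "\<Theta> \<one>\<^bsub>H\<^esub> \<alpha> = \<Theta> (u \<otimes>\<^bsub>H\<^esub> k) \<alpha>"
    using k(2) UD.P.sum_zero_eq_neg[of "\<Theta> \<one>\<^bsub>H\<^esub> \<alpha>" "\<ominus>\<^bsub>UP D\<^esub> \<Theta> (u \<otimes>\<^bsub>H\<^esub> k) \<alpha>"]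
      \<Theta>c[OF H.one_closed \<alpha>] \<Theta>c[OF sk \<alpha>] by simp
  then have skK: "u \<otimes>\<^bsub>H\<^esub> k \<in> K" by (rule separate[OF sk])
  have "u = (u \<otimes>\<^bsub>H\<^esub> k) \<otimes>\<^bsub>H\<^esub> inv\<^bsub>H\<^esub> k" using s kc by (simp add: H.m_assoc)
  then show "u \<in> K"
    using subgroup.m_closed[OF K skK subgroup.m_inv_closed[OF K k(1)]] by simp
qed

end

section \<open>Homomorphisms from finite p-groups\<close>

text \<open>The fixed points of the translation action on the functions \<open>f\<close> to $\mathbb{Z}/p$ with
  \<open>f 1 = 0\<close> are the homomorphisms, and their number is divisible by \<open>p\<close>.\<close>

lemma p_group_hom_mod:
  fixes J (structure) and p :: nat
  assumes J: "group J" and p: "Factorial_Ring.prime p" and card: "card (carrier J) = p ^ k"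
    and nontriv: "carrier J \<noteq> {\<one>}"
  obtains \<chi> :: "'a \<Rightarrow> int" where
    "\<And>g h. g \<in> carrier J \<Longrightarrow> h \<in> carrier J \<Longrightarrow> \<chi> (g \<otimes> h) mod int p = (\<chi> g + \<chi> h) mod int p"
    "\<exists>g\<in>carrier J. \<chi> g mod int p \<noteq> 0"
proof -
  interpret J: group J by (rule J)
  have p0: "0 < p" "1 < p" using prime_gt_0_nat[OF p] prime_gt_1_nat[OF p] by auto
  have finJ: "finite (carrier J)" using card p0 by (intro card_ge_0_finite) simp
  \<comment> \<open>Values are reduced modulo \<open>p\<close> and the value at the neutral element
    is 0. Extensionality makes \<open>E\<close> finite and equality in it pointwise on the
    group.\<close>
  define E :: "('a \<Rightarrow> int) set" where
    "E = PiE (carrier J) (\<lambda>x. if x = \<one> then {0} else {0..<int p})"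
  \<comment> \<open>Subtracting \<open>f g\<close> restores the value 0 at the neutral element. That
    every \<open>g\<close> fixes \<open>f\<close> says that \<open>f\<close> is additive modulo
    \<open>p\<close>.\<close>
  define act where "act g f = (\<lambda>x\<in>carrier J. (f (x \<otimes> g) - f g) mod int p)" for g :: 'a and f :: "'a \<Rightarrow> int"
  define \<phi> where "\<phi> g = (\<lambda>f\<in>E. act g f)" for g
  have E_val: "f x mod int p = f x" if "f \<in> E" "x \<in> carrier J" for f x
    using that p0 unfolding E_def by (auto simp: PiE_iff split: if_splits)
  have E_one: "f \<one> = 0" if "f \<in> E" for f using PiE_mem[OF that[unfolded E_def] J.one_closed] by simp
  have actE: "act g f \<in> E" if "f \<in> E" "g \<in> carrier J" for f g
    using that p0 unfolding E_def act_def by (auto simp: PiE_iff)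
  have act_comp: "act g (act h f) = act (g \<otimes> h) f" if "g \<in> carrier J" "h \<in> carrier J" for f g h
    unfolding act_def using that by (auto simp: restrict_def fun_eq_iff J.m_assoc mod_simps)
  have act_one: "act \<one> f = f" if "f \<in> E" for f
  proof
    fix x show "act \<one> f x = f x"
      using that E_val[OF that, of x] E_one[OF that] unfolding act_def E_def
      by (auto simp: PiE_iff extensional_def restrict_def)
  qed
  have act: "group_action J E \<phi>"
    unfolding group_action_def group_hom_def group_hom_axioms_def
  proof (intro conjI J group_BijGroup)
    have bij: "\<phi> g \<in> Bij E" if g: "g \<in> carrier J" for g
    proof -
      have "bij_betw (act g) E E"
      proof (rule bij_betwI[where g = "act (inv g)"])
        show "act g \<in> E \<rightarrow> E" "act (inv g) \<in> E \<rightarrow> E" using actE g by auto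
        fix f assume "f \<in> E"
        then show "act (inv g) (act g f) = f" "act g (act (inv g) f) = f"
          using g by (simp_all add: act_comp act_one)
      qed
      then have "bij_betw (\<phi> g) E E" using bij_betw_cong[of E "\<phi> g" "act g"] by (simp add: \<phi>_def)
      then show ?thesis by (simp add: Bij_def \<phi>_def)
    qed
    show "\<phi> \<in> hom J (BijGroup E)"
    proof (rule homI)
      fix g h assume gh: "g \<in> carrier J" "h \<in> carrier J"
      have "\<phi> (g \<otimes> h) = compose E (\<phi> g) (\<phi> h)"
        using gh actE act_comp by (auto simp: \<phi>_def compose_def restrict_def fun_eq_iff)
      then show "\<phi> (g \<otimes> h) = \<phi> g \<otimes>\<^bsub>BijGroup E\<^esub> \<phi> h" using bij gh by (simp add: BijGroup_def)
    qed (use bij in \<open>simp add: BijGroup_def\<close>)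
  qed
  interpret act: group_action J E \<phi> by (rule act)
  have "\<exists>f\<in>E. f \<noteq> (\<lambda>x\<in>carrier J. 0) \<and> (\<forall>g\<in>carrier J. act g f = f)"
  proof (rule ccontr)
    assume no: "\<not> ?thesis"
    define z :: "'a \<Rightarrow> int" where "z = (\<lambda>x\<in>carrier J. 0)"
    have zE: "z \<in> E" using p0 unfolding E_def z_def by (auto simp: PiE_iff)
    have finE: "finite E" unfolding E_def using finJ by (intro finite_PiE) auto
    have "act g z = z" if "g \<in> carrier J" for g
      using that unfolding act_def z_def by (auto simp: restrict_def fun_eq_iff)
    then have orb_z: "orbit J \<phi> z = {z}"
      unfolding orbit_def using zE J.one_closed by (auto simp: \<phi>_def intro!: exI[of _ "\<one>"])
    have fin: "finite (orbits J E \<phi>)" unfolding orbits_def using finE by simp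
    have "card E = (\<Sum>W\<in>orbits J E \<phi>. card W)"
      using act.disjoint_sum[OF finE, of "\<lambda>_. 1 :: nat"] by simp
    also have "\<dots> = card {z} + (\<Sum>W\<in>orbits J E \<phi> - {{z}}. card W)"
      using fin orb_z zE by (intro sum.remove) (auto simp: orbits_def)
    finally have sum: "card E = 1 + (\<Sum>W\<in>orbits J E \<phi> - {{z}}. card W)" by simp
    \<comment> \<open>The zero function is assumed to be the only fixed point, so any other orbit
      has more than one element; its size divides a power of \<open>p\<close> and is therefore
      divisible by \<open>p\<close>.\<close>
    have "p dvd card W" if W: "W \<in> orbits J E \<phi> - {{z}}" for W
    proof -
      obtain f where f: "f \<in> E" "W = orbit J \<phi> f" using W by (auto simp: orbits_def)
      have "f \<noteq> z" using f W orb_z by auto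
      then obtain g where g: "g \<in> carrier J" "act g f \<noteq> f" using no f unfolding z_def by blast
      have "card W dvd p ^ k"
        using act.orbit_stabilizer_theorem[OF f(1)] f(2) card by (metis dvd_triv_left order_def)
      then obtain i where i: "card W = p ^ i" using p divides_primepow_nat by blast
      have "f \<in> W" "act g f \<in> W"
        using f g act.orbit_refl[OF f(1)] by (auto simp: orbit_def \<phi>_def)
      moreover have "finite W" using i p0 by (intro card_ge_0_finite) simp
      ultimately have "card W \<noteq> 1" using g by (metis card_1_singletonE singletonD)
      then show ?thesis using i by (cases i) auto
    qed
    then have "p dvd (\<Sum>W\<in>orbits J E \<phi> - {{z}}. card W)" by (rule dvd_sum)
    moreover have "p dvd card E"
    proof -
      have "card E = (\<Prod>x\<in>carrier J. card (if x = \<one> then {0} else {0..<int p}))"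
        unfolding E_def by (rule card_PiE[OF finJ])
      \<comment> \<open>Any element other than the neutral one contributes a factor \<open>p\<close>
        to the number of functions.\<close>
      moreover obtain x where x: "x \<in> carrier J" "x \<noteq> \<one>" using nontriv J.one_closed by blast
      then have "card (if x = \<one> then {0} else {0..<int p}) dvd
          (\<Prod>x\<in>carrier J. card (if x = \<one> then {0} else {0..<int p}))"
        using finJ by (intro dvd_prodI) auto
      ultimately show ?thesis using x by simp
    qed
    ultimately have "p dvd 1" using sum by (metis dvd_add_left_iff)
    then show False using p0 by simp
  qed
  then obtain f where f: "f \<in> E" "f \<noteq> (\<lambda>x\<in>carrier J. 0)" "\<And>g. g \<in> carrier J \<Longrightarrow> act g f = f" by blast
  show thesis
  proof (rule that)
    fix g h assume gh: "g \<in> carrier J" "h \<in> carrier J"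
    have "f g = (f (g \<otimes> h) - f h) mod int p"
      using f(3)[OF gh(2)] gh by (metis act_def restrict_apply')
    then have "(f g + f h) mod int p = ((f (g \<otimes> h) - f h) mod int p + f h) mod int p" by simp
    also have "\<dots> = f (g \<otimes> h) mod int p" by (simp add: mod_simps)
    finally show "f (g \<otimes> h) mod int p = (f g + f h) mod int p" by simp
  next
    have "f \<in> extensional (carrier J)" using f(1) by (simp add: E_def PiE_iff)
    then have ext: "f x = undefined" if "x \<notin> carrier J" for x by (rule extensional_arb[OF _ that])
    obtain g where g: "f g \<noteq> (\<lambda>x\<in>carrier J. 0) g" using f(2) by (meson HOL.ext)
    have gJ: "g \<in> carrier J"
    proof (rule ccontr)
      assume "g \<notin> carrier J"
      then show False using g ext[of g] by simp
    qed
    then have "f g \<noteq> 0" using g by simp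
    then have "f g mod int p \<noteq> 0" using E_val[OF f(1) gJ] by simp
    then show "\<exists>g\<in>carrier J. f g mod int p \<noteq> 0" using gJ by blast
  qed
qed

section \<open>The cohomology class of an additive character\<close>

context ring_action
begin

definition inertia :: "'a set \<Rightarrow> 'g set" where
  "inertia P = {g \<in> carrier H. \<forall>a\<in>carrier R. \<rho> g a \<ominus> a \<in> P}"

lemma inertia_subgroup:
  assumes P: "ideal P R" shows "subgroup (inertia P) H"
proof (rule H.subgroupI)
  show "inertia P \<subseteq> carrier H" by (auto simp: inertia_def)
  have "\<one>\<^bsub>H\<^esub> \<in> inertia P" using ideal_zero[OF P] by (simp add: inertia_def act_id a_minus_def r_neg)
  then show "inertia P \<noteq> {}" by blast
  fix g assume g: "g \<in> inertia P"
  then have gc: "g \<in> carrier H" by (simp add: inertia_def)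
  show "inv\<^bsub>H\<^esub> g \<in> inertia P"
    unfolding inertia_def
  proof (intro CollectI conjI ballI)
    fix a assume a: "a \<in> carrier R"
    let ?b = "\<rho> (inv\<^bsub>H\<^esub> g) a"
    have b: "?b \<in> carrier R" using gc a by simp
    have "\<rho> g ?b \<ominus> ?b \<in> P" using g b by (simp add: inertia_def)
    then have "a \<ominus> ?b \<in> P" using act_inv_right[OF gc a] by simp
    then have "congr P a ?b" using a b by (simp add: congr_def)
    then show "?b \<ominus> a \<in> P" using congr_sym[OF P] by (simp add: congr_def)
  qed (use gc in simp)
  fix h assume h: "h \<in> inertia P"
  then have hc: "h \<in> carrier H" by (simp add: inertia_def)
  show "g \<otimes>\<^bsub>H\<^esub> h \<in> inertia P"
    unfolding inertia_def
  proof (intro CollectI conjI ballI)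
    fix a assume a: "a \<in> carrier R"
    have "congr P (\<rho> g (\<rho> h a)) (\<rho> h a)" "congr P (\<rho> h a) a"
      using g h a gc hc by (auto simp: inertia_def congr_def)
    then have "congr P (\<rho> g (\<rho> h a)) a" by (rule congr_trans[OF P])
    then show "\<rho> (g \<otimes>\<^bsub>H\<^esub> h) a \<ominus> a \<in> P" using act_comp[OF gc hc a] by (simp add: congr_def)
  qed (use gc hc in simp)
qed

lemma inertia_congr: "g \<in> inertia P \<Longrightarrow> a \<in> carrier R \<Longrightarrow> congr P (\<rho> g a) a"
  by (simp add: inertia_def congr_def)

lemma inertia_mem_iff:
  "ideal P R \<Longrightarrow> g \<in> inertia P \<Longrightarrow> a \<in> carrier R \<Longrightarrow> \<rho> g a \<in> P \<longleftrightarrow> a \<in> P"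
  using congr_mem inertia_congr by blast

lemma bij_left_mult_compl:
  assumes K: "subgroup K H" and g: "g \<in> K"
  shows "bij_betw (\<lambda>k. g \<otimes>\<^bsub>H\<^esub> k) (carrier H - K) (carrier H - K)"
proof -
  have gc: "g \<in> carrier H" using subgroup_subset[OF K] g by blast
  have "bij_betw (\<lambda>k. g \<otimes>\<^bsub>H\<^esub> k) (carrier H) (carrier H)" by (rule bij_left_mult[OF H.subgroup_self gc])
  moreover have "bij_betw (\<lambda>k. g \<otimes>\<^bsub>H\<^esub> k) K K" by (rule bij_left_mult[OF K g])
  ultimately show ?thesis using subgroup_subset[OF K]
    inj_on_image_set_diff[of "\<lambda>k. g \<otimes>\<^bsub>H\<^esub> k" "carrier H" "carrier H" K]
    by (auto simp: bij_betw_def intro: inj_on_diff)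
qed

definition tr :: "'g set \<Rightarrow> 'a \<Rightarrow> 'a" where
  "tr K b = (\<Oplus>h\<in>K. \<rho> h b)"

lemma sum_translate:
  assumes K: "subgroup K H" and g: "g \<in> K" and f: "f \<in> K \<rightarrow> carrier R"
  shows "(\<Oplus>h\<in>K. f (g \<otimes>\<^bsub>H\<^esub> h)) = (\<Oplus>h\<in>K. f h)"
proof -
  have bij: "bij_betw (\<lambda>k. g \<otimes>\<^bsub>H\<^esub> k) K K" by (rule bij_left_mult[OF K g])
  then have im: "(\<lambda>k. g \<otimes>\<^bsub>H\<^esub> k) ` K = K" and inj: "inj_on (\<lambda>k. g \<otimes>\<^bsub>H\<^esub> k) K" by (auto simp: bij_betw_def)
  have "(\<Oplus>h\<in>(\<lambda>k. g \<otimes>\<^bsub>H\<^esub> k) ` K. f h) = (\<Oplus>h\<in>K. f (g \<otimes>\<^bsub>H\<^esub> h))"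
    by (rule finsum_reindex[OF _ inj]) (use f im in simp)
  then show ?thesis using im by simp
qed

lemma tr_fixed:
  assumes K: "subgroup K H" and b: "b \<in> carrier R" shows "tr K b \<in> fixset K"
proof (rule fixsetI)
  have c: "k \<in> carrier H" if "k \<in> K" for k using subgroup_subset[OF K] that by blast
  show "tr K b \<in> carrier R" unfolding tr_def using c b by (intro finsum_closed) auto
  fix g assume g: "g \<in> K"
  have "\<rho> g (tr K b) = (\<Oplus>h\<in>K. \<rho> g (\<rho> h b))"
    unfolding tr_def using c g b by (intro act_finsum) auto
  also have "\<dots> = (\<Oplus>h\<in>K. \<rho> (g \<otimes>\<^bsub>H\<^esub> h) b)"
    by (rule sum_cong) (use c g b act_comp in auto)
  also have "\<dots> = tr K b"
    unfolding tr_def by (rule sum_translate[OF K g]) (use c b in auto)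
  finally show "\<rho> g (tr K b) = tr K b" .
qed

text \<open>Being an ideal of the \<open>K\<close>-invariants makes the set of traces accessible to
  prime avoidance in that ring.\<close>

lemma ideal_range_tr:
  assumes K: "subgroup K H"
  shows "ideal (tr K ` carrier R) (fixring K)"
proof -
  have KH: "K \<subseteq> carrier H" by (rule subgroup_subset[OF K])
  have c: "k \<in> carrier H" if "k \<in> K" for k using KH that by blast
  interpret F: cring "fixring K" by (rule cring_fixring[OF KH])
  show ?thesis
  proof (rule F.ideal_intro)
    show "tr K ` carrier R \<subseteq> carrier (fixring K)" using tr_fixed[OF K] by auto
    have "tr K \<zero> = \<zero>" unfolding tr_def by (rule add.finprod_one_eqI) (use c act_zero in auto)
    then show "\<zero>\<^bsub>fixring K\<^esub> \<in> tr K ` carrier R" using zero_closed by (metis fixring_simps(4) image_eqI)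
  next
    fix a b assume "a \<in> tr K ` carrier R" "b \<in> tr K ` carrier R"
    then obtain x y where xy: "x \<in> carrier R" "y \<in> carrier R" "a = tr K x" "b = tr K y" by blast
    have "tr K (x \<oplus> y) = (\<Oplus>h\<in>K. \<rho> h x \<oplus> \<rho> h y)"
      unfolding tr_def by (rule sum_cong) (use c xy act_add in auto)
    also have "\<dots> = tr K x \<oplus> tr K y"
      unfolding tr_def using c xy by (intro finsum_addf) auto
    finally have "a \<oplus> b = tr K (x \<oplus> y)" using xy by simp
    then show "a \<oplus>\<^bsub>fixring K\<^esub> b \<in> tr K ` carrier R" using xy by auto
  next
    fix r a assume r: "r \<in> carrier (fixring K)" and "a \<in> tr K ` carrier R"
    then obtain x where x: "x \<in> carrier R" "a = tr K x" by blast
    have rc: "r \<in> carrier R" "r \<in> fixset K" using r fixset_carr by auto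
    have "tr K (r \<otimes> x) = (\<Oplus>h\<in>K. r \<otimes> \<rho> h x)"
      unfolding tr_def by (rule sum_cong) (use c x rc act_mult fixsetD in auto)
    also have "\<dots> = r \<otimes> tr K x"
      unfolding tr_def using c x rc finite_subgroup[OF K] by (intro finsum_rdistr[symmetric]) auto
    finally have "r \<otimes> a = tr K (r \<otimes> x)" using x by simp
    then show "r \<otimes>\<^bsub>fixring K\<^esub> a \<in> tr K ` carrier R" using x rc by auto
  qed
qed

text \<open>The trace is the sum of the maps \<open>\<rho> k\<close> with all coefficients 1.
  Trivial intersection with the inertia group makes these maps distinct modulo \<open>Q\<close>, so
  independence of characters forbids that all traces lie in \<open>Q\<close>.\<close>

lemma tr_not_in_prime:
  assumes K: "subgroup K H" and Q: "primeideal Q R" and triv: "inertia Q \<inter> K \<subseteq> {\<one>\<^bsub>H\<^esub>}"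
  shows "\<exists>b\<in>carrier R. tr K b \<notin> Q"
proof (rule ccontr)
  assume no: "\<not> ?thesis"
  have c: "k \<in> carrier H" if "k \<in> K" for k using subgroup_subset[OF K] that by blast
  have "\<forall>k\<in>K. (\<lambda>_. \<one>) k \<in> Q"
  proof (rule independence_of_characters_mod_prime[OF Q finite_subgroup[OF K]])
    show "\<rho> k \<in> ring_hom R R" if "k \<in> K" for k using act_hom c that by blast
    show "(\<lambda>_. \<one>) \<in> K \<rightarrow> carrier R" by simp
    fix b assume b: "b \<in> carrier R"
    have "(\<Oplus>k\<in>K. \<one> \<otimes> \<rho> k b) = tr K b" unfolding tr_def by (rule sum_cong) (use c b in auto)
    then show "(\<Oplus>k\<in>K. \<one> \<otimes> \<rho> k b) \<in> Q" using no b by auto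
  next
    fix k l assume kl: "k \<in> K" "l \<in> K" "k \<noteq> l"
    show "\<exists>b\<in>carrier R. \<rho> k b \<ominus> \<rho> l b \<notin> Q"
    proof (rule ccontr)
      assume n: "\<not> ?thesis"
      have li: "inv\<^bsub>H\<^esub> l \<in> K" by (rule subgroup.m_inv_closed[OF K kl(2)])
      have mK: "k \<otimes>\<^bsub>H\<^esub> inv\<^bsub>H\<^esub> l \<in> K" by (rule subgroup.m_closed[OF K kl(1) li])
      have "\<rho> (k \<otimes>\<^bsub>H\<^esub> inv\<^bsub>H\<^esub> l) a \<ominus> a \<in> Q" if a: "a \<in> carrier R" for a
      proof -
        have "\<rho> k (\<rho> (inv\<^bsub>H\<^esub> l) a) \<ominus> \<rho> l (\<rho> (inv\<^bsub>H\<^esub> l) a) \<in> Q"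
          using n act_closed[OF c[OF li] a] by blast
        then show ?thesis using act_inv_right[OF c[OF kl(2)] a] act_comp[OF c[OF kl(1)] c[OF li] a] by simp
      qed
      then have "k \<otimes>\<^bsub>H\<^esub> inv\<^bsub>H\<^esub> l \<in> inertia Q" using c[OF mK] by (simp add: inertia_def)
      then have "k \<otimes>\<^bsub>H\<^esub> inv\<^bsub>H\<^esub> l = \<one>\<^bsub>H\<^esub>" using triv mK by blast
      then have "k = l" using H.inv_equality[of k "inv\<^bsub>H\<^esub> l"] c kl by simp
      then show False using kl(3) by simp
    qed
  qed
  then have "\<one> \<in> Q" using subgroup.one_closed[OF K] by blast
  then show False using prime_one_notin[OF Q] by blast
qed

end

text \<open>The additive character \<open>c\<close> is a 1-cocycle, and \<open>killer\<close> below is the ideal of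
  invariants annihilating its class in $H^1(I, R)$.\<close>

locale additive_character = ring_action R H \<rho> for R (structure) and H :: "('g, 'h) monoid_scheme" and \<rho> +
  fixes I :: "'g set" and c :: "'g \<Rightarrow> 'a"
  assumes I: "subgroup I H"
    and c_fixed: "g \<in> I \<Longrightarrow> c g \<in> fixset (carrier H)"
    and c_mult: "g \<in> I \<Longrightarrow> h \<in> I \<Longrightarrow> c (g \<otimes>\<^bsub>H\<^esub> h) = c g \<oplus> c h"
begin

definition killer :: "'a set" where
  "killer = {x \<in> fixset (carrier H). \<exists>\<beta>\<in>carrier R. \<forall>g\<in>I. \<rho> g \<beta> = \<beta> \<oplus> x \<otimes> c g}"

lemma I_carr: "g \<in> I \<Longrightarrow> g \<in> carrier H"
  using subgroup_subset[OF I] by blast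

lemma c_carr: "g \<in> I \<Longrightarrow> c g \<in> carrier R"
  using c_fixed fixset_carr by blast

lemma killer_ideal: "ideal killer (fixring (carrier H))"
proof -
  interpret F: cring "fixring (carrier H)" by (rule cring_fixring) simp
  show ?thesis
  proof (rule F.ideal_intro)
    show "killer \<subseteq> carrier (fixring (carrier H))" by (auto simp: killer_def)
    have "\<forall>g\<in>I. \<rho> g \<zero> = \<zero> \<oplus> \<zero> \<otimes> c g" using act_zero I_carr c_carr by simp
    then show "\<zero>\<^bsub>fixring (carrier H)\<^esub> \<in> killer"
      using fixset_zero[OF subset_refl] zero_closed unfolding killer_def by auto
  next
    fix a b assume "a \<in> killer" "b \<in> killer"
    then obtain \<beta> \<gamma> where a: "a \<in> fixset (carrier H)" "\<beta> \<in> carrier R" "\<forall>g\<in>I. \<rho> g \<beta> = \<beta> \<oplus> a \<otimes> c g"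
      and b: "b \<in> fixset (carrier H)" "\<gamma> \<in> carrier R" "\<forall>g\<in>I. \<rho> g \<gamma> = \<gamma> \<oplus> b \<otimes> c g"
      unfolding killer_def by blast
    have "\<forall>g\<in>I. \<rho> g (\<beta> \<oplus> \<gamma>) = (\<beta> \<oplus> \<gamma>) \<oplus> (a \<oplus> b) \<otimes> c g"
      using a b I_carr c_carr fixset_carr[OF a(1)] fixset_carr[OF b(1)] by (simp add: act_add l_distr a_ac)
    then show "a \<oplus>\<^bsub>fixring (carrier H)\<^esub> b \<in> killer"
      using a b fixset_add[OF subset_refl a(1) b(1)] unfolding killer_def by auto
  next
    fix r a assume r: "r \<in> carrier (fixring (carrier H))" and "a \<in> killer"
    then obtain \<beta> where a: "a \<in> fixset (carrier H)" "\<beta> \<in> carrier R" "\<forall>g\<in>I. \<rho> g \<beta> = \<beta> \<oplus> a \<otimes> c g"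
      unfolding killer_def by blast
    have rf: "r \<in> fixset (carrier H)" using r by simp
    have "\<forall>g\<in>I. \<rho> g (r \<otimes> \<beta>) = (r \<otimes> \<beta>) \<oplus> (r \<otimes> a) \<otimes> c g"
      using a I_carr c_carr fixset_carr[OF a(1)] fixset_carr[OF rf] fixsetD[OF rf]
      by (simp add: act_mult r_distr m_assoc)
    then show "r \<otimes>\<^bsub>fixring (carrier H)\<^esub> a \<in> killer"
      using a rf fixset_carr[OF rf] fixset_mult[OF subset_refl rf a(1)] unfolding killer_def by auto
  qed
qed

text \<open>The witness is minus the sum S of all c(h) h(b). Replacing h by g h and using additivity
  of \<open>c\<close> gives S = c(g) tr(b) + g(S).\<close>

lemma tr_kills:
  assumes b: "b \<in> carrier R"
  obtains \<beta> where "\<beta> \<in> carrier R" "\<And>g. g \<in> I \<Longrightarrow> \<rho> g \<beta> = \<beta> \<oplus> tr I b \<otimes> c g"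
proof -
  define S where "S = (\<Oplus>h\<in>I. c h \<otimes> \<rho> h b)"
  have Sc: "S \<in> carrier R" unfolding S_def using b I_carr c_carr by (intro finsum_closed) auto
  have tc: "tr I b \<in> carrier R" using tr_fixed[OF I b] fixset_carr by blast
  have "\<rho> g (\<ominus> S) = \<ominus> S \<oplus> tr I b \<otimes> c g" if g: "g \<in> I" for g
  proof -
    have gc: "g \<in> carrier H" "c g \<in> carrier R" using g I_carr c_carr by auto
    have trans: "(\<Oplus>h\<in>I. \<rho> (g \<otimes>\<^bsub>H\<^esub> h) b) = tr I b"
      unfolding tr_def by (rule sum_translate[OF I g]) (use b I_carr in auto)
    have 1: "\<rho> g S = (\<Oplus>h\<in>I. c h \<otimes> \<rho> (g \<otimes>\<^bsub>H\<^esub> h) b)"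
    proof -
      have "\<rho> g S = (\<Oplus>h\<in>I. \<rho> g (c h \<otimes> \<rho> h b))"
        unfolding S_def using gc b I_carr c_carr by (intro act_finsum) auto
      also have "\<dots> = (\<Oplus>h\<in>I. c h \<otimes> \<rho> (g \<otimes>\<^bsub>H\<^esub> h) b)"
        by (rule sum_cong)
          (use gc b I_carr c_carr fixsetD[OF c_fixed] in \<open>auto simp: act_mult act_comp\<close>)
      finally show ?thesis .
    qed
    have "S = (\<Oplus>h\<in>I. c (g \<otimes>\<^bsub>H\<^esub> h) \<otimes> \<rho> (g \<otimes>\<^bsub>H\<^esub> h) b)"
      unfolding S_def by (rule sum_translate[OF I g, symmetric]) (use b I_carr c_carr in auto)
    also have "\<dots> = (\<Oplus>h\<in>I. c g \<otimes> \<rho> (g \<otimes>\<^bsub>H\<^esub> h) b \<oplus> c h \<otimes> \<rho> (g \<otimes>\<^bsub>H\<^esub> h) b)"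
      by (rule sum_cong) (use g b I_carr c_carr c_mult in \<open>auto simp: l_distr\<close>)
    also have "\<dots> = (\<Oplus>h\<in>I. c g \<otimes> \<rho> (g \<otimes>\<^bsub>H\<^esub> h) b) \<oplus> (\<Oplus>h\<in>I. c h \<otimes> \<rho> (g \<otimes>\<^bsub>H\<^esub> h) b)"
      using g b I_carr c_carr by (intro finsum_addf) auto
    also have "(\<Oplus>h\<in>I. c g \<otimes> \<rho> (g \<otimes>\<^bsub>H\<^esub> h) b) = c g \<otimes> tr I b"
      unfolding trans[symmetric]
      using g b I_carr c_carr finite_subgroup[OF I] by (intro finsum_rdistr[symmetric]) auto
    finally have S: "S = c g \<otimes> tr I b \<oplus> \<rho> g S" using 1 by simp
    have rS: "\<rho> g S \<in> carrier R" using gc Sc by simp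
    have "\<ominus> S \<oplus> tr I b \<otimes> c g = \<ominus> (c g \<otimes> tr I b \<oplus> \<rho> g S) \<oplus> tr I b \<otimes> c g" using S by simp
    also have "\<dots> = \<ominus> \<rho> g S"
      using gc tc rS by (simp add: minus_add m_comm[of "c g"] a_ac r_neg1 r_neg2 r_neg)
    finally show ?thesis using gc Sc by (simp add: act_uminus)
  qed
  then show thesis using that[of "\<ominus> S"] Sc by simp
qed

text \<open>The trace is fixed by \<open>I\<close>, whereas \<open>killer\<close> consists of
  invariants of the whole group. The norm of the trace is the trace times an element
  \<open>z\<close> fixed by \<open>I\<close>, so \<open>z\<close> times the witness of
  \<open>tr_kills\<close> is a witness for the norm.\<close>

lemma norm_tr_killer:
  assumes b: "b \<in> carrier R"
  shows "(\<Otimes>g\<in>carrier H. \<rho> g (tr I b)) \<in> killer"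
proof -
  define a where "a = tr I b"
  have af: "a \<in> fixset I" and ac: "a \<in> carrier R"
    using tr_fixed[OF I b] fixset_carr unfolding a_def by auto
  define y where "y = (\<Otimes>g\<in>carrier H - I. \<rho> g a)"
  have yf: "y \<in> fixset I" unfolding y_def
    by (rule norm_fixed_on[OF _ subgroup_subset[OF I] bij_left_mult_compl[OF I] ac]) auto
  have yc: "y \<in> carrier R" using yf fixset_carr by blast
  have finI: "finite I" by (rule finite_subgroup[OF I])
  have "carrier H = I \<union> (carrier H - I)" using subgroup_subset[OF I] by blast
  then have "(\<Otimes>g\<in>carrier H. \<rho> g a) = (\<Otimes>g\<in>I \<union> (carrier H - I). \<rho> g a)" by simp
  also have "\<dots> = (\<Otimes>g\<in>I. \<rho> g a) \<otimes> y"
    unfolding y_def using finI finite_H ac I_carr by (intro finprod_Un_disjoint) auto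
  also have "(\<Otimes>g\<in>I. \<rho> g a) = (\<Otimes>g\<in>I. a)"
    by (rule prod_cong) (use af ac fixsetD in auto)
  also have "\<dots> = a [^] card I" using ac by (rule finprod_const)
  finally have N: "(\<Otimes>g\<in>carrier H. \<rho> g a) = a [^] card I \<otimes> y" .
  have "card I > 0" using finI subgroup.one_closed[OF I] card_gt_0_iff by blast
  then obtain n where n: "card I = Suc n" using gr0_implies_Suc by blast
  define z where "z = a [^] n \<otimes> y"
  have zf: "z \<in> fixset I" unfolding z_def
    by (intro fixset_mult fixset_pow subgroup_subset[OF I] af yf)
  have zc: "z \<in> carrier R" using zf fixset_carr by blast
  have Nz: "(\<Otimes>g\<in>carrier H. \<rho> g a) = z \<otimes> a" using N n ac yc by (simp add: z_def m_ac)
  obtain \<beta> where \<beta>: "\<beta> \<in> carrier R" "\<And>g. g \<in> I \<Longrightarrow> \<rho> g \<beta> = \<beta> \<oplus> a \<otimes> c g"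
    using tr_kills[OF b] unfolding a_def by blast
  have "\<rho> g (z \<otimes> \<beta>) = z \<otimes> \<beta> \<oplus> (z \<otimes> a) \<otimes> c g" if "g \<in> I" for g
    using \<beta> that zc ac I_carr c_carr fixsetD[OF zf that] by (simp add: act_mult r_distr m_assoc)
  moreover have "(\<Otimes>g\<in>carrier H. \<rho> g a) \<in> fixset (carrier H)"
    by (rule norm_fixed[OF H.subgroup_self ac])
  ultimately show ?thesis
    using zc \<beta>(1) unfolding killer_def a_def[symmetric] Nz by auto
qed

context
  assumes no_reflection: "\<And>Q. primeideal Q R \<Longrightarrow> height R Q \<le> 2 \<Longrightarrow> inertia Q = {\<one>\<^bsub>H\<^esub>}"
begin

text \<open>Otherwise every trace from \<open>I\<close> would have its norm in \<open>Q\<close> and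
  so lie in some conjugate of \<open>Q\<close>. Prime avoidance in the ring of
  \<open>I\<close>-invariants puts all traces into one conjugate, whose inertia group is trivial
  because its height is also at most 2.\<close>

lemma killer_not_in_small_prime:
  assumes Q: "primeideal Q R" "height R Q \<le> 2"
  shows "\<not> killer \<subseteq> Q"
proof
  assume sub: "killer \<subseteq> Q"
  have IH: "I \<subseteq> carrier H" by (rule subgroup_subset[OF I])
  have QR: "Q \<subseteq> carrier R" using ideal_carr[OF primeideal.axioms(1)[OF Q(1)]] by blast
  interpret F: cring "fixring I" by (rule cring_fixring[OF IH])
  let ?F = "(\<lambda>g. pull g Q \<inter> fixset I) ` carrier H"
  have "tr I ` carrier R \<subseteq> \<Union>?F"
  proof
    fix a assume "a \<in> tr I ` carrier R"
    then obtain b where b: "b \<in> carrier R" "a = tr I b" by blast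
    have af: "a \<in> fixset I" "a \<in> carrier R" using tr_fixed[OF I b(1)] fixset_carr b(2) by auto
    have "(\<Otimes>g\<in>carrier H. \<rho> g a) \<in> Q" using norm_tr_killer[OF b(1)] b(2) sub by blast
    then obtain g where "g \<in> carrier H" "\<rho> g a \<in> Q"
      using prime_finprod[OF Q(1) finite_H, of "\<lambda>g. \<rho> g a"] af by auto
    then show "a \<in> \<Union>?F" using af by (auto simp: pull_def)
  qed
  then have "\<exists>Q'\<in>?F. tr I ` carrier R \<subseteq> Q'"
    using finite_H prime_contract[OF IH prime_pull[OF _ Q(1)]]
    by (intro F.prime_avoidance[OF ideal_range_tr[OF I]]) auto
  then obtain g where g: "g \<in> carrier H" "tr I ` carrier R \<subseteq> pull g Q" by blast
  have "height R (pull g Q) \<le> 2" using height_pull[OF g(1) QR] Q(2) by (rule order_trans)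
  then have "inertia (pull g Q) = {\<one>\<^bsub>H\<^esub>}" by (rule no_reflection[OF prime_pull[OF g(1) Q(1)]])
  then have "\<exists>b\<in>carrier R. tr I b \<notin> pull g Q"
    by (intro tr_not_in_prime[OF I prime_pull[OF g(1) Q(1)]]) simp
  then show False using g(2) by blast
qed

text \<open>Primes of two rings are avoided at once. Those of \<open>R\<close> are contracted to the
  invariants; for those of the invariants a prime of \<open>R\<close> above is taken, whose height
  is at most 2 by \<open>height_contract\<close>.\<close>

lemma killer_avoids:
  assumes F1: "finite F1" "\<And>q. q \<in> F1 \<Longrightarrow> primeideal q (fixring (carrier H)) \<and> height (fixring (carrier H)) q \<le> 2"
    and F2: "finite F2" "\<And>Q. Q \<in> F2 \<Longrightarrow> primeideal Q R \<and> height R Q \<le> 2"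
  obtains x where "x \<in> killer" "x \<notin> \<Union>F1" "x \<notin> \<Union>F2"
proof -
  interpret F: cring "fixring (carrier H)" by (rule cring_fixring) simp
  let ?F = "F1 \<union> (\<lambda>Q. Q \<inter> fixset (carrier H)) ` F2"
  have kf: "killer \<subseteq> fixset (carrier H)" by (auto simp: killer_def)
  have "\<not> killer \<subseteq> q" if q: "q \<in> F1" for q
  proof
    assume sub: "killer \<subseteq> q"
    obtain Q where Q: "primeideal Q R" "Q \<inter> fixset (carrier H) = q" using lying_over F1(2)[OF q] by blast
    have "height R Q \<le> 2" using height_contract[OF Q(1)] F1(2)[OF q] Q(2) by (simp add: order_trans)
    then show False using killer_not_in_small_prime[OF Q(1)] sub Q(2) by blast
  qed
  moreover have "\<not> killer \<subseteq> Q \<inter> fixset (carrier H)" if "Q \<in> F2" for Q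
    using killer_not_in_small_prime F2(2)[OF that] by blast
  ultimately have no: "\<not> (\<exists>q\<in>?F. killer \<subseteq> q)" by blast
  have "primeideal q (fixring (carrier H))" if "q \<in> ?F" for q
    using that F1(2) F2(2) prime_contract[OF subset_refl] by blast
  then have "\<not> killer \<subseteq> \<Union>?F"
    using F.prime_avoidance[OF killer_ideal, of ?F] F1(1) F2(1) no by auto
  then obtain x where x: "x \<in> killer" "x \<notin> \<Union>?F" by blast
  have "x \<notin> \<Union>F1" "x \<notin> \<Union>F2" using x kf by auto
  then show thesis by (rule that[OF x(1)])
qed

end

end

section \<open>Descent from the inertia group\<close>

context ring_action
begin

text \<open>The functions on the group defined by tensors over pairs of \<open>I\<close>-invariants.
  The inductive form spares explicit finite sums, and the rule \<open>agree\<close> disregards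
  values outside the group.\<close>

inductive separable :: "'g set \<Rightarrow> ('g \<Rightarrow> 'a) \<Rightarrow> bool" for I where
  elementary: "y \<in> fixset I \<Longrightarrow> z \<in> fixset I \<Longrightarrow> separable I (\<lambda>g. \<rho> g y \<otimes> z)"
| add: "separable I \<phi> \<Longrightarrow> separable I \<psi> \<Longrightarrow> separable I (\<lambda>g. \<phi> g \<oplus> \<psi> g)"
| agree: "separable I \<phi> \<Longrightarrow> (\<And>g. g \<in> carrier H \<Longrightarrow> \<phi> g = \<psi> g) \<Longrightarrow> separable I \<psi>"

context
  fixes I assumes I: "subgroup I H"
begin

lemma sub_carr: "g \<in> I \<Longrightarrow> g \<in> carrier H"
  using subgroup_subset[OF I] by blast

lemma separable_closed: "separable I \<phi> \<Longrightarrow> g \<in> carrier H \<Longrightarrow> \<phi> g \<in> carrier R"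
proof (induction rule: separable.induct)
  case (agree \<phi> \<psi>)
  then show ?case by metis
qed (auto simp: fixset_carr)

lemma separable_one_fixed: "separable I \<phi> \<Longrightarrow> \<phi> \<one>\<^bsub>H\<^esub> \<in> fixset I"
proof (induction rule: separable.induct)
  case (elementary y z)
  then show ?case using fixset_mult[OF subgroup_subset[OF I]] act_id fixset_carr by simp
next
  case (add \<phi> \<psi>)
  then show ?case using fixset_add[OF subgroup_subset[OF I]] by simp
next
  case (agree \<phi> \<psi>)
  then show ?case by simp
qed

lemma separable_const:
  assumes "z \<in> fixset I" shows "separable I (\<lambda>_. z)"
proof (rule separable.agree[OF separable.elementary[OF fixset_one[OF subgroup_subset[OF I]] assms]])
  show "\<rho> g \<one> \<otimes> z = z" if "g \<in> carrier H" for g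
    using that assms fixset_carr by (simp add: act_one)
qed

lemma separable_mult:
  assumes "separable I \<phi>" "separable I \<psi>"
  shows "separable I (\<lambda>g. \<phi> g \<otimes> \<psi> g)"
  using assms(1)
proof (induction rule: separable.induct)
  case (elementary y z)
  show ?case using assms(2)
  proof (induction rule: separable.induct)
    case (elementary y' z')
    have "separable I (\<lambda>g. \<rho> g (y \<otimes> y') \<otimes> (z \<otimes> z'))"
      by (intro separable.elementary fixset_mult subgroup_subset[OF I]) fact+
    then show ?case
    proof (rule separable.agree)
      fix g assume "g \<in> carrier H"
      then show "\<rho> g (y \<otimes> y') \<otimes> (z \<otimes> z') = \<rho> g y \<otimes> z \<otimes> (\<rho> g y' \<otimes> z')"
        using \<open>y \<in> fixset I\<close> \<open>z \<in> fixset I\<close> elementary fixset_carr by (simp add: act_mult m_ac)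
    qed
  next
    case (add \<phi>' \<psi>')
    have c: "\<rho> g y \<otimes> z \<in> carrier R" if "g \<in> carrier H" for g
      using that \<open>y \<in> fixset I\<close> \<open>z \<in> fixset I\<close> fixset_carr by simp
    show ?case
      by (rule separable.agree[OF separable.add[OF add.IH]])
        (use c separable_closed add.hyps in \<open>simp add: r_distr\<close>)
  next
    case (agree \<phi>' \<psi>')
    show ?case by (rule separable.agree[OF agree.IH]) (use agree.hyps in simp)
  qed
next
  case (add \<phi>' \<psi>')
  show ?case
    by (rule separable.agree[OF separable.add[OF add.IH]])
      (use separable_closed add.hyps assms(2) in \<open>simp add: l_distr\<close>)
next
  case (agree \<phi>' \<psi>')
  show ?case by (rule separable.agree[OF agree.IH]) (use agree.hyps in simp)
qed

lemma separable_finprod: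
  assumes "finite K" "\<And>k. k \<in> K \<Longrightarrow> separable I (\<lambda>g. f k g)"
  shows "separable I (\<lambda>g. \<Otimes>k\<in>K. f k g)"
  using assms
proof (induction K rule: finite_induct)
  case empty
  then show ?case using separable_const[OF fixset_one[OF subgroup_subset[OF I]]] by simp
next
  case (insert k K)
  show ?case
  proof (rule separable.agree[OF separable_mult[of "f k" "\<lambda>g. \<Otimes>k\<in>K. f k g"]])
    fix g assume "g \<in> carrier H"
    then show "f k g \<otimes> (\<Otimes>k\<in>K. f k g) = (\<Otimes>k\<in>Set.insert k K. f k g)"
      using insert separable_closed by (intro finprod_insert[symmetric]) auto
  qed (use insert in auto)
qed

lemma separable_finsum:
  assumes "finite K" "\<And>k. k \<in> K \<Longrightarrow> separable I (\<lambda>g. f k g)"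
  shows "separable I (\<lambda>g. \<Oplus>k\<in>K. f k g)"
  using assms
proof (induction K rule: finite_induct)
  case empty
  then show ?case using separable_const[OF fixset_zero[OF subgroup_subset[OF I]]] by simp
next
  case (insert k K)
  show ?case
  proof (rule separable.agree[OF separable.add[of I "f k" "\<lambda>g. \<Oplus>k\<in>K. f k g"]])
    fix g assume "g \<in> carrier H"
    then show "f k g \<oplus> (\<Oplus>k\<in>K. f k g) = (\<Oplus>k\<in>Set.insert k K. f k g)"
      using insert separable_closed by (intro finsum_insert[symmetric]) auto
  qed (use insert in auto)
qed

section \<open>Transfer along the left cosets of the subgroup\<close>

definition cosets :: "'g set set" where
  "cosets = (\<lambda>g. g <#\<^bsub>H\<^esub> I) ` carrier H"

text \<open>This depends on the choice of representatives unless \<open>f\<close> is constant on left cosets.\<close>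

definition cosum :: "('g \<Rightarrow> 'a) \<Rightarrow> 'a" where
  "cosum f = (\<Oplus>Y\<in>cosets. f (SOME g. g \<in> Y))"

lemma coset_rep:
  assumes Y: "Y \<in> cosets"
  shows "(SOME g. g \<in> Y) \<in> carrier H" "Y = (SOME g. g \<in> Y) <#\<^bsub>H\<^esub> I"
proof -
  obtain g where g: "g \<in> carrier H" "Y = g <#\<^bsub>H\<^esub> I" using Y unfolding cosets_def by blast
  have "g \<otimes>\<^bsub>H\<^esub> \<one>\<^bsub>H\<^esub> \<in> Y" unfolding g(2) l_coset_def using subgroup.one_closed[OF I] by blast
  then have r: "(SOME g. g \<in> Y) \<in> Y" by (rule someI)
  then show "(SOME g. g \<in> Y) \<in> carrier H"
    unfolding g(2) using H.l_coset_subset_G[OF subgroup_subset[OF I] g(1)] by blast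
  show "Y = (SOME g. g \<in> Y) <#\<^bsub>H\<^esub> I"
    using H.l_repr_independence[OF _ g(1) I, of "SOME g. g \<in> Y"] r g(2) by simp
qed

lemma coset_constant:
  assumes f: "\<And>g i. g \<in> carrier H \<Longrightarrow> i \<in> I \<Longrightarrow> f (g \<otimes>\<^bsub>H\<^esub> i) = f g"
    and "g \<in> carrier H" "h \<in> carrier H" "g <#\<^bsub>H\<^esub> I = h <#\<^bsub>H\<^esub> I"
  shows "f g = f h"
proof -
  have "g \<otimes>\<^bsub>H\<^esub> \<one>\<^bsub>H\<^esub> \<in> g <#\<^bsub>H\<^esub> I"
    unfolding l_coset_def using subgroup.one_closed[OF I] by blast
  then have "g \<in> h <#\<^bsub>H\<^esub> I" using H.r_one[OF assms(2)] assms(4) by simp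
  then obtain i where i: "i \<in> I" "g = h \<otimes>\<^bsub>H\<^esub> i" unfolding l_coset_def by blast
  show ?thesis unfolding i(2) by (rule f[OF assms(3) i(1)])
qed

lemma finite_cosets: "finite cosets"
  unfolding cosets_def using finite_H by simp

text \<open>Left translation permutes the cosets. The representative chosen for a translated coset
  differs from the translated representative by a right factor in \<open>I\<close>, which
  \<open>f\<close> ignores.\<close>

lemma cosum_translate:
  assumes f: "\<And>g i. g \<in> carrier H \<Longrightarrow> i \<in> I \<Longrightarrow> f (g \<otimes>\<^bsub>H\<^esub> i) = f g"
    and fc: "\<And>g. g \<in> carrier H \<Longrightarrow> f g \<in> carrier R" and h: "h \<in> carrier H"
  shows "cosum (\<lambda>g. f (h \<otimes>\<^bsub>H\<^esub> g)) = cosum f"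
proof -
  let ?r = "\<lambda>Y. SOME g. g \<in> Y"
  let ?t = "\<lambda>Y. h <#\<^bsub>H\<^esub> Y"
  have assoc: "k <#\<^bsub>H\<^esub> (g <#\<^bsub>H\<^esub> I) = (k \<otimes>\<^bsub>H\<^esub> g) <#\<^bsub>H\<^esub> I" if "k \<in> carrier H" "g \<in> carrier H" for k g
    using H.lcos_m_assoc[OF subgroup_subset[OF I] that] .
  have bij: "bij_betw ?t cosets cosets"
  proof (rule bij_betwI[where g = "\<lambda>Y. inv\<^bsub>H\<^esub> h <#\<^bsub>H\<^esub> Y"])
    show "?t \<in> cosets \<rightarrow> cosets" "(\<lambda>Y. inv\<^bsub>H\<^esub> h <#\<^bsub>H\<^esub> Y) \<in> cosets \<rightarrow> cosets"
      using h by (auto simp: cosets_def assoc)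
    fix Y assume "Y \<in> cosets"
    then show "inv\<^bsub>H\<^esub> h <#\<^bsub>H\<^esub> (h <#\<^bsub>H\<^esub> Y) = Y" "h <#\<^bsub>H\<^esub> (inv\<^bsub>H\<^esub> h <#\<^bsub>H\<^esub> Y) = Y"
      using h by (auto simp: cosets_def assoc H.m_assoc[symmetric])
  qed
  then have im: "?t ` cosets = cosets" and inj: "inj_on ?t cosets" by (auto simp: bij_betw_def)
  have "cosum f = (\<Oplus>Y\<in>?t ` cosets. f (?r Y))" unfolding cosum_def im ..
  also have "\<dots> = (\<Oplus>Y\<in>cosets. f (?r (?t Y)))"
    by (rule finsum_reindex[OF _ inj]) (use im fc coset_rep in auto)
  also have "\<dots> = cosum (\<lambda>g. f (h \<otimes>\<^bsub>H\<^esub> g))"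
    unfolding cosum_def
  proof (rule sum_cong)
    fix Y assume Y: "Y \<in> cosets"
    have tY: "?t Y \<in> cosets" using Y im by blast
    have hr: "h \<otimes>\<^bsub>H\<^esub> ?r Y \<in> carrier H" using h coset_rep(1)[OF Y] by simp
    have "?r (?t Y) <#\<^bsub>H\<^esub> I = ?t Y" using coset_rep(2)[OF tY] by simp
    also have "\<dots> = h <#\<^bsub>H\<^esub> (?r Y <#\<^bsub>H\<^esub> I)" using coset_rep(2)[OF Y] by simp
    also have "\<dots> = (h \<otimes>\<^bsub>H\<^esub> ?r Y) <#\<^bsub>H\<^esub> I" by (rule assoc[OF h coset_rep(1)[OF Y]])
    finally show "f (?r (?t Y)) = f (h \<otimes>\<^bsub>H\<^esub> ?r Y)"
      by (intro coset_constant[of f, OF f coset_rep(1)[OF tY] hr])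
    show "f (h \<otimes>\<^bsub>H\<^esub> ?r Y) \<in> carrier R" by (rule fc[OF hr])
  qed
  finally show ?thesis by simp
qed

lemma cosum_act_fixed:
  assumes u: "u \<in> fixset I"
  shows "cosum (\<lambda>g. \<rho> g u) \<in> fixset (carrier H)"
proof (rule fixsetI)
  have uc: "u \<in> carrier R" using u fixset_carr by blast
  show "cosum (\<lambda>g. \<rho> g u) \<in> carrier R"
    unfolding cosum_def using coset_rep(1) uc by (intro finsum_closed) auto
  fix h assume h: "h \<in> carrier H"
  have "\<rho> h (cosum (\<lambda>g. \<rho> g u)) = (\<Oplus>Y\<in>cosets. \<rho> h (\<rho> (SOME g. g \<in> Y) u))"
    unfolding cosum_def using coset_rep(1) uc h by (intro act_finsum) auto
  also have "\<dots> = cosum (\<lambda>g. \<rho> (h \<otimes>\<^bsub>H\<^esub> g) u)"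
    unfolding cosum_def by (rule sum_cong) (use coset_rep(1) uc h act_comp in auto)
  also have "\<dots> = cosum (\<lambda>g. \<rho> g u)"
  proof (rule cosum_translate[OF _ _ h])
    fix g i assume "g \<in> carrier H" "i \<in> I"
    then show "\<rho> (g \<otimes>\<^bsub>H\<^esub> i) u = \<rho> g u" using act_comp[OF _ sub_carr uc] fixsetD[OF u] by simp
  qed (use uc in simp)
  finally show "\<rho> h (cosum (\<lambda>g. \<rho> g u)) = cosum (\<lambda>g. \<rho> g u)" .
qed

text \<open>Only the coset \<open>I\<close> itself contributes, and \<open>f\<close> is constant on
  it.\<close>

lemma cosum_supported:
  assumes fc: "\<And>g. g \<in> carrier H \<Longrightarrow> f g \<in> carrier R"
    and f: "\<And>g i. g \<in> carrier H \<Longrightarrow> i \<in> I \<Longrightarrow> f (g \<otimes>\<^bsub>H\<^esub> i) = f g"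
    and zero: "\<And>g. g \<in> carrier H \<Longrightarrow> g \<notin> I \<Longrightarrow> f g = \<zero>"
  shows "cosum f = f \<one>\<^bsub>H\<^esub>"
proof -
  have one: "\<one>\<^bsub>H\<^esub> <#\<^bsub>H\<^esub> I = I" using H.lcos_mult_one[OF subgroup_subset[OF I]] .
  then have IK: "I \<in> cosets" unfolding cosets_def by (intro image_eqI[of _ _ "\<one>\<^bsub>H\<^esub>"]) auto
  have z: "f (SOME g. g \<in> Y) = \<zero>" if Y: "Y \<in> cosets - {I}" for Y
  proof (rule zero)
    show "(SOME g. g \<in> Y) \<in> carrier H" using coset_rep(1) Y by blast
    show "(SOME g. g \<in> Y) \<notin> I"
    proof
      assume r: "(SOME g. g \<in> Y) \<in> I"
      then have "(SOME g. g \<in> Y) <#\<^bsub>H\<^esub> I = I"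
        using H.l_repr_independence[of "SOME g. g \<in> Y" "\<one>\<^bsub>H\<^esub>" I] one I by simp
      then show False using coset_rep(2)[of Y] Y by blast
    qed
  qed
  have "cosum f = (\<Oplus>Y\<in>Set.insert I (cosets - {I}). f (SOME g. g \<in> Y))"
    unfolding cosum_def using IK by (simp add: insert_absorb)
  also have "\<dots> = f (SOME g. g \<in> I) \<oplus> (\<Oplus>Y\<in>cosets - {I}. f (SOME g. g \<in> Y))"
    using finite_cosets fc coset_rep(1) IK by (intro finsum_insert) auto
  also have "(\<Oplus>Y\<in>cosets - {I}. f (SOME g. g \<in> Y)) = \<zero>"
    by (rule add.finprod_one_eqI) (use z in simp)
  also have "f (SOME g. g \<in> I) = f \<one>\<^bsub>H\<^esub>"
    by (rule coset_constant[of f, OF f coset_rep(1)[OF IK] H.one_closed]) (assumption | rule trans[OF coset_rep(2)[OF IK, symmetric] one[symmetric]])+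
  finally show ?thesis using fc by simp
qed

text \<open>The sum over the cosets of g(u) times \<open>\<phi> g\<close> is evaluated twice. The
  support condition leaves the term at the identity; a summand g(y) z of \<open>\<phi>\<close>
  contributes z times the transfer of u y, which lies in \<open>D\<close>.\<close>

lemma separable_descent:
  assumes sep: "separable I \<phi>" and zero: "\<And>g. g \<in> carrier H \<Longrightarrow> g \<notin> I \<Longrightarrow> \<phi> g = \<zero>"
    and u: "u \<in> fixset I" and D: "ideal D (fixring I)"
    and T: "\<And>y. y \<in> fixset I \<Longrightarrow> cosum (\<lambda>g. \<rho> g (u \<otimes> y)) \<in> D"
  shows "u \<otimes> \<phi> \<one>\<^bsub>H\<^esub> \<in> D"
proof -
  interpret F: cring "fixring I" by (rule cring_fixring[OF subgroup_subset[OF I]])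
  have uc: "u \<in> carrier R" using u fixset_carr by blast
  have gen: "cosum (\<lambda>g. \<rho> g u \<otimes> \<psi> g) \<in> D" if "separable I \<psi>" for \<psi>
    using that
  proof (induction rule: separable.induct)
    case (elementary y z)
    have yz: "y \<in> carrier R" "z \<in> carrier R" using elementary fixset_carr by auto
    have "cosum (\<lambda>g. \<rho> g u \<otimes> (\<rho> g y \<otimes> z)) = (\<Oplus>Y\<in>cosets. z \<otimes> \<rho> (SOME g. g \<in> Y) (u \<otimes> y))"
      unfolding cosum_def by (rule sum_cong) (use coset_rep(1) uc yz in \<open>auto simp: act_mult m_ac\<close>)
    also have "\<dots> = z \<otimes> cosum (\<lambda>g. \<rho> g (u \<otimes> y))"
      unfolding cosum_def using finite_cosets coset_rep(1) uc yz by (intro finsum_rdistr[symmetric]) auto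
    finally show ?case using F.ideal_mult[OF D T[OF elementary(1)]] elementary(2) by simp
  next
    case (add \<phi> \<psi>)
    have c: "\<phi> g \<in> carrier R" "\<psi> g \<in> carrier R" if "g \<in> carrier H" for g
      using separable_closed add.hyps that by auto
    have "cosum (\<lambda>g. \<rho> g u \<otimes> (\<phi> g \<oplus> \<psi> g)) =
        (\<Oplus>Y\<in>cosets. \<rho> (SOME g. g \<in> Y) u \<otimes> \<phi> (SOME g. g \<in> Y) \<oplus> \<rho> (SOME g. g \<in> Y) u \<otimes> \<psi> (SOME g. g \<in> Y))"
      unfolding cosum_def by (rule sum_cong) (use coset_rep(1) uc c in \<open>auto simp: r_distr\<close>)
    also have "\<dots> = cosum (\<lambda>g. \<rho> g u \<otimes> \<phi> g) \<oplus> cosum (\<lambda>g. \<rho> g u \<otimes> \<psi> g)"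
      unfolding cosum_def using coset_rep(1) uc c by (intro finsum_addf) auto
    finally show ?case using F.ideal_add[OF D add.IH] by simp
  next
    case (agree \<phi> \<psi>)
    have "cosum (\<lambda>g. \<rho> g u \<otimes> \<psi> g) = cosum (\<lambda>g. \<rho> g u \<otimes> \<phi> g)"
      unfolding cosum_def
      by (rule sum_cong) (use coset_rep(1) uc agree.hyps(2) separable_closed[OF agree.hyps(1)] in force)+
    then show ?case using agree.IH by simp
  qed
  have const: "\<psi> (g \<otimes>\<^bsub>H\<^esub> i) = \<psi> g" if "separable I \<psi>" "g \<in> carrier H" "i \<in> I" for \<psi> g i
    using that
  proof (induction rule: separable.induct)
    case (elementary y z)
    then show ?case using act_comp[OF _ sub_carr] fixsetD fixset_carr by simp
  next
    case (agree \<phi> \<psi>)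
    then show ?case using sub_carr by (metis H.m_closed)
  qed simp
  have "cosum (\<lambda>g. \<rho> g u \<otimes> \<phi> g) = \<rho> \<one>\<^bsub>H\<^esub> u \<otimes> \<phi> \<one>\<^bsub>H\<^esub>"
  proof (rule cosum_supported)
    fix g i assume "g \<in> carrier H" "i \<in> I"
    then show "\<rho> (g \<otimes>\<^bsub>H\<^esub> i) u \<otimes> \<phi> (g \<otimes>\<^bsub>H\<^esub> i) = \<rho> g u \<otimes> \<phi> g"
      using const[OF sep] act_comp[OF _ sub_carr uc] fixsetD[OF u] by simp
  qed (use uc zero separable_closed[OF sep] in auto)
  then show ?thesis using gen[OF sep] act_id[OF uc] by simp
qed

end

text \<open>The separating function is a product over \<open>\<gamma> \<notin> inertia P\<close> of
  \<open>\<lambda>g. \<Prod>h. h \<gamma> b - g b\<close>, where \<open>b\<close> is moved by \<open>\<gamma>\<close> modulo \<open>P\<close> and \<open>h\<close> runs through the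
  inertia group; this makes the coefficients invariant.\<close>

lemma separable_inertia:
  assumes P: "primeideal P R"
  obtains \<phi> where "separable (inertia P) \<phi>" "\<phi> \<one>\<^bsub>H\<^esub> \<notin> P"
    "\<And>g. g \<in> carrier H \<Longrightarrow> g \<notin> inertia P \<Longrightarrow> \<phi> g = \<zero>"
proof -
  define I where "I = inertia P"
  have idP: "ideal P R" using P by (rule primeideal.axioms(1))
  have I: "subgroup I H" unfolding I_def by (rule inertia_subgroup[OF idP])
  have finI: "finite I" by (rule finite_subgroup[OF I])
  have Ic: "g \<in> carrier H" if "g \<in> I" for g using subgroup_subset[OF I] that by blast
  have one_factor: "\<exists>\<phi>. separable I \<phi> \<and> \<phi> \<one>\<^bsub>H\<^esub> \<notin> P \<and> \<phi> \<gamma> = \<zero>" if \<gamma>: "\<gamma> \<in> carrier H" "\<gamma> \<notin> I" for \<gamma>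
  proof -
    \<comment> \<open>An \<open>I\<close>-invariant element moved by \<open>\<gamma>\<close> modulo
      \<open>P\<close> must exist, since otherwise \<open>\<gamma>\<close> would belong to
      \<open>I\<close>.\<close>
    obtain b where b: "b \<in> fixset I" "\<rho> \<gamma> b \<ominus> b \<notin> P"
      using mem_of_trivial_on_fixset[OF I P _ \<gamma>(1)] \<gamma>(2) by (auto simp: I_def inertia_def)
    have bc: "b \<in> carrier R" using b fixset_carr by blast
    define y where "y h = \<rho> h (\<rho> \<gamma> b)" for h
    have y: "y \<in> I \<rightarrow> carrier R" unfolding y_def using Ic \<gamma>(1) bc by auto
    have yf: "esym I y j \<in> fixset I" for j unfolding y_def
      by (rule esym_fixed[OF I]) (use \<gamma>(1) bc in simp)
    let ?\<phi> = "\<lambda>g. \<Otimes>h\<in>I. \<ominus> \<rho> g b \<oplus> y h"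
    \<comment> \<open>The product is expanded in powers of -g(b). The coefficients are symmetric
      functions of the \<open>I\<close>-translates of \<open>\<rho> \<gamma> b\<close>, hence fixed
      by \<open>I\<close>, so every term is elementary.\<close>
    have "separable I (\<lambda>g. \<Oplus>j\<in>{..card I}. \<rho> g ((\<ominus> b) [^] (card I - j)) \<otimes> esym I y j)"
      by (intro separable_finsum[OF I] separable.elementary yf fixset_pow fixset_uminus subgroup_subset[OF I] b) simp
    then have "separable I ?\<phi>"
    proof (rule separable.agree)
      fix g assume "g \<in> carrier H"
      then show "(\<Oplus>j\<in>{..card I}. \<rho> g ((\<ominus> b) [^] (card I - j)) \<otimes> esym I y j) = ?\<phi> g"
        using finprod_add_expand[OF finI _ y, of "\<ominus> \<rho> g b"] bc by (simp add: act_pow act_uminus)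
    qed
    moreover have "?\<phi> \<one>\<^bsub>H\<^esub> \<notin> P"
    proof
      assume inP: "?\<phi> \<one>\<^bsub>H\<^esub> \<in> P"
      have "(\<lambda>h. \<ominus> \<rho> \<one>\<^bsub>H\<^esub> b \<oplus> y h) \<in> I \<rightarrow> carrier R"
        using funcset_mem[OF y] bc by simp
      then obtain h where h: "h \<in> I" "\<ominus> \<rho> \<one>\<^bsub>H\<^esub> b \<oplus> y h \<in> P"
        using prime_finprod[OF P finI _ inP] by blast
      have "\<ominus> \<rho> \<one>\<^bsub>H\<^esub> b \<oplus> y h = \<rho> h (\<rho> \<gamma> b \<ominus> b)"
        using act_id[OF bc] fixsetD[OF b(1) h(1)] Ic[OF h(1)] \<gamma>(1) bc
        by (simp add: y_def act_diff) (simp add: a_minus_def a_comm)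
      \<comment> \<open>Elements of the inertia group preserve membership in \<open>P\<close>, so
        \<open>h\<close> can be removed.\<close>
      then have "\<rho> \<gamma> b \<ominus> b \<in> P"
        using h inertia_mem_iff[OF idP, of h "\<rho> \<gamma> b \<ominus> b"] \<gamma>(1) bc by (simp add: I_def)
      then show False using b(2) by blast
    qed
    moreover have "?\<phi> \<gamma> \<in> {\<zero>}"
    proof (rule ideal_finprod[OF zeroideal finI _ subgroup.one_closed[OF I]])
      show "(\<lambda>h. \<ominus> \<rho> \<gamma> b \<oplus> y h) \<in> I \<rightarrow> carrier R" using y \<gamma>(1) bc by auto
      show "\<ominus> \<rho> \<gamma> b \<oplus> y \<one>\<^bsub>H\<^esub> \<in> {\<zero>}" using \<gamma>(1) bc by (simp add: y_def act_id l_neg)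
    qed
    ultimately show ?thesis by (intro exI[of _ ?\<phi>]) simp
  qed
  define f where "f \<gamma> = (SOME \<phi>. separable I \<phi> \<and> \<phi> \<one>\<^bsub>H\<^esub> \<notin> P \<and> \<phi> \<gamma> = \<zero>)" for \<gamma>
  have f: "separable I (f \<gamma>)" "f \<gamma> \<one>\<^bsub>H\<^esub> \<notin> P" "f \<gamma> \<gamma> = \<zero>" if "\<gamma> \<in> carrier H - I" for \<gamma>
    using someI_ex[OF one_factor[of \<gamma>]] that unfolding f_def by auto
  let ?\<Phi> = "\<lambda>g. \<Otimes>\<gamma>\<in>carrier H - I. f \<gamma> g"
  have fin: "finite (carrier H - I)" using finite_H by simp
  have fc: "(\<lambda>\<gamma>. f \<gamma> g) \<in> carrier H - I \<rightarrow> carrier R" if "g \<in> carrier H" for g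
    using separable_closed[OF I f(1)] that by blast
  have "separable I ?\<Phi>" by (rule separable_finprod[OF I fin]) (rule f(1))
  moreover have "?\<Phi> \<one>\<^bsub>H\<^esub> \<notin> P"
    using prime_finprod[OF P fin fc[OF H.one_closed]] f(2) by blast
  moreover have "?\<Phi> g = \<zero>" if g: "g \<in> carrier H" "g \<notin> I" for g
  proof -
    have "?\<Phi> g \<in> {\<zero>}"
      by (rule ideal_finprod[OF zeroideal fin fc[OF g(1)], of g]) (use g f(3) in auto)
    then show ?thesis by simp
  qed
  ultimately show thesis using that unfolding I_def by blast
qed

end

lemma (in cring) add_diff_cancel:
  "a \<in> carrier R \<Longrightarrow> b \<in> carrier R \<Longrightarrow> (a \<oplus> b) \<ominus> b = a"
  by (simp add: a_minus_def a_assoc r_neg)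

lemma (in cring) add_cancel_diff:
  assumes "p \<in> carrier R" "q \<in> carrier R" "r \<in> carrier R"
  shows "(p \<oplus> r) \<ominus> (q \<oplus> r) = p \<ominus> q"
proof -
  have "(p \<oplus> r) \<ominus> (q \<oplus> r) = (p \<oplus> \<ominus> q) \<oplus> (r \<oplus> \<ominus> r)"
    using assms by (simp add: a_minus_def minus_add a_ac)
  then show ?thesis using assms by (simp add: r_neg a_minus_def)
qed

lemma (in cring) diff_eq_zero_iff:
  "a \<in> carrier R \<Longrightarrow> b \<in> carrier R \<Longrightarrow> a \<ominus> b = \<zero> \<longleftrightarrow> a = b"
  using r_right_minus_eq by simp

lemma (in cring) cleared_denominators:
  assumes "s \<in> carrier R" "t \<in> carrier R" "a \<in> carrier R" "b \<in> carrier R" "e \<in> carrier R"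
    and "s \<otimes> (t \<otimes> (a \<ominus> b) \<ominus> e) = \<zero>"
  shows "(s \<otimes> t) \<otimes> a = s \<otimes> e \<oplus> (s \<otimes> t) \<otimes> b"
proof -
  have "(s \<otimes> t) \<otimes> a \<ominus> (s \<otimes> e \<oplus> (s \<otimes> t) \<otimes> b) = s \<otimes> (t \<otimes> (a \<ominus> b) \<ominus> e)"
    using assms(1-5) by (simp add: a_minus_def r_distr r_minus minus_add a_ac m_assoc)
  then show ?thesis using assms diff_eq_zero_iff[of "(s \<otimes> t) \<otimes> a" "s \<otimes> e \<oplus> (s \<otimes> t) \<otimes> b"] by simp
qed

context additive_character
begin

lemma cosum_smult:
  assumes "x \<in> fixset (carrier H)" "w \<in> carrier R"
  shows "x \<otimes> cosum I (\<lambda>g. \<rho> g w) = cosum I (\<lambda>g. \<rho> g (x \<otimes> w))"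
proof -
  have x: "x \<in> carrier R" using assms fixset_carr by blast
  have "x \<otimes> cosum I (\<lambda>g. \<rho> g w) = (\<Oplus>Y\<in>cosets I. x \<otimes> \<rho> (SOME g. g \<in> Y) w)"
    unfolding cosum_def[OF I] using finite_cosets[OF I] coset_rep(1)[OF I] x assms(2) by (intro finsum_rdistr) auto
  also have "\<dots> = cosum I (\<lambda>g. \<rho> g (x \<otimes> w))"
    unfolding cosum_def[OF I]
    by (rule sum_cong) (use coset_rep(1)[OF I] x assms(2) fixsetD[OF assms(1)] act_mult in auto)
  finally show ?thesis .
qed

lemma cosum_add:
  assumes "v \<in> carrier R" "w \<in> carrier R"
  shows "cosum I (\<lambda>g. \<rho> g (v \<oplus> w)) = cosum I (\<lambda>g. \<rho> g v) \<oplus> cosum I (\<lambda>g. \<rho> g w)"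
proof -
  have "cosum I (\<lambda>g. \<rho> g (v \<oplus> w)) = (\<Oplus>Y\<in>cosets I. \<rho> (SOME g. g \<in> Y) v \<oplus> \<rho> (SOME g. g \<in> Y) w)"
    unfolding cosum_def[OF I]
    by (rule sum_cong) (use coset_rep(1)[OF I] assms act_add in auto)
  also have "\<dots> = cosum I (\<lambda>g. \<rho> g v) \<oplus> cosum I (\<lambda>g. \<rho> g w)"
    unfolding cosum_def[OF I] using coset_rep(1)[OF I] assms by (intro finsum_addf) auto
  finally show ?thesis .
qed

text \<open>That \<open>c g\<close> lies outside \<open>P\<close> is the nontriviality of the class
  at \<open>P\<close>. All denominators introduced on the way are kept outside \<open>P\<close>, so
  that they cannot absorb the final contradiction.\<close>

lemma not_both_cohen_macaulay:
  assumes cmR: "cohen_macaulay R" and cmC: "cohen_macaulay (fixring (carrier H))"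
    and no_reflection: "\<And>Q. primeideal Q R \<Longrightarrow> height R Q \<le> 2 \<Longrightarrow> inertia Q = {\<one>\<^bsub>H\<^esub>}"
    and P: "primeideal P R" and IP: "I = inertia P" and g: "g \<in> I" "c g \<notin> P"
  shows False
proof -
  define C where "C = fixring (carrier H)"
  define Cs where "Cs = fixset (carrier H)"
  have HH: "carrier H \<subseteq> carrier H" and IH: "I \<subseteq> carrier H" using subgroup_subset[OF I] by auto
  have C_simps [simp]: "carrier C = Cs" "monoid.mult C = monoid.mult R"
    "one C = \<one>" "ring.zero C = \<zero>" "add C = add R" by (simp_all add: C_def Cs_def)
  have C_diff: "a \<ominus>\<^bsub>C\<^esub> b = a \<ominus> b" if "a \<in> Cs" "b \<in> Cs" for a b
    using fixring_diff[OF HH] that by (simp add: C_def Cs_def)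
  have Cs_carr: "a \<in> carrier R" if "a \<in> Cs" for a using that fixset_carr by (simp add: Cs_def)
  have CsI: "a \<in> fixset I" if "a \<in> Cs" for a using that fixset_antimono[OF IH] by (auto simp: Cs_def)
  have Cs_mult: "a \<otimes> b \<in> Cs" if "a \<in> Cs" "b \<in> Cs" for a b using that fixset_mult[OF HH] by (simp add: Cs_def)
  have Cs_diff: "a \<ominus> b \<in> Cs" if "a \<in> Cs" "b \<in> Cs" for a b using that fixset_diff[OF HH] by (simp add: Cs_def)
  have idP: "ideal P R" using P by (rule primeideal.axioms(1))
  interpret F: cring C unfolding C_def by (rule cring_fixring[OF HH])
  \<comment> \<open>The Cohen-Macaulay condition speaks of maximal ideals, so \<open>P\<close> and
    its contraction are enlarged to maximal ideals of the two rings separately. What connects them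
    is that elements of \<open>R\<close> outside \<open>M\<close>, and invariants outside
    \<open>m\<close>, are outside \<open>P\<close>.\<close>
  obtain M where M: "maximalideal M R" "P \<subseteq> M"
    using maximalideal_exists[OF idP prime_one_notin[OF P]] .
  have pp: "primeideal (P \<inter> Cs) C" using prime_contract[OF HH P] by (simp add: C_def Cs_def)
  obtain m where m: "maximalideal m C" "P \<inter> Cs \<subseteq> m"
    using F.maximalideal_exists[OF primeideal.axioms(1)[OF pp] F.prime_one_notin[OF pp]] .
  interpret LR: localized_ring R M
    by (intro localized_ring.intro localized_ring_axioms.intro cring_axioms maximalideal_prime[OF M(1)])
  interpret LC: localized_ring C m
    by (intro localized_ring.intro localized_ring_axioms.intro F.cring_axioms F.maximalideal_prime[OF m(1)])
  have kCs: "x \<in> Cs" if "x \<in> killer" for x using that by (simp add: killer_def Cs_def)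
  \<comment> \<open>A killing element times \<open>c g\<close> is a value of g - 1 and hence lies in
    \<open>P\<close>. So all of \<open>killer\<close> lies in \<open>P\<close> and can be used in
    both local rings.\<close>
  have kP: "x \<in> P" if x: "x \<in> killer" for x
  proof -
    have xc: "x \<in> carrier R" using kCs[OF x] Cs_carr by blast
    obtain \<beta> where \<beta>: "\<beta> \<in> carrier R" "\<rho> g \<beta> = \<beta> \<oplus> x \<otimes> c g" using x g(1) unfolding killer_def by blast
    have "\<rho> g \<beta> \<ominus> \<beta> \<in> P" using g(1) \<beta>(1) by (simp add: IP inertia_def)
    moreover have "\<rho> g \<beta> \<ominus> \<beta> = x \<otimes> c g"
      using \<beta> xc c_carr[OF g(1)] add_diff_cancel[of "x \<otimes> c g" \<beta>] by (simp add: a_comm)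
    ultimately have "x \<otimes> c g \<in> P" by simp
    then show ?thesis using primeideal.I_prime[OF P xc c_carr[OF g(1)]] g(2) by blast
  qed
  have kM: "x \<in> M" if "x \<in> killer" for x using kP[OF that] M(2) by blast
  have km: "x \<in> m" if "x \<in> killer" for x using kP[OF that] kCs[OF that] m(2) by blast
  have le2: "h \<le> 2" if "h \<le> enat n" "n \<le> 2" for h n
    using that by (metis enat_ord_simps(1) numeral_eq_enat order_trans)
  \<comment> \<open>A single element of \<open>killer\<close> prolongs two given regular sequences,
    one on each ring.\<close>
  have pick: "\<exists>x\<in>killer. LR.nzd (LR.adjs LR.zero_sat xs) x \<and> LC.nzd (LC.adjs LC.zero_sat ys) x"
    if xs: "LR.regular LR.zero_sat xs" "set xs \<subseteq> killer" "length xs \<le> 2"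
      and ys: "LC.regular LC.zero_sat ys" "set ys \<subseteq> killer" "length ys \<le> 2" for xs ys
  proof -
    obtain F2 where F2: "finite F2" "\<And>Q. Q \<in> F2 \<Longrightarrow> primeideal Q R \<and> height R Q \<le> enat (length xs)"
      "\<And>x. x \<in> carrier R \<Longrightarrow> x \<notin> \<Union>F2 \<Longrightarrow> LR.nzd (LR.adjs LR.zero_sat xs) x"
      using cohen_macaulay_nzd[OF cmR M(1) xs(1)] xs(2) kM by (metis subset_iff)
    obtain F1 where F1: "finite F1" "\<And>Q. Q \<in> F1 \<Longrightarrow> primeideal Q C \<and> height C Q \<le> enat (length ys)"
      "\<And>x. x \<in> carrier C \<Longrightarrow> x \<notin> \<Union>F1 \<Longrightarrow> LC.nzd (LC.adjs LC.zero_sat ys) x"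
      using cohen_macaulay_nzd[OF cmC[folded C_def] m(1) ys(1)] ys(2) km by (metis subset_iff)
    obtain x where x: "x \<in> killer" "x \<notin> \<Union>F1" "x \<notin> \<Union>F2"
    proof (rule killer_avoids[OF no_reflection F1(1) _ F2(1)])
      show "primeideal q (fixring (carrier H)) \<and> height (fixring (carrier H)) q \<le> 2" if "q \<in> F1" for q
        using F1(2)[OF that] le2[OF _ ys(3)] by (simp add: C_def)
      show "primeideal Q R \<and> height R Q \<le> 2" if "Q \<in> F2" for Q
        using F2(2)[OF that] le2[OF _ xs(3)] by simp
    qed
    have "LR.nzd (LR.adjs LR.zero_sat xs) x" by (rule F2(3)[OF Cs_carr[OF kCs[OF x(1)]] x(3)])
    moreover have "LC.nzd (LC.adjs LC.zero_sat ys) x" by (rule F1(3)[OF _ x(2)]) (simp add: kCs[OF x(1)])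
    ultimately show ?thesis using x(1) by blast
  qed
  obtain x1 where x1: "x1 \<in> killer" "LR.nzd LR.zero_sat x1" "LC.nzd LC.zero_sat x1"
    using pick[of "[]" "[]"] by auto
  obtain x2 where x2: "x2 \<in> killer" "LR.nzd (LR.adj LR.zero_sat x1) x2" "LC.nzd (LC.adj LC.zero_sat x1) x2"
    using pick[of "[x1]" "[x1]"] x1 by auto
  \<comment> \<open>Regularity of the third element after \<open>x1\<close> and \<open>x2\<close> is
    wanted on the invariants; on \<open>R\<close> the empty sequence is passed.\<close>
  obtain x3 where x3: "x3 \<in> killer" "LC.nzd (LC.adj (LC.adj LC.zero_sat x1) x2) x3"
    using pick[of "[]" "[x1, x2]"] x1 x2 by auto
  have xC: "x1 \<in> Cs" "x2 \<in> Cs" "x3 \<in> Cs" using kCs x1 x2 x3 by auto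
  have xc: "x1 \<in> carrier R" "x2 \<in> carrier R" "x3 \<in> carrier R" using Cs_carr xC by auto
  obtain b1 where b1: "b1 \<in> carrier R" "\<And>g. g \<in> I \<Longrightarrow> \<rho> g b1 = b1 \<oplus> x1 \<otimes> c g" using x1(1) unfolding killer_def by blast
  obtain b2 where b2: "b2 \<in> carrier R" "\<And>g. g \<in> I \<Longrightarrow> \<rho> g b2 = b2 \<oplus> x2 \<otimes> c g" using x2(1) unfolding killer_def by blast
  obtain b3 where b3: "b3 \<in> carrier R" "\<And>g. g \<in> I \<Longrightarrow> \<rho> g b3 = b3 \<oplus> x3 \<otimes> c g" using x3(1) unfolding killer_def by blast
  \<comment> \<open>Both products acquire the same term x x' c(h), which cancels in the
    difference.\<close>
  have u_fixed: "x \<otimes> b' \<ominus> x' \<otimes> b \<in> fixset I"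
    if x: "x \<in> Cs" "x' \<in> Cs" and b: "b \<in> carrier R" "b' \<in> carrier R"
      "\<And>g. g \<in> I \<Longrightarrow> \<rho> g b = b \<oplus> x \<otimes> c g" "\<And>g. g \<in> I \<Longrightarrow> \<rho> g b' = b' \<oplus> x' \<otimes> c g" for x x' b b'
  proof (rule fixsetI)
    have xx: "x \<in> carrier R" "x' \<in> carrier R" using x Cs_carr by auto
    show "x \<otimes> b' \<ominus> x' \<otimes> b \<in> carrier R" using xx b by simp
    fix h assume h: "h \<in> I"
    have "\<rho> h (x \<otimes> b' \<ominus> x' \<otimes> b) = x \<otimes> (b' \<oplus> x' \<otimes> c h) \<ominus> x' \<otimes> (b \<oplus> x \<otimes> c h)"
      using I_carr[OF h] xx b(1,2) b(3)[OF h] b(4)[OF h] fixsetD[OF CsI[OF x(1)] h] fixsetD[OF CsI[OF x(2)] h]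
      by (simp add: act_diff act_mult)
    also have "\<dots> = x \<otimes> b' \<ominus> x' \<otimes> b"
    proof -
      have "x \<otimes> (b' \<oplus> x' \<otimes> c h) = x \<otimes> b' \<oplus> x \<otimes> (x' \<otimes> c h)" "x' \<otimes> (b \<oplus> x \<otimes> c h) = x' \<otimes> b \<oplus> x \<otimes> (x' \<otimes> c h)"
        using xx b(1,2) c_carr[OF h] by (simp_all add: r_distr m_ac)
      then show ?thesis using xx b(1,2) c_carr[OF h] by (simp add: add_cancel_diff)
    qed
    finally show "\<rho> h (x \<otimes> b' \<ominus> x' \<otimes> b) = x \<otimes> b' \<ominus> x' \<otimes> b" .
  qed
  define u12 where "u12 = x1 \<otimes> b2 \<ominus> x2 \<otimes> b1"
  define u13 where "u13 = x1 \<otimes> b3 \<ominus> x3 \<otimes> b1"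
  define u23 where "u23 = x2 \<otimes> b3 \<ominus> x3 \<otimes> b2"
  have uf: "u12 \<in> fixset I" "u13 \<in> fixset I" "u23 \<in> fixset I"
    unfolding u12_def u13_def u23_def
    using u_fixed[OF xC(1,2) b1(1) b2(1) b1(2) b2(2)] u_fixed[OF xC(1,3) b1(1) b3(1) b1(2) b3(2)]
      u_fixed[OF xC(2,3) b2(1) b3(1) b2(2) b3(2)] by auto
  have uc: "u12 \<in> carrier R" "u13 \<in> carrier R" "u23 \<in> carrier R" using uf fixset_carr by auto
  have koszul: "x3 \<otimes> u12 \<oplus> x1 \<otimes> u23 = x2 \<otimes> u13"
  proof -
    let ?a = "x1 \<otimes> (x3 \<otimes> b2)" and ?b = "x2 \<otimes> (x3 \<otimes> b1)" and ?e = "x1 \<otimes> (x2 \<otimes> b3)"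
    have c: "?a \<in> carrier R" "?b \<in> carrier R" "?e \<in> carrier R" using xc b1(1) b2(1) b3(1) by auto
    have "x3 \<otimes> u12 = ?a \<ominus> ?b" "x1 \<otimes> u23 = ?e \<ominus> ?a" "x2 \<otimes> u13 = ?e \<ominus> ?b"
      unfolding u12_def u13_def u23_def using xc b1(1) b2(1) b3(1)
      by (simp_all add: a_minus_def r_distr r_minus m_ac)
    moreover have "(?a \<ominus> ?b) \<oplus> (?e \<ominus> ?a) = (?e \<oplus> ?a) \<ominus> (?b \<oplus> ?a)"
      using c by (simp add: a_minus_def minus_add a_ac)
    ultimately show ?thesis using add_cancel_diff[OF c(3,2,1)] by simp
  qed
  \<comment> \<open>The \<open>I\<close>-invariants that fall into the ideal (x1, x2) of the ring of
    \<open>I\<close>-invariants after inverting \<open>Cs - m\<close>.\<close>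
  define D where "D = {v \<in> fixset I. \<exists>s\<in>Cs - m. \<exists>v1\<in>fixset I. \<exists>v2\<in>fixset I. s \<otimes> v = x1 \<otimes> v1 \<oplus> x2 \<otimes> v2}"
  have D: "ideal D (fixring I)"
  proof -
    interpret FI: cring "fixring I" by (rule cring_fixring[OF IH])
    show ?thesis
    proof (rule FI.ideal_intro)
      show "D \<subseteq> carrier (fixring I)" by (auto simp: D_def)
      have "\<one> \<in> Cs - m" using LC.U_one by simp
      moreover have "\<one> \<otimes> \<zero> = x1 \<otimes> \<zero> \<oplus> x2 \<otimes> \<zero>" using xc by simp
      ultimately show "\<zero>\<^bsub>fixring I\<^esub> \<in> D" unfolding D_def fixring_simps using fixset_zero[OF IH] by blast
    next
      fix v w assume "v \<in> D" "w \<in> D"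
      then obtain s v1 v2 t w1 w2 where
        v: "v \<in> fixset I" "s \<in> Cs" "s \<notin> m" "v1 \<in> fixset I" "v2 \<in> fixset I" "s \<otimes> v = x1 \<otimes> v1 \<oplus> x2 \<otimes> v2" and
        w: "w \<in> fixset I" "t \<in> Cs" "t \<notin> m" "w1 \<in> fixset I" "w2 \<in> fixset I" "t \<otimes> w = x1 \<otimes> w1 \<oplus> x2 \<otimes> w2"
        unfolding D_def by blast
      have cc: "v \<in> carrier R" "s \<in> carrier R" "v1 \<in> carrier R" "v2 \<in> carrier R"
        "w \<in> carrier R" "t \<in> carrier R" "w1 \<in> carrier R" "w2 \<in> carrier R"
        using v w fixset_carr Cs_carr by auto
      have "(s \<otimes> t) \<otimes> (v \<oplus> w) = t \<otimes> (s \<otimes> v) \<oplus> s \<otimes> (t \<otimes> w)" using cc by (simp add: r_distr m_ac)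
      also have "\<dots> = x1 \<otimes> (t \<otimes> v1 \<oplus> s \<otimes> w1) \<oplus> x2 \<otimes> (t \<otimes> v2 \<oplus> s \<otimes> w2)"
        unfolding v(6) w(6) using cc xc by (simp add: r_distr m_ac a_ac)
      finally have "(s \<otimes> t) \<otimes> (v \<oplus> w) = x1 \<otimes> (t \<otimes> v1 \<oplus> s \<otimes> w1) \<oplus> x2 \<otimes> (t \<otimes> v2 \<oplus> s \<otimes> w2)" .
      moreover have "s \<otimes> t \<in> Cs - m" using LC.U_mult[of s t] v w by simp
      moreover have "t \<otimes> v1 \<oplus> s \<otimes> w1 \<in> fixset I" "t \<otimes> v2 \<oplus> s \<otimes> w2 \<in> fixset I" "v \<oplus> w \<in> fixset I"
        using v w CsI by (auto intro!: fixset_add[OF IH] fixset_mult[OF IH])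
      ultimately show "v \<oplus>\<^bsub>fixring I\<^esub> w \<in> D" unfolding D_def fixring_simps by blast
    next
      fix r v assume r: "r \<in> carrier (fixring I)" and "v \<in> D"
      then obtain s v1 v2 where
        v: "v \<in> fixset I" "s \<in> Cs" "s \<notin> m" "v1 \<in> fixset I" "v2 \<in> fixset I" "s \<otimes> v = x1 \<otimes> v1 \<oplus> x2 \<otimes> v2"
        unfolding D_def by blast
      have rf: "r \<in> fixset I" using r by simp
      have cc: "v \<in> carrier R" "s \<in> carrier R" "v1 \<in> carrier R" "v2 \<in> carrier R" "r \<in> carrier R"
        using v rf fixset_carr Cs_carr by auto
      have "s \<otimes> (r \<otimes> v) = r \<otimes> (s \<otimes> v)" using cc by (simp add: m_lcomm)
      also have "\<dots> = x1 \<otimes> (r \<otimes> v1) \<oplus> x2 \<otimes> (r \<otimes> v2)"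
        unfolding v(6) using cc xc by (simp add: r_distr m_lcomm)
      finally have "s \<otimes> (r \<otimes> v) = x1 \<otimes> (r \<otimes> v1) \<oplus> x2 \<otimes> (r \<otimes> v2)" .
      then show "r \<otimes>\<^bsub>fixring I\<^esub> v \<in> D"
        unfolding D_def fixring_simps
        using v(2,3) fixset_mult[OF IH rf v(1)] fixset_mult[OF IH rf v(4)] fixset_mult[OF IH rf v(5)] by blast
    qed
  qed
  \<comment> \<open>Multiplied by \<open>y\<close> and transferred to the full invariants, the
    relation becomes x3 t(u12) + x1 t(u23) = x2 t(u13). There \<open>x3\<close> is regular modulo
    (x1, x2), so t(u12) lies in that ideal locally.\<close>
  have T: "cosum I (\<lambda>g. \<rho> g (u12 \<otimes> y)) \<in> D" if y: "y \<in> fixset I" for y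
  proof -
    define t where "t u = cosum I (\<lambda>g. \<rho> g (u \<otimes> y))" for u
    have yc: "y \<in> carrier R" using y fixset_carr by blast
    have tC: "t u \<in> Cs" if "u \<in> fixset I" for u
      unfolding t_def Cs_def by (rule cosum_act_fixed[OF I fixset_mult[OF IH that y]])
    have lin: "x \<otimes> t u = t (x \<otimes> u)" if "x \<in> Cs" "u \<in> carrier R" for x u
      unfolding t_def using cosum_smult[of x "u \<otimes> y"] that yc Cs_carr by (simp add: m_assoc Cs_def)
    have "x3 \<otimes> t u12 \<oplus> x1 \<otimes> t u23 = t (x3 \<otimes> u12) \<oplus> t (x1 \<otimes> u23)" using lin xC uc by simp
    also have "\<dots> = t (x3 \<otimes> u12 \<oplus> x1 \<otimes> u23)"
      unfolding t_def using cosum_add[of "x3 \<otimes> u12 \<otimes> y" "x1 \<otimes> u23 \<otimes> y"] xc uc yc by (simp add: l_distr)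
    also have "\<dots> = x2 \<otimes> t u13" unfolding koszul using lin xC uc by simp
    finally have rel: "x3 \<otimes> t u12 \<oplus> x1 \<otimes> t u23 = x2 \<otimes> t u13" .
    define K1 where "K1 = LC.adj LC.zero_sat x1"
    define K2 where "K2 = LC.adj K1 x2"
    have idZ: "ideal LC.zero_sat C" by (rule LC.sat_ideal[OF LC.saturated_zero_sat])
    have idK1: "ideal K1 C" unfolding K1_def by (rule LC.sat_ideal[OF LC.saturated_adj[OF idZ]]) (simp add: xC)
    have idK2: "ideal K2 C" unfolding K2_def by (rule LC.sat_ideal[OF LC.saturated_adj[OF idK1]]) (simp add: xC)
    have tt: "t u12 \<in> Cs" "t u13 \<in> Cs" "t u23 \<in> Cs" using tC uf by auto
    have "x1 \<otimes> t u23 \<in> K1" unfolding K1_def using LC.adj_multiple[OF idZ, of x1 "t u23"] xC tt by simp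
    then have 1: "x1 \<otimes> t u23 \<in> K2" unfolding K2_def using LC.adj_superset[OF idK1, of x2] xC by auto
    have 2: "x2 \<otimes> t u13 \<in> K2" unfolding K2_def using LC.adj_multiple[OF idK1, of x2 "t u13"] xC tt by simp
    have "x2 \<otimes> t u13 \<ominus>\<^bsub>C\<^esub> x1 \<otimes> t u23 \<in> K2" by (rule F.ideal_diff[OF idK2 2 1])
    moreover have "x2 \<otimes> t u13 \<ominus>\<^bsub>C\<^esub> x1 \<otimes> t u23 = x3 \<otimes> t u12"
      unfolding rel[symmetric] using F.add_diff_cancel[of "x3 \<otimes> t u12" "x1 \<otimes> t u23"] Cs_mult xC tt by simp
    ultimately have "x3 \<otimes> t u12 \<in> K2" by simp
    then have "t u12 \<in> K2"
      using LC.nzdD[OF x3(2)] tt unfolding K2_def K1_def by simp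
    then obtain s r where s: "s \<in> Cs" "s \<notin> m" "r \<in> Cs" "F.congr K1 (s \<otimes> t u12) (x2 \<otimes> r)"
      unfolding K2_def C_simps(2)[symmetric] C_simps(1)[symmetric] by (rule LC.adjE) blast
    have "s \<otimes> t u12 \<ominus>\<^bsub>C\<^esub> x2 \<otimes> r \<in> K1" using s(4) by (simp add: F.congr_def)
    then have "s \<otimes> t u12 \<ominus> x2 \<otimes> r \<in> K1" using C_diff Cs_mult s tt xC by simp
    then obtain s' r' where s': "s' \<in> Cs" "s' \<notin> m" "r' \<in> Cs"
      "F.congr LC.zero_sat (s' \<otimes> (s \<otimes> t u12 \<ominus> x2 \<otimes> r)) (x1 \<otimes> r')"
      unfolding K1_def C_simps(2)[symmetric] C_simps(1)[symmetric] by (rule LC.adjE) blast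
    have "s' \<otimes> (s \<otimes> t u12 \<ominus> x2 \<otimes> r) \<ominus>\<^bsub>C\<^esub> x1 \<otimes> r' \<in> LC.zero_sat" using s'(4) by (simp add: F.congr_def)
    then have "s' \<otimes> (s \<otimes> t u12 \<ominus> x2 \<otimes> r) \<ominus> x1 \<otimes> r' \<in> LC.zero_sat"
      using C_diff Cs_mult Cs_diff s s' tt xC by simp
    then obtain s'' where s'': "s'' \<in> Cs" "s'' \<notin> m" "s'' \<otimes> (s' \<otimes> (s \<otimes> t u12 \<ominus> x2 \<otimes> r) \<ominus> x1 \<otimes> r') = \<zero>"
      unfolding LC.zero_sat_def by auto
    have cc: "s \<in> carrier R" "r \<in> carrier R" "s' \<in> carrier R" "r' \<in> carrier R" "s'' \<in> carrier R" "t u12 \<in> carrier R"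
      using s s' s'' tt Cs_carr by auto
    have "(s'' \<otimes> s') \<otimes> (s \<otimes> t u12) = s'' \<otimes> (x1 \<otimes> r') \<oplus> (s'' \<otimes> s') \<otimes> (x2 \<otimes> r)"
      by (rule cleared_denominators[OF _ _ _ _ _ s''(3)]) (use cc xc in auto)
    then have "(s'' \<otimes> s' \<otimes> s) \<otimes> t u12 = x1 \<otimes> (s'' \<otimes> r') \<oplus> x2 \<otimes> (s'' \<otimes> s' \<otimes> r)"
      using cc xc by (simp add: m_ac)
    moreover have "s'' \<otimes> s' \<otimes> s \<in> Cs - m"
      using LC.U_mult[of "s'' \<otimes> s'" s] LC.U_mult[of s'' s'] s s' s'' by simp
    moreover have "s'' \<otimes> r' \<in> fixset I" "s'' \<otimes> s' \<otimes> r \<in> fixset I" "t u12 \<in> fixset I"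
      using CsI Cs_mult s s' s'' tt by auto
    ultimately show ?thesis unfolding D_def t_def[symmetric] by blast
  qed
  obtain \<phi> where \<phi>: "separable I \<phi>" "\<phi> \<one>\<^bsub>H\<^esub> \<notin> P" "\<And>g. g \<in> carrier H \<Longrightarrow> g \<notin> I \<Longrightarrow> \<phi> g = \<zero>"
    using separable_inertia[OF P] unfolding IP by blast
  define s0 where "s0 = \<phi> \<one>\<^bsub>H\<^esub>"
  have s0: "s0 \<in> fixset I" "s0 \<notin> P" unfolding s0_def using separable_one_fixed[OF I \<phi>(1)] \<phi>(2) by auto
  have "u12 \<otimes> s0 \<in> D" unfolding s0_def by (rule separable_descent[OF I \<phi>(1,3) uf(1) D T])
  then obtain s v1 v2 where s: "s \<in> Cs" "s \<notin> m" and v: "v1 \<in> fixset I" "v2 \<in> fixset I"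
    "s \<otimes> (u12 \<otimes> s0) = x1 \<otimes> v1 \<oplus> x2 \<otimes> v2"
    unfolding D_def by blast
  have sP: "s \<notin> P" using s m(2) by blast
  define t where "t = s \<otimes> s0"
  have tf: "t \<in> fixset I" unfolding t_def by (rule fixset_mult[OF IH CsI[OF s(1)] s0(1)])
  have tP: "t \<notin> P" unfolding t_def
    using primeideal.I_prime[OF P, of s s0] s0 sP s(1) Cs_carr fixset_carr by blast
  have cc: "t \<in> carrier R" "v1 \<in> carrier R" "v2 \<in> carrier R" "s \<in> carrier R" "s0 \<in> carrier R"
    using tf v fixset_carr s s0 Cs_carr by auto
  have tu: "t \<otimes> u12 = x1 \<otimes> v1 \<oplus> x2 \<otimes> v2" using v(3) cc uc by (simp add: t_def m_ac)
  \<comment> \<open>\<open>w\<close> is \<open>b1\<close> changed by the factor \<open>t\<close> and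
    an \<open>I\<close>-invariant summand, so that x2 w becomes a multiple of \<open>x1\<close>.
    Regularity of \<open>x2\<close> modulo \<open>x1\<close> on \<open>R\<close> then divides
    \<open>w\<close> itself by \<open>x1\<close>, up to a denominator.\<close>
  define w where "w = t \<otimes> b1 \<oplus> v2"
  have wc: "w \<in> carrier R" using cc b1 by (simp add: w_def)
  have xw: "x2 \<otimes> w = x1 \<otimes> (t \<otimes> b2 \<ominus> v1)"
  proof -
    have "x1 \<otimes> (t \<otimes> b2 \<ominus> v1) \<ominus> x2 \<otimes> w = t \<otimes> u12 \<ominus> (x1 \<otimes> v1 \<oplus> x2 \<otimes> v2)"
      unfolding w_def u12_def using cc xc b1(1) b2(1)
      by (simp add: a_minus_def r_distr r_minus minus_add m_ac a_ac)
    also have "\<dots> = \<zero>" unfolding tu using cc xc by (simp add: diff_eq_zero_iff)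
    finally show ?thesis
      using diff_eq_zero_iff[of "x1 \<otimes> (t \<otimes> b2 \<ominus> v1)" "x2 \<otimes> w"] cc xc b2(1) wc by simp
  qed
  have idZR: "ideal LR.zero_sat R" by (rule LR.sat_ideal[OF LR.saturated_zero_sat])
  have "x2 \<otimes> w \<in> LR.adj LR.zero_sat x1"
    unfolding xw by (rule LR.adj_multiple[OF idZR]) (use cc xc b2 in auto)
  then have "w \<in> LR.adj LR.zero_sat x1" by (rule LR.nzdD[OF x2(2) wc])
  then obtain s2 r where s2: "s2 \<in> carrier R" "s2 \<notin> M" "r \<in> carrier R" "congr LR.zero_sat (s2 \<otimes> w) (x1 \<otimes> r)"
    by (rule LR.adjE) blast
  have "s2 \<otimes> w \<ominus> x1 \<otimes> r \<in> LR.zero_sat" using s2(4) by (simp add: congr_def)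
  then obtain s3 where s3: "s3 \<in> carrier R" "s3 \<notin> M" "s3 \<otimes> (s2 \<otimes> w \<ominus> x1 \<otimes> r) = \<zero>"
    unfolding LR.zero_sat_def by auto
  define d where "d = s3 \<otimes> s2"
  have dc: "d \<in> carrier R" using s2 s3 by (simp add: d_def)
  have dM: "d \<notin> M" unfolding d_def using LR.U_mult[of s3 s2] s2 s3 by simp
  have dw: "d \<otimes> w = x1 \<otimes> (s3 \<otimes> r)"
  proof -
    have "d \<otimes> w \<ominus> x1 \<otimes> (s3 \<otimes> r) = s3 \<otimes> (s2 \<otimes> w \<ominus> x1 \<otimes> r)"
      unfolding d_def using s2 s3 wc xc by (simp add: a_minus_def r_distr r_minus m_ac)
    then show ?thesis
      using s3(3) diff_eq_zero_iff[of "d \<otimes> w" "x1 \<otimes> (s3 \<otimes> r)"] dc wc xc s2 s3 by simp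
  qed
  \<comment> \<open>The denominator \<open>d\<close> need not be fixed by \<open>I\<close>. Its norm
    is, and it stays outside \<open>P\<close> because the inertia group preserves membership in
    \<open>P\<close>.\<close>
  define N where "N = (\<Otimes>h\<in>I. \<rho> h d)"
  have finI: "finite I" by (rule finite_subgroup[OF I])
  have oneI: "\<one>\<^bsub>H\<^esub> \<in> I" by (rule subgroup.one_closed[OF I])
  have \<rho>d: "(\<lambda>h. \<rho> h d) \<in> I \<rightarrow> carrier R" using I_carr dc by auto
  have Nf: "N \<in> fixset I" unfolding N_def by (rule norm_fixed[OF I dc])
  have Nc: "N \<in> carrier R" using Nf fixset_carr by blast
  have NP: "N \<notin> P"
  proof
    assume "N \<in> P"
    then obtain h where h: "h \<in> I" "\<rho> h d \<in> P" unfolding N_def using prime_finprod[OF P finI \<rho>d] by blast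
    then have "d \<in> P" using inertia_mem_iff[OF idP, of h d] dc by (simp add: IP)
    then show False using dM M(2) by blast
  qed
  define d' where "d' = (\<Otimes>h\<in>I - {\<one>\<^bsub>H\<^esub>}. \<rho> h d)"
  have d'c: "d' \<in> carrier R" unfolding d'_def using \<rho>d by (intro finprod_closed) auto
  have Nd: "N = d \<otimes> d'"
  proof -
    have "N = (\<Otimes>h\<in>Set.insert \<one>\<^bsub>H\<^esub> (I - {\<one>\<^bsub>H\<^esub>}). \<rho> h d)" unfolding N_def using oneI by (simp add: insert_absorb)
    also have "\<dots> = \<rho> \<one>\<^bsub>H\<^esub> d \<otimes> d'"
      unfolding d'_def using finI \<rho>d dc by (intro finprod_insert) auto
    finally show ?thesis using act_id[OF dc] by simp
  qed
  define q where "q = d' \<otimes> (s3 \<otimes> r)"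
  have qc: "q \<in> carrier R" unfolding q_def using d'c s2 s3 by simp
  have Nw: "N \<otimes> w = x1 \<otimes> q"
  proof -
    have "N \<otimes> w = d' \<otimes> (d \<otimes> w)" unfolding Nd using dc d'c wc by (simp add: m_ac)
    also have "\<dots> = x1 \<otimes> q" unfolding dw q_def using d'c s2 s3 xc by (simp add: m_lcomm)
    finally show ?thesis .
  qed
  have gH: "g \<in> carrier H" and cg: "c g \<in> carrier R" using g I_carr c_carr by auto
  \<comment> \<open>Applying \<open>g\<close> to N w = x1 q adds x1 z on the left. Cancelling
    \<open>x1\<close> identifies \<open>z\<close> with g(q) - q up to a denominator outside
    \<open>M\<close>; this puts \<open>z\<close> into \<open>P\<close>, although \<open>N\<close>,
    \<open>t\<close> and \<open>c g\<close> are all outside \<open>P\<close>.\<close>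
  define z where "z = N \<otimes> (t \<otimes> c g)"
  have zc: "z \<in> carrier R" unfolding z_def using Nc cc cg by simp
  have "\<rho> g (N \<otimes> w) = N \<otimes> (t \<otimes> (b1 \<oplus> x1 \<otimes> c g) \<oplus> v2)"
    unfolding w_def using gH Nc cc b1 fixsetD[OF Nf g(1)] fixsetD[OF tf g(1)] fixsetD[OF v(2) g(1)] g(1)
    by (simp add: act_mult act_add)
  also have "\<dots> = N \<otimes> w \<oplus> x1 \<otimes> z"
    unfolding w_def z_def using Nc cc b1(1) xc cg by (simp add: r_distr m_ac a_ac)
  finally have "x1 \<otimes> \<rho> g q = x1 \<otimes> q \<oplus> x1 \<otimes> z"
    unfolding Nw using gH xc qc fixsetD[OF CsI[OF xC(1)] g(1)] by (simp add: act_mult)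
  then have eq: "x1 \<otimes> (z \<ominus> (\<rho> g q \<ominus> q)) = \<zero>"
  proof -
    assume e: "x1 \<otimes> \<rho> g q = x1 \<otimes> q \<oplus> x1 \<otimes> z"
    have "x1 \<otimes> (z \<ominus> (\<rho> g q \<ominus> q)) = (x1 \<otimes> q \<oplus> x1 \<otimes> z) \<ominus> x1 \<otimes> \<rho> g q"
      using xc zc qc gH by (simp add: a_minus_def r_distr r_minus minus_add a_ac)
    then show ?thesis using e xc zc qc by (simp add: diff_eq_zero_iff)
  qed
  have ec: "z \<ominus> (\<rho> g q \<ominus> q) \<in> carrier R" using zc qc gH by simp
  have "z \<ominus> (\<rho> g q \<ominus> q) \<in> LR.zero_sat"
    by (rule LR.nzdD[OF x1(2) ec]) (simp add: eq ideal_zero[OF idZR])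
  then obtain s4 where s4: "s4 \<in> carrier R" "s4 \<notin> M" "s4 \<otimes> (z \<ominus> (\<rho> g q \<ominus> q)) = \<zero>"
    unfolding LR.zero_sat_def by auto
  then have "z \<ominus> (\<rho> g q \<ominus> q) \<in> P"
    using primeideal.I_prime[OF P s4(1) ec] ideal_zero[OF idP] M(2) by auto
  moreover have "\<rho> g q \<ominus> q \<in> P" using g(1) qc by (simp add: IP inertia_def)
  ultimately have "z \<in> P" using ideal_cancel_right[OF idP _ _ zc] by blast
  then show False
    unfolding z_def using primeideal.I_prime[OF P Nc, of "t \<otimes> c g"] primeideal.I_prime[OF P cc(1) cg] NP tP g(2) cc cg by auto
qed

end

section \<open>Quotient actions and the theorem\<close>

lemma (in cring) nat_mod_one:
  fixes n p :: nat
  assumes "add_pow R (p) \<one> = \<zero>" shows "add_pow R (n) \<one> = add_pow R ((n mod p)) \<one>"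
proof -
  have "add_pow R (n) \<one> = add_pow R ((p * (n div p))) \<one> \<oplus> add_pow R ((n mod p)) \<one>"
    using add.nat_pow_mult[of \<one> "p * (n div p)" "n mod p"] by simp
  also have "add_pow R ((p * (n div p))) \<one> = add_pow R (n div p) (add_pow R p \<one>)"
    by (rule add.nat_pow_pow[symmetric]) simp
  also have "\<dots> = \<zero>" using assms by (simp add: add.nat_pow_one)
  finally show ?thesis by (simp add: add.nat_pow_closed)
qed

context ring_action
begin

text \<open>A homomorphism to the integers modulo \<open>p\<close> becomes a cocycle when its values
  are read as multiples of 1, which the whole group fixes. A nonzero residue is invertible modulo
  \<open>p\<close>, by Bezout, and therefore lies in no prime ideal.\<close>

lemma p_group_inertia_contradiction:
  fixes p :: nat
  assumes cmR: "cohen_macaulay R" and cmC: "cohen_macaulay (fixring (carrier H))"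
    and no_reflection: "\<And>Q. primeideal Q R \<Longrightarrow> height R Q \<le> 2 \<Longrightarrow> inertia Q = {\<one>\<^bsub>H\<^esub>}"
    and P: "primeideal P R" and p: "Factorial_Ring.prime p" and char: "add_pow R (p) \<one> = \<zero>"
    and nontriv: "inertia P \<noteq> {\<one>\<^bsub>H\<^esub>}" and card: "card (inertia P) = p ^ k"
  shows False
proof -
  define I where "I = inertia P"
  have idP: "ideal P R" using P by (rule primeideal.axioms(1))
  have I: "subgroup I H" unfolding I_def by (rule inertia_subgroup[OF idP])
  define J where "J = H\<lparr>carrier := I\<rparr>"
  have J: "group J" unfolding J_def by (rule subgroup.subgroup_is_group[OF I group_H])
  obtain \<chi> :: "'g \<Rightarrow> int" where
    \<chi>: "\<And>g h. g \<in> carrier J \<Longrightarrow> h \<in> carrier J \<Longrightarrow> \<chi> (g \<otimes>\<^bsub>J\<^esub> h) mod int p = (\<chi> g + \<chi> h) mod int p"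
      "\<exists>g\<in>carrier J. \<chi> g mod int p \<noteq> 0"
    by (rule p_group_hom_mod[OF J p]) (use nontriv card in \<open>auto simp: J_def I_def\<close>)
  have p0: "0 < p" using prime_gt_0_nat[OF p] .
  define n where "n g = nat (\<chi> g mod int p)" for g
  have n_mult: "n (g \<otimes>\<^bsub>H\<^esub> h) = (n g + n h) mod p" if "g \<in> I" "h \<in> I" for g h
  proof -
    have "int (n (g \<otimes>\<^bsub>H\<^esub> h)) = int ((n g + n h) mod p)"
      using \<chi>(1)[of g h] that p0 by (simp add: n_def J_def zmod_int mod_simps)
    then show ?thesis by linarith
  qed
  have fixed_nat: "add_pow R (k) \<one> \<in> fixset (carrier H)" for k :: nat
  proof (induction k)
    case (Suc k)
    then show ?case using fixset_add[OF subset_refl _ fixset_one[OF subset_refl]] by simp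
  qed (use fixset_zero[OF subset_refl] in simp)
  interpret additive_character R H \<rho> I "\<lambda>g. add_pow R (n g) \<one>"
  proof (intro additive_character.intro additive_character_axioms.intro ring_action_axioms I fixed_nat)
    fix g h assume "g \<in> I" "h \<in> I"
    then show "add_pow R (n (g \<otimes>\<^bsub>H\<^esub> h)) \<one> = add_pow R (n g) \<one> \<oplus> add_pow R (n h) \<one>"
      using n_mult nat_mod_one[OF char, of "n g + n h"] add.nat_pow_mult[of \<one> "n g" "n h"] by simp
  qed
  obtain g where g: "g \<in> I" "\<chi> g mod int p \<noteq> 0" using \<chi>(2) by (auto simp: J_def)
  have ng: "0 < n g" "n g < p"
    using g(2) p0 pos_mod_bound[of "int p" "\<chi> g"] pos_mod_sign[of "int p" "\<chi> g"] unfolding n_def by linarith+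
  have "add_pow R (n g) \<one> \<notin> P"
  proof
    assume inP: "add_pow R (n g) \<one> \<in> P"
    have "coprime (n g) p"
      using ng p by (metis coprime_commute nat_dvd_not_less prime_imp_coprime_nat)
    then obtain x y where xy: "n g * x = p * y + 1"
      using bezout_nat[of "n g" p] ng by (metis coprime_imp_gcd_eq_1 not_gr0)
    have "add_pow R ((n g * x)) \<one> = add_pow R ((p * y + 1)) \<one>" using xy by simp
    moreover have "add_pow R ((n g * x)) \<one> = add_pow R x (add_pow R (n g) \<one>)"
      by (rule add.nat_pow_pow[symmetric]) simp
    moreover have "add_pow R x (add_pow R (n g) \<one>) \<in> P"
      by (induction x) (use inP ideal_zero[OF idP] ideal_add[OF idP] in auto)
    moreover have "add_pow R ((p * y + 1)) \<one> = add_pow R (((p * y + 1) mod p)) \<one>" by (rule nat_mod_one[OF char])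
    moreover have "(p * y + 1) mod p = 1" using ng by (simp add: mod_mult_self4 mod_Suc)
    ultimately have "\<one> \<in> P" by simp
    then show False using prime_one_notin[OF P] by blast
  qed
  then show False
    using not_both_cohen_macaulay[OF cmR cmC no_reflection P I_def g(1)] by blast
qed

lemma act_fixset:
  assumes K: "K \<lhd> H" and g: "g \<in> carrier H" and a: "a \<in> fixset K" shows "\<rho> g a \<in> fixset K"
proof (rule fixsetI)
  have KH: "K \<subseteq> carrier H" using subgroup_subset[OF normal.axioms(1)[OF K]] .
  have ac: "a \<in> carrier R" using a fixset_carr by blast
  then show "\<rho> g a \<in> carrier R" using g by simp
  fix k assume k: "k \<in> K"
  then have kc: "k \<in> carrier H" using KH by blast
  have m: "inv\<^bsub>H\<^esub> g \<otimes>\<^bsub>H\<^esub> k \<otimes>\<^bsub>H\<^esub> g \<in> K" using normal.inv_op_closed1[OF K g k] .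
  have "k \<otimes>\<^bsub>H\<^esub> g = g \<otimes>\<^bsub>H\<^esub> (inv\<^bsub>H\<^esub> g \<otimes>\<^bsub>H\<^esub> k \<otimes>\<^bsub>H\<^esub> g)"
    using g kc by (simp add: H.m_assoc[symmetric])
  then have "\<rho> k (\<rho> g a) = \<rho> (g \<otimes>\<^bsub>H\<^esub> (inv\<^bsub>H\<^esub> g \<otimes>\<^bsub>H\<^esub> k \<otimes>\<^bsub>H\<^esub> g)) a"
    using act_comp[OF kc g ac] by simp
  also have "\<dots> = \<rho> g (\<rho> (inv\<^bsub>H\<^esub> g \<otimes>\<^bsub>H\<^esub> k \<otimes>\<^bsub>H\<^esub> g) a)"
    by (rule act_comp[OF g _ ac]) (use m KH in blast)
  also have "\<dots> = \<rho> g a" using fixsetD[OF a m] by simp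
  finally show "\<rho> k (\<rho> g a) = \<rho> g a" .
qed

lemma subgroup_action:
  assumes "subgroup K H" shows "ring_action R (H\<lparr>carrier := K\<rparr>) \<rho>"
proof (intro ring_action.intro ring_action_axioms.intro cring_axioms)
  show "group (H\<lparr>carrier := K\<rparr>)" by (rule subgroup.subgroup_is_group[OF assms group_H])
qed (use finite_subgroup[OF assms] act_hom act_comp act_id subgroup_subset[OF assms] in \<open>auto simp: subset_iff\<close>)

end

text \<open>The map \<open>\<phi>\<close> is prescribed only for cosets acting on invariants, so
  that \<open>coset_action\<close> can be inserted at the end without being unfolded in the general
  theory.\<close>

locale quotient_ring_action = ring_action R H \<rho> for R (structure) and H :: "('g, 'h) monoid_scheme" and \<rho> +
  fixes K :: "'g set" and \<phi> :: "'g set \<Rightarrow> 'a \<Rightarrow> 'a"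
  assumes K: "K \<lhd> H"
    and \<phi>: "g \<in> carrier H \<Longrightarrow> a \<in> fixset K \<Longrightarrow> \<phi> (K #>\<^bsub>H\<^esub> g) a = \<rho> g a"
begin

lemma subgroup_K: "subgroup K H"
  using K by (rule normal.axioms(1))

lemma K_carr: "K \<subseteq> carrier H"
  by (rule subgroup_subset[OF subgroup_K])

lemma carrier_quotient: "carrier (H Mod K) = (\<lambda>g. K #>\<^bsub>H\<^esub> g) ` carrier H"
  by (auto simp: FactGroup_def RCOSETS_def)

lemma one_quotient: "\<one>\<^bsub>H Mod K\<^esub> = K"
  by (simp add: FactGroup_def)

sublocale quot: ring_action "fixring K" "H Mod K" \<phi>
proof (intro ring_action.intro ring_action_axioms.intro)
  show "cring (fixring K)" by (rule cring_fixring[OF K_carr])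
  show "group (H Mod K)" by (rule normal.factorgroup_is_group[OF K])
  show "finite (carrier (H Mod K))" unfolding carrier_quotient using finite_H by simp
next
  fix Y assume "Y \<in> carrier (H Mod K)"
  then obtain g where g: "g \<in> carrier H" "Y = K #>\<^bsub>H\<^esub> g" unfolding carrier_quotient by blast
  show "\<phi> Y \<in> ring_hom (fixring K) (fixring K)"
    by (rule ring_hom_memI)
      (use g \<phi> act_fixset[OF K] fixset_mult[OF K_carr] fixset_add[OF K_carr] fixset_one[OF K_carr] fixset_carr
        in \<open>auto simp: act_mult act_add act_one\<close>)
next
  fix Y Z a assume "Y \<in> carrier (H Mod K)" "Z \<in> carrier (H Mod K)" and a: "a \<in> carrier (fixring K)"
  then obtain g h where g: "g \<in> carrier H" "Y = K #>\<^bsub>H\<^esub> g" and h: "h \<in> carrier H" "Z = K #>\<^bsub>H\<^esub> h"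
    unfolding carrier_quotient by blast
  have af: "a \<in> fixset K" using a by simp
  have "Y \<otimes>\<^bsub>H Mod K\<^esub> Z = K #>\<^bsub>H\<^esub> (g \<otimes>\<^bsub>H\<^esub> h)"
    using normal.rcos_sum[OF K g(1) h(1)] g h by (simp add: FactGroup_def)
  then show "\<phi> (Y \<otimes>\<^bsub>H Mod K\<^esub> Z) a = \<phi> Y (\<phi> Z a)"
    using g h af \<phi> act_fixset[OF K] act_comp fixset_carr by simp
next
  fix a assume a: "a \<in> carrier (fixring K)"
  have "K #>\<^bsub>H\<^esub> \<one>\<^bsub>H\<^esub> = K" by (rule H.coset_mult_one[OF K_carr])
  then show "\<phi> \<one>\<^bsub>H Mod K\<^esub> a = a"
    using \<phi>[OF H.one_closed, of a] a act_id fixset_carr by (simp add: one_quotient)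
qed

lemma quot_fixring: "quot.fixring (carrier (H Mod K)) = fixring (carrier H)"
proof -
  have eq: "quot.fixset (carrier (H Mod K)) = fixset (carrier H)"
  proof (intro equalityI subsetI)
    fix a assume a: "a \<in> quot.fixset (carrier (H Mod K))"
    then have aK: "a \<in> fixset K" by (simp add: quot.fixset_def)
    show "a \<in> fixset (carrier H)"
    proof (rule fixsetI)
      fix g assume g: "g \<in> carrier H"
      then have "\<phi> (K #>\<^bsub>H\<^esub> g) a = a" using a by (simp add: quot.fixset_def carrier_quotient)
      then show "\<rho> g a = a" using \<phi>[OF g aK] by simp
    qed (rule fixset_carr[OF aK])
  next
    fix a assume a: "a \<in> fixset (carrier H)"
    then have aK: "a \<in> fixset K" using fixset_antimono[OF K_carr] by blast
    then show "a \<in> quot.fixset (carrier (H Mod K))"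
      using \<phi>[OF _ aK] fixsetD[OF a] by (auto simp: quot.fixset_def carrier_quotient)
  qed
  show ?thesis unfolding quot.fixring_def eq by (simp add: fixring_def)
qed

text \<open>A prime \<open>P\<close> above \<open>Q\<close> has height at most \<open>t\<close>, so
  \<open>refl\<close> puts its inertia group into \<open>K\<close>. A representative of a coset that
  acts trivially modulo \<open>Q\<close> then belongs to \<open>K\<close> by
  \<open>mem_of_trivial_on_fixset\<close>.\<close>

lemma quot_inertia_trivial:
  assumes refl: "\<And>P. primeideal P R \<Longrightarrow> height R P \<le> t \<Longrightarrow> inertia P \<subseteq> K"
    and Q: "primeideal Q (fixring K)" "height (fixring K) Q \<le> t"
  shows "quot.inertia Q = {\<one>\<^bsub>H Mod K\<^esub>}"
proof
  interpret N: ring_action R "H\<lparr>carrier := K\<rparr>" \<rho> by (rule subgroup_action[OF subgroup_K])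
  obtain P where P: "primeideal P R" "P \<inter> fixset K = Q"
    by (rule N.lying_over[of Q]) (use Q(1) in simp_all)
  have "height R P \<le> t" using N.height_contract[OF P(1)] Q(2) P(2) by (simp add: order_trans)
  then have inK: "inertia P \<subseteq> K" by (rule refl[OF P(1)])
  show "quot.inertia Q \<subseteq> {\<one>\<^bsub>H Mod K\<^esub>}"
  proof
    fix Y assume Y: "Y \<in> quot.inertia Q"
    then obtain g where g: "g \<in> carrier H" "Y = K #>\<^bsub>H\<^esub> g"
      unfolding quot.inertia_def carrier_quotient by blast
    have "g \<in> K"
    proof (rule mem_of_trivial_on_fixset[OF subgroup_K P(1) _ g(1)])
      show "h \<in> K" if "h \<in> carrier H" "\<forall>a\<in>carrier R. \<rho> h a \<ominus> a \<in> P" for h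
        using inK that by (auto simp: inertia_def)
      fix b assume b: "b \<in> fixset K"
      have "\<phi> Y b \<ominus>\<^bsub>fixring K\<^esub> b \<in> Q" using Y b by (simp add: quot.inertia_def)
      then show "\<rho> g b \<ominus> b \<in> P"
        using fixring_diff[OF K_carr act_fixset[OF K g(1) b] b] \<phi>[OF g(1) b] g(2) P(2) by auto
    qed
    then have "Y = K" using g(2) H.coset_join2[OF g(1) subgroup_K] by simp
    then show "Y \<in> {\<one>\<^bsub>H Mod K\<^esub>}" by (simp add: one_quotient)
  qed
  show "{\<one>\<^bsub>H Mod K\<^esub>} \<subseteq> quot.inertia Q"
    using subgroup.one_closed[OF quot.inertia_subgroup[OF primeideal.axioms(1)[OF Q(1)]]] by simp
qed

end

section \<open>Groups of ring automorphisms as group actions\<close>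

lemma ring_aut_group_subgroup:
  fixes R (structure)
  assumes "ring R"
  shows "subgroup (ring_hom R R \<inter> Bij (carrier R)) (BijGroup (carrier R))"
proof -
  interpret ring R by fact
  interpret B: group "BijGroup (carrier R)" by (rule group_BijGroup)
  have Bij_closed: "f a \<in> carrier R" if "f \<in> Bij (carrier R)" "a \<in> carrier R" for f a
    using that Bij_imp_funcset by blast
  show ?thesis
  proof (rule B.subgroupI)
    show "ring_hom R R \<inter> Bij (carrier R) \<subseteq> carrier (BijGroup (carrier R))" by (simp add: BijGroup_def)
    have "(\<lambda>x\<in>carrier R. x) \<in> ring_hom R R" by (rule ring_hom_memI) auto
    then show "ring_hom R R \<inter> Bij (carrier R) \<noteq> {}" using id_Bij by blast
    fix f assume f: "f \<in> ring_hom R R \<inter> Bij (carrier R)"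
    let ?i = "\<lambda>x\<in>carrier R. inv_into (carrier R) f x"
    have iB: "?i \<in> Bij (carrier R)" using f by (simp add: restrict_inv_into_Bij)
    have im: "f ` carrier R = carrier R" and inj: "inj_on f (carrier R)" using f by (auto simp: Bij_def bij_betw_def)
    have fi: "f (?i x) = x" if "x \<in> carrier R" for x using that im by (simp add: f_inv_into_f)
    have eq: "x = y" if "x \<in> carrier R" "y \<in> carrier R" "f x = f y" for x y
      by (rule inj_onD[OF inj that(3,1,2)])
    have ic: "?i x \<in> carrier R" if "x \<in> carrier R" for x using Bij_closed[OF iB that] .
    have fh: "f \<in> ring_hom R R" using f by simp
    have "?i \<in> ring_hom R R"
    proof (rule ring_hom_memI)
      fix x y assume x: "x \<in> carrier R" and y: "y \<in> carrier R"
      show "?i x \<in> carrier R" by (rule ic[OF x])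
      show "?i (x \<otimes> y) = ?i x \<otimes> ?i y"
        by (rule eq) (use x y ic fi ring_hom_mult[OF fh ic[OF x] ic[OF y]] in \<open>simp_all del: restrict_apply'\<close>)
      show "?i (x \<oplus> y) = ?i x \<oplus> ?i y"
        by (rule eq) (use x y ic fi ring_hom_add[OF fh ic[OF x] ic[OF y]] in \<open>simp_all del: restrict_apply'\<close>)
    next
      show "?i \<one> = \<one>" by (rule eq) (use ic fi ring_hom_one[OF fh] in \<open>simp_all del: restrict_apply'\<close>)
    qed
    then show "inv\<^bsub>BijGroup (carrier R)\<^esub> f \<in> ring_hom R R \<inter> Bij (carrier R)"
      using f iB by (simp add: inv_BijGroup)
    fix g assume g: "g \<in> ring_hom R R \<inter> Bij (carrier R)"
    then have gh: "g \<in> ring_hom R R" by simp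
    have "compose (carrier R) f g \<in> ring_hom R R"
      by (rule ring_hom_memI)
        (auto simp: compose_eq ring_hom_closed[OF fh] ring_hom_closed[OF gh] ring_hom_mult[OF fh] ring_hom_mult[OF gh]
          ring_hom_add[OF fh] ring_hom_add[OF gh] ring_hom_one[OF fh] ring_hom_one[OF gh])
    then show "f \<otimes>\<^bsub>BijGroup (carrier R)\<^esub> g \<in> ring_hom R R \<inter> Bij (carrier R)"
      using f g compose_Bij[of f "carrier R" g] by (simp add: BijGroup_def)
  qed
qed

lemma group_ring_aut_group: "ring R \<Longrightarrow> group (ring_aut_group R)"
  unfolding ring_aut_group_def
  by (rule subgroup.subgroup_is_group[OF ring_aut_group_subgroup group_BijGroup])

lemma ring_action_aut:
  assumes A: "cring A" and G: "subgroup G (ring_aut_group A)" and fin: "finite G"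
  shows "ring_action A (ring_aut_group A\<lparr>carrier := G\<rparr>) (\<lambda>g. g)"
proof (intro ring_action.intro ring_action_axioms.intro A)
  interpret A: cring A by (rule A)
  have sub: "g \<in> ring_hom A A \<inter> Bij (carrier A)" if "g \<in> G" for g
    using that subgroup.subset[OF G] by (auto simp: ring_aut_group_def)
  show "group (ring_aut_group A\<lparr>carrier := G\<rparr>)"
    by (rule subgroup.subgroup_is_group[OF G group_ring_aut_group[OF A.ring_axioms]])
  show "finite (carrier (ring_aut_group A\<lparr>carrier := G\<rparr>))" using fin by simp
  show "g \<in> ring_hom A A" if "g \<in> carrier (ring_aut_group A\<lparr>carrier := G\<rparr>)" for g
    using sub that by simp
  show "(g \<otimes>\<^bsub>ring_aut_group A\<lparr>carrier := G\<rparr>\<^esub> h) a = g (h a)"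
    if "g \<in> carrier (ring_aut_group A\<lparr>carrier := G\<rparr>)" "h \<in> carrier (ring_aut_group A\<lparr>carrier := G\<rparr>)"
      "a \<in> carrier A" for g h a
    using that sub by (simp add: ring_aut_group_def BijGroup_def compose_eq)
  show "\<one>\<^bsub>ring_aut_group A\<lparr>carrier := G\<rparr>\<^esub> a = a" if "a \<in> carrier A" for a
    using that by (simp add: ring_aut_group_def BijGroup_def)
qed

lemma (in ring) subfield_card_mult_one:
  assumes F: "subfield F R" and fin: "finite F" shows "add_pow R ((card F)) \<one> = \<zero>"
proof -
  have sub: "subring F R" using F by (simp add: subfield_def subdomain_def subcring_def)
  interpret F: ring "R\<lparr>carrier := F\<rparr>" by (rule subring_is_ring[OF sub])
  have "add_pow (R\<lparr>carrier := F\<rparr>) n \<one> = add_pow R (n) \<one>" for n :: nat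
    by (induction n) (simp_all add: add_pow_def)
  moreover have "add_pow (R\<lparr>carrier := F\<rparr>) (card F) \<one> = \<zero>"
    using group.pow_order_eq_1[OF F.a_group, of \<one>] F.one_closed by (simp add: add_pow_def order_def)
  ultimately show ?thesis by simp
qed

theorem proposition3p11:
  fixes A :: "('a, 'b) ring_scheme"
    and p :: nat
    and F :: "'a set"
    and G N :: "('a \<Rightarrow> 'a) set"
  defines "quot \<equiv> (ring_aut_group A\<lparr>carrier := G\<rparr>) Mod N"
  assumes "Factorial_Ring.prime p"
    and "cring A"
    and "subfield F A" and "card F = p"
    and "subgroup G (ring_aut_group A)" and "finite G"
    and "N = generate (ring_aut_group A\<lparr>carrier := G\<rparr>) {g \<in> G. t_reflection A 2 g}"
    and "cohen_macaulay (invariant_ring A N)"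
    and "noetherian_ring (invariant_ring A G)"
    and "finite_over (invariant_ring A N) (invariant_ring A G)"
    and "\<exists>P k. primeideal P (invariant_ring A N) \<and>
           inertia_group quot coset_action (invariant_ring A N) P \<noteq> {\<one>\<^bsub>quot\<^esub>} \<and>
           card (inertia_group quot coset_action (invariant_ring A N) P) = p ^ k"
  shows "\<not> cohen_macaulay (invariant_ring A G)"
proof
  assume cmG: "cohen_macaulay (invariant_ring A G)"
  let ?\<Gamma> = "ring_aut_group A\<lparr>carrier := G\<rparr>"
  interpret A: ring_action A ?\<Gamma> "\<lambda>g. g" by (rule ring_action_aut[OF assms(3,6,7)])
  \<comment> \<open>A prime contains the ideal generated by the displacements exactly if it contains
    the displacements, so reflections are the elements of inertia groups of primes of height at most
    2.\<close>
  have refl_iff: "t_reflection A 2 g \<longleftrightarrow> (\<exists>P. primeideal P A \<and> height A P \<le> 2 \<and> g \<in> A.inertia P)"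
    if g: "g \<in> G" for g
  proof -
    have "displacement A g \<subseteq> carrier A" using g A.act_closed by (auto simp: displacement_def)
    then have "genideal A (displacement A g) \<subseteq> P \<longleftrightarrow> displacement A g \<subseteq> P" if "primeideal P A" for P
      using A.Idl_subset_ideal[OF primeideal.axioms(1)[OF that]] by blast
    then show ?thesis
      using g unfolding t_reflection_def A.inertia_def displacement_def
      by (auto simp: numeral_eq_enat image_subset_iff)
  qed
  let ?S = "{g \<in> G. t_reflection A 2 g}"
  \<comment> \<open>A conjugate of a reflection at \<open>P\<close> is a reflection at a conjugate
    prime, whose height is no larger. Hence the reflections generate a normal subgroup.\<close>
  have conj: "g \<otimes>\<^bsub>?\<Gamma>\<^esub> s \<otimes>\<^bsub>?\<Gamma>\<^esub> inv\<^bsub>?\<Gamma>\<^esub> g \<in> ?S" if s: "s \<in> ?S" and g: "g \<in> carrier ?\<Gamma>" for s g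
  proof -
    have sc: "s \<in> carrier ?\<Gamma>" using s by simp
    obtain P where P: "primeideal P A" "height A P \<le> 2" "s \<in> A.inertia P" using refl_iff s by blast
    let ?g' = "inv\<^bsub>?\<Gamma>\<^esub> g"
    have g': "?g' \<in> carrier ?\<Gamma>" using g by (rule A.H.inv_closed)
    let ?c = "g \<otimes>\<^bsub>?\<Gamma>\<^esub> s \<otimes>\<^bsub>?\<Gamma>\<^esub> ?g'"
    have cc: "?c \<in> carrier ?\<Gamma>" using g sc g' by blast
    have "?g' (?c a \<ominus>\<^bsub>A\<^esub> a) \<in> P" if a: "a \<in> carrier A" for a
    proof -
      have b: "?g' a \<in> carrier A" by (rule A.act_closed[OF g' a])
      have "?c a = g (s (?g' a))"
        using A.act_comp[OF A.H.m_closed[OF g sc] g' a] A.act_comp[OF g sc b] by simp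
      moreover have "?g' (g (s (?g' a))) = s (?g' a)" by (rule A.act_inv_left[OF g A.act_closed[OF sc b]])
      ultimately have "?g' (?c a \<ominus>\<^bsub>A\<^esub> a) = s (?g' a) \<ominus>\<^bsub>A\<^esub> ?g' a"
        using A.act_diff[OF g' A.act_closed[OF cc a] a] by simp
      then show ?thesis using P(3) b by (simp add: A.inertia_def)
    qed
    then have "?c \<in> A.inertia (A.pull ?g' P)"
      using cc A.act_closed by (simp add: A.inertia_def A.pull_def)
    moreover have "P \<subseteq> carrier A" using A.ideal_carr[OF primeideal.axioms(1)[OF P(1)]] by blast
    then have "height A (A.pull ?g' P) \<le> 2" using A.height_pull[OF g'] P(2) order_trans by blast
    ultimately show ?thesis using refl_iff[of ?c] A.prime_pull[OF g' P(1)] cc by auto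
  qed
  have normal: "N \<lhd> ?\<Gamma>" unfolding assms(8) by (rule A.H.normal_generateI[OF _ conj]) auto
  have "coset_action (N #>\<^bsub>?\<Gamma>\<^esub> g) a = g a" if g: "g \<in> carrier ?\<Gamma>" and a: "a \<in> A.fixset N" for g a
  proof -
    have ac: "a \<in> carrier A" using a by (rule A.fixset_carr)
    have NG: "N \<subseteq> carrier ?\<Gamma>" by (rule A.subgroup_subset[OF normal.axioms(1)[OF normal]])
    \<comment> \<open>By normality g a is again fixed by \<open>N\<close>, so all members of the
      coset give the same value.\<close>
    have ga: "(n \<otimes>\<^bsub>?\<Gamma>\<^esub> g) a = g a" if "n \<in> N" for n
      using A.act_comp[OF _ g ac] A.fixsetD[OF A.act_fixset[OF normal g a] that] NG that by auto
    have "(\<lambda>f. f a) ` (N #>\<^bsub>?\<Gamma>\<^esub> g) = (\<lambda>n. (n \<otimes>\<^bsub>?\<Gamma>\<^esub> g) a) ` N"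
      unfolding r_coset_def by auto
    also have "\<dots> = (\<lambda>n. g a) ` N" by (rule image_cong[OF HOL.refl ga])
    also have "\<dots> = {g a}" using subgroup.one_closed[OF normal.axioms(1)[OF normal]] by blast
    finally have "(\<lambda>f. f a) ` (N #>\<^bsub>?\<Gamma>\<^esub> g) = {g a}" .
    then show ?thesis by (simp add: coset_action_def)
  qed
  then interpret Q: quotient_ring_action A ?\<Gamma> "\<lambda>g. g" N coset_action
    by (intro quotient_ring_action.intro quotient_ring_action_axioms.intro A.ring_action_axioms normal)
  have inv: "invariant_ring A L = A.fixring L" for L
    by (simp add: invariant_ring_def A.fixring_def A.fixset_def)
  obtain P k where P: "primeideal P (A.fixring N)" "inertia_group quot coset_action (A.fixring N) P \<noteq> {\<one>\<^bsub>quot\<^esub>}"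
    "card (inertia_group quot coset_action (A.fixring N) P) = p ^ k"
    using assms(12) unfolding inv by blast
  have inertia: "inertia_group quot coset_action (A.fixring N) P = Q.quot.inertia P"
    unfolding inertia_group_def Q.quot.inertia_def displacement_def quot_def by auto
  \<comment> \<open>The order of the additive group of the field \<open>F\<close> is
    \<open>p\<close>, so it annihilates 1.\<close>
  have "add_pow A p \<one>\<^bsub>A\<^esub> = \<zero>\<^bsub>A\<^esub>"
    using A.subfield_card_mult_one[OF assms(4)] assms(2,5) prime_gt_0_nat card_ge_0_finite by blast
  moreover have "add_pow (A.fixring N) n \<one>\<^bsub>A\<^esub> = add_pow A n \<one>\<^bsub>A\<^esub>" for n :: nat
    by (induction n) (simp_all add: add_pow_def)
  ultimately have char: "add_pow (A.fixring N) p \<one>\<^bsub>A.fixring N\<^esub> = \<zero>\<^bsub>A.fixring N\<^esub>" by simp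
  show False
  proof (rule Q.quot.p_group_inertia_contradiction[OF _ _ Q.quot_inertia_trivial P(1) assms(2) char])
    show "cohen_macaulay (A.fixring N)" using assms(9) unfolding inv .
    show "cohen_macaulay (Q.quot.fixring (carrier (?\<Gamma> Mod N)))"
      using cmG unfolding inv Q.quot_fixring by simp
    show "A.inertia P \<subseteq> N" if "primeideal P A" "height A P \<le> 2" for P
    proof
      fix g assume g: "g \<in> A.inertia P"
      then have "g \<in> G" by (simp add: A.inertia_def)
      then have "g \<in> ?S" using refl_iff that g by blast
      then show "g \<in> N" unfolding assms(8) by (rule generate.incl)
    qed
    show "Q.quot.inertia P \<noteq> {\<one>\<^bsub>?\<Gamma> Mod N\<^esub>}" by (rule P(2)[unfolded inertia, unfolded quot_def])
    show "card (Q.quot.inertia P) = p ^ k" by (rule P(3)[unfolded inertia])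
  qed
qed

end
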